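(* Let $u,\phi$ be real scalar fields on $\mathbb{R}^3$ with conjugate momenta $p_u,p_\phi$, let $\psi=(u+ip_u)/\sqrt2$, $\psi^*=(u-ip_u)/\sqrt2$, and consider the Klein-Gordon-Wave Hamiltonian $H_\varepsilon=H_0+\varepsilon H_1$, where (all integrals over $\mathbb{R}^3$) $$H_0=h+k,\qquad h=\int|\psi|^2,\qquad k=\int\frac{p_\phi^2}{2},$$ $$H_1=\int\left[\frac{|\nabla\psi+\nabla\psi^*|^2}{4}+\frac{|\nabla\phi|^2}{2}+\frac{\phi(\psi+\psi^* )^2}{2}\right].$$ Then, in the sense of formal power series in $\varepsilon$, there exist two generating Hamiltonians $G_1,G_2$ and a canonical transformation $$\mathcal{C}^{-1}:=\Phi_{G_1}^{\varepsilon}\circ\Phi_{G_2}^{\varepsilon^2}$$ mapping $H_\varepsilon$ into $$\widetilde H_\varepsilon=H_\varepsilon\circ\mathcal{C}^{-1}=H_0+\varepsilon Z_1+\varepsilon^2Z_2+\mathcal{R}_3,$$ which is in normal form to order $2$ with respect to $h$; that is, $\{Z_1,h\}=\{Z_2,h\}=0$ and $\mathcal{R}_3$ is of order $\varepsilon^3$. The components are $$Z_1:=\overline{H_1},\qquad Z_2:=\overline{F_2},\qquad F_2:=L_{G_1}H_1+\tfrac12L_{G_1}^2H_0,$$ with explicit expressions $$Z_1=\int\left[\frac{|\nabla\phi|^2}{2}+\frac{|\nabla\psi|^2}{2}+\phi|\psi|^2\right],$$ $$Z_2=-\frac18\int|\Delta\psi|^2+\frac14\int\phi\left(\psi^*\Delta\psi+\psi\Delta\psi^*\right)+\frac{i}{16}\int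 p_\phi\left(\psi^*\Delta\psi-\psi\Delta\psi^*\right)-\frac12\int\phi^2|\psi|^2+\frac1{16}\int|\psi|^4 .$$ The generating Hamiltonians are $$G_1:=(1+L_h^{-1}L_k)^{-1}L_h^{-1}\,\delta H_1,\qquad \delta H_1:=H_1-\overline{H_1},$$ $$G_2:=(1+L_h^{-1}L_k)^{-1}L_h^{-1}\,\delta F_2,\qquad \delta F_2:=F_2-\overline{F_2},$$ and $G_1$ has the explicit expression $$G_1=\int\left[\frac i8\left((\nabla\psi)^2-(\nabla\psi^* )^2\right)+\frac i4\phi\left(\psi^2-(\psi^* )^2\right)+\frac18p_\phi\left(\psi^2+(\psi^* )^2\right)\right].$$
   Context: Setting and formal sense. The result is formal. Functionals are integrals over $\mathbb{R}^3$ of polynomials in the fields $\psi,\psi^*,\phi,p_\phi$ and their spatial derivatives (and products/linear combinations of such), the fields being smooth and decaying at infinity so that integrations by parts produce no boundary terms. No convergence of series in $\varepsilon$ and no existence of flows of $G_1,G_2$ is claimed. Notation: $(\nabla\psi)^2:=\nabla\psi\cdot\nabla\psi$ (bilinear, no conjugation), $|\nabla\psi|^2=\nabla\psi\cdot\nabla\psi^*$, $|\psi|^2=\psi\psi^*$, $|\Delta\psi|^2=\Delta\psi\,\Delta\psi^*$. Poisson bracket. The bracket is determined by $\{\psi(x),\psi^*(y)\}=-i\delta(x-y)$, $\{\phi(x),p_\phi(y)\}=\delta(x-y)$, the other brackets of the fields (up to antisymmetry) being zero, i.e. $$\{F,G\}=-i\int\left(\frac{\delta F}{\delta\psi}\frac{\delta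 G}{\delta\psi^*}-\frac{\delta F}{\delta\psi^*}\frac{\delta G}{\delta\psi}\right)+\int\left(\frac{\delta F}{\delta\phi}\frac{\delta G}{\delta p_\phi}-\frac{\delta F}{\delta p_\phi}\frac{\delta G}{\delta\phi}\right).$$ In particular $\{h,k\}=0$. Lie derivative and flow. For a Hamiltonian $K$, $L_KF:=\{F,K\}$. $\Phi_K^s$ denotes the Hamiltonian flow of $K$ at time $s$, and composition with it is understood as $F\circ\Phi_K^s=e^{sL_K}F=\sum_{j\ge0}\frac{s^j}{j!}L_K^jF$, a formal series in $s$. Hence $H_\varepsilon\circ\Phi_{G_1}^{\varepsilon}\circ\Phi_{G_2}^{\varepsilon^2}=e^{\varepsilon^2L_{G_2}}e^{\varepsilon L_{G_1}}(H_0+\varepsilon H_1)$ as a formal power series in $\varepsilon$. "$\mathcal R_3$ is of order $\varepsilon^3$" means that it contains only powers $\varepsilon^j$ with $j\ge3$. Average along the flow of $h$. The flow of $h$ is $\Phi_h^s(\psi,\psi^*,\phi,p_\phi)=(e^{-is}\psi,e^{is}\psi^*,\phi,p_\phi)$, which is $2\pi$-periodic. For a functional $F$, $$\overline F:=\frac1{2\pi}\int_0^{2\pi}F\circ\Phi_h^s\,ds,\qquad \delta F:=F-\overline F.$$ Inverse operators. On functionals $F$ with $\overline F=0$, $L_h^{-1}$ is defined by $$L_h^{-1}F:=\frac1{2\pi}\int_0^{2\pi}s\,(F\circ\Phi_h^s)\,ds .$$ The operator $(1+L_h^{-1}L_k)^{-1}$ is defined by the series $\sum_{j\ge0}(-1)^j(L_h^{-1}L_k)^j$,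 which has only finitely many nonzero terms when applied to a functional depending polynomially on $\phi$, since each $L_k$ lowers the degree in $\phi$ by one. Normal form. Let $H_0=h+k$ with $\{h,k\}=0$, both $h$ and $k$ integrable, $h$ with bounded flow and $k$ with unbounded flow. A Hamiltonian is in normal form to order $n$ with respect to $h$ if it has the form $H_0+\sum_{j=1}^n\varepsilon^jZ_j+\mathcal R_{n+1}$ with $\{Z_j,h\}=0$ for $j=1,\dots,n$ and $\mathcal R_{n+1}$ of order $\varepsilon^{n+1}$. *)

theory Defs
  imports
    "HOL-Analysis.Analysis"
    "HOL-Computational_Algebra.Formal_Power_Series"
    "HOL-Library.Function_Algebras"
begin

section \<open>Fields on three-space\<close>

definition pd :: "3 \<Rightarrow> (real^3 \<Rightarrow> 'a::real_normed_vector) \<Rightarrow> real^3 \<Rightarrow> 'a" where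
  "pd i f x = frechet_derivative f (at x) (axis i 1)"

text \<open>``Smooth and decaying at infinity'' is read as membership in the Schwartz class: all iterated
  partial derivatives exist, are differentiable, and decay faster than every power.\<close>

definition schwartz :: "(real^3 \<Rightarrow> 'a::real_normed_vector) \<Rightarrow> bool" where
  "schwartz f \<longleftrightarrow> (\<forall>is. (\<forall>x. foldr pd is f differentiable (at x)) \<and>
     (\<forall>n::nat. \<exists>C. \<forall>x. norm x ^ n * norm (foldr pd is f x) \<le> C))"

lemma pd_const_zero: "pd i (\<lambda>x. 0) = (\<lambda>x. 0)"
  by (rule ext) (simp add: pd_def)

lemma foldr_pd_zero: "foldr pd is (\<lambda>x. 0) = (\<lambda>x. 0)"
  by (induction "is") (simp_all add: pd_const_zero)

lemma schwartz_zero: "schwartz (\<lambda>x. 0)"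
  unfolding schwartz_def by (auto simp: foldr_pd_zero)

lemma foldr_pd_add:
  assumes "schwartz f" "schwartz g"
  shows "foldr pd is (\<lambda>x. f x + g x) = (\<lambda>x. foldr pd is f x + foldr pd is g x)"
proof (induction "is")
  case (Cons i "is")
  have "foldr pd is f differentiable (at x)" "foldr pd is g differentiable (at x)" for x
    using assms by (auto simp: schwartz_def)
  hence "frechet_derivative (\<lambda>x. foldr pd is f x + foldr pd is g x) (at x) =
      (\<lambda>v. frechet_derivative (foldr pd is f) (at x) v + frechet_derivative (foldr pd is g) (at x) v)" for x
    by (intro frechet_derivative_at[symmetric] has_derivative_add)
       (simp_all add: frechet_derivative_works[symmetric])
  then show ?case by (intro ext) (simp add: Cons.IH pd_def[of i])
qed simp

lemma schwartz_add:
  assumes f: "schwartz f" and g: "schwartz g"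
  shows "schwartz (\<lambda>x. f x + g x)"
  unfolding schwartz_def foldr_pd_add[OF f g]
proof (intro allI conjI)
  fix "is" x
  show "(\<lambda>x. foldr pd is f x + foldr pd is g x) differentiable (at x)"
    using f g by (auto simp: schwartz_def)
next
  fix "is" and n :: nat
  obtain C D where C: "\<And>x. norm x ^ n * norm (foldr pd is f x) \<le> C"
    and D: "\<And>x. norm x ^ n * norm (foldr pd is g x) \<le> D"
    using f g unfolding schwartz_def by metis
  have "norm x ^ n * norm (foldr pd is f x + foldr pd is g x) \<le> C + D" for x
  proof -
    have "norm x ^ n * norm (foldr pd is f x + foldr pd is g x)
        \<le> norm x ^ n * (norm (foldr pd is f x) + norm (foldr pd is g x))"
      by (intro mult_left_mono norm_triangle_ineq) simp
    also have "\<dots> \<le> C + D" using C[of x] D[of x] by (simp add: distrib_left)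
    finally show ?thesis .
  qed
  thus "\<exists>C. \<forall>x. norm x ^ n * norm (foldr pd is f x + foldr pd is g x) \<le> C" by blast
qed

lemma foldr_pd_scaleR:
  assumes "schwartz f"
  shows "foldr pd is (\<lambda>x. c *\<^sub>R f x) = (\<lambda>x. c *\<^sub>R foldr pd is f x)"
proof (induction "is")
  case (Cons i "is")
  have "foldr pd is f differentiable (at x)" for x
    using assms by (auto simp: schwartz_def)
  hence "frechet_derivative (\<lambda>x. c *\<^sub>R foldr pd is f x) (at x) =
      (\<lambda>v. c *\<^sub>R frechet_derivative (foldr pd is f) (at x) v)" for x
    by (intro frechet_derivative_at[symmetric] has_derivative_scaleR_right)
       (simp_all add: frechet_derivative_works[symmetric])
  then show ?case by (intro ext) (simp add: Cons.IH pd_def[of i])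
qed simp

lemma schwartz_scaleR:
  assumes f: "schwartz f"
  shows "schwartz (\<lambda>x. c *\<^sub>R f x)"
  unfolding schwartz_def foldr_pd_scaleR[OF f]
proof (intro allI conjI)
  fix "is" x
  show "(\<lambda>x. c *\<^sub>R foldr pd is f x) differentiable (at x)"
    using f by (auto simp: schwartz_def)
next
  fix "is" and n :: nat
  obtain C where C: "\<And>x. norm x ^ n * norm (foldr pd is f x) \<le> C"
    using f unfolding schwartz_def by metis
  have "norm x ^ n * norm (c *\<^sub>R foldr pd is f x) \<le> \<bar>c\<bar> * C" for x
    using mult_left_mono[OF C[of x], of "\<bar>c\<bar>"] by (simp add: algebra_simps)
  thus "\<exists>C. \<forall>x. norm x ^ n * norm (c *\<^sub>R foldr pd is f x) \<le> C" by blast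
qed

typedef sfield = "{f :: real^3 \<Rightarrow> real. schwartz f}"
  morphisms at_point Abs_sfield
  using schwartz_zero by blast

instantiation sfield :: real_vector
begin

definition "0 = Abs_sfield (\<lambda>x. 0)"
definition "f + g = Abs_sfield (\<lambda>x. at_point f x + at_point g x)"
definition "c *\<^sub>R f = Abs_sfield (\<lambda>x. c *\<^sub>R at_point f x)"
definition "- f = (-1) *\<^sub>R (f :: sfield)"
definition "f - g = f + - (g :: sfield)"

lemma at_point_zero: "at_point 0 = (\<lambda>x. 0)"
  unfolding zero_sfield_def by (simp add: Abs_sfield_inverse schwartz_zero)

lemma at_point_add: "at_point (f + g) = (\<lambda>x. at_point f x + at_point g x)"
  unfolding plus_sfield_def
  using schwartz_add[of "at_point f" "at_point g"] at_point[of f] at_point[of g]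
  by (simp add: Abs_sfield_inverse)

lemma at_point_scaleR: "at_point (c *\<^sub>R f) = (\<lambda>x. c * at_point f x)"
  unfolding scaleR_sfield_def
  using schwartz_scaleR[of "at_point f" c] at_point[of f]
  by (simp add: Abs_sfield_inverse)

instance
  by standard
    (auto simp: at_point_inject[symmetric] at_point_zero at_point_add at_point_scaleR
       uminus_sfield_def minus_sfield_def algebra_simps)

end

section \<open>Phase space and complex field variables\<close>

text \<open>A phase space point assigns a real field to each of \<open>u, p\<^sub>u, \<phi>, p\<^sub>\<phi>\<close>.\<close>

datatype coord = U | PU | PHI | PPHI

type_synonym phase = "coord \<Rightarrow> sfield"
type_synonym fnl = "phase \<Rightarrow> complex"

definition psi :: "phase \<Rightarrow> real^3 \<Rightarrow> complex" where
  "psi z x = (of_real (at_point (z U) x) + \<i> * of_real (at_point (z PU) x)) / of_real (sqrt 2)"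

definition psis :: "phase \<Rightarrow> real^3 \<Rightarrow> complex" where
  "psis z x = (of_real (at_point (z U) x) - \<i> * of_real (at_point (z PU) x)) / of_real (sqrt 2)"

definition phi :: "phase \<Rightarrow> real^3 \<Rightarrow> complex" where
  "phi z x = of_real (at_point (z PHI) x)"

definition pphi :: "phase \<Rightarrow> real^3 \<Rightarrow> complex" where
  "pphi z x = of_real (at_point (z PPHI) x)"

section \<open>Functionals\<close>

text \<open>Differential polynomials in the fields without constant term, as maps from phase space to
  densities.\<close>

inductive diff_poly :: "(phase \<Rightarrow> real^3 \<Rightarrow> complex) \<Rightarrow> bool" where
  "diff_poly psi"
| "diff_poly psis"
| "diff_poly phi"
| "diff_poly pphi"
| "diff_poly P \<Longrightarrow> diff_poly Q \<Longrightarrow> diff_poly (\<lambda>z x. P z x + Q z x)"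
| "diff_poly P \<Longrightarrow> diff_poly Q \<Longrightarrow> diff_poly (\<lambda>z x. P z x * Q z x)"
| "diff_poly P \<Longrightarrow> diff_poly (\<lambda>z x. c * P z x)"
| "diff_poly P \<Longrightarrow> diff_poly (\<lambda>z. pd i (P z))"

text \<open>Linear combinations and products of integrals of differential polynomials.  Every monomial of
  an integrand has degree at least two, whence the product \<open>P Q\<close>: the integral of a nonzero constant
  diverges, and so does already the bracket of the linear functionals \<open>\<integral>\<psi>\<close> and \<open>\<integral>\<psi>\<^sup>*\<close>.\<close>

inductive is_functional :: "fnl \<Rightarrow> bool" where
  "diff_poly P \<Longrightarrow> diff_poly Q \<Longrightarrow> is_functional (\<lambda>z. \<integral>x. P z x * Q z x \<partial>lborel)"
| "is_functional F \<Longrightarrow> is_functional G \<Longrightarrow> is_functional (\<lambda>z. F z + G z)"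
| "is_functional F \<Longrightarrow> is_functional G \<Longrightarrow> is_functional (\<lambda>z. F z * G z)"
| "is_functional F \<Longrightarrow> is_functional (\<lambda>z. c * F z)"

definition is_hamiltonian :: "fnl \<Rightarrow> bool" where
  "is_hamiltonian F \<longleftrightarrow> is_functional F \<and> (\<forall>z. F z \<in> \<real>)"

section \<open>Functional derivatives and the Poisson bracket\<close>

definition has_fderiv :: "fnl \<Rightarrow> coord \<Rightarrow> phase \<Rightarrow> (real^3 \<Rightarrow> complex) \<Rightarrow> bool" where
  "has_fderiv F a z D \<longleftrightarrow> schwartz D \<and>
     (\<forall>\<eta>. ((\<lambda>t. F (z(a := z a + t *\<^sub>R \<eta>))) has_vector_derivative
            (\<integral>x. D x * of_real (at_point \<eta> x) \<partial>lborel)) (at 0))"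

definition fderiv :: "fnl \<Rightarrow> coord \<Rightarrow> phase \<Rightarrow> real^3 \<Rightarrow> complex" where
  "fderiv F a z = (THE D. has_fderiv F a z D)"

text \<open>Chain rule for \<open>u = (\<psi> + \<psi>\<^sup>*)/\<surd>2\<close>, \<open>p\<^sub>u = (\<psi> - \<psi>\<^sup>*)/(i\<surd>2)\<close>.\<close>

definition fderiv_psi :: "fnl \<Rightarrow> phase \<Rightarrow> real^3 \<Rightarrow> complex" where
  "fderiv_psi F z x = (fderiv F U z x - \<i> * fderiv F PU z x) / of_real (sqrt 2)"

definition fderiv_psis :: "fnl \<Rightarrow> phase \<Rightarrow> real^3 \<Rightarrow> complex" where
  "fderiv_psis F z x = (fderiv F U z x + \<i> * fderiv F PU z x) / of_real (sqrt 2)"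

definition bracket :: "fnl \<Rightarrow> fnl \<Rightarrow> fnl" where
  "bracket F G z =
     - \<i> * (\<integral>x. fderiv_psi F z x * fderiv_psis G z x - fderiv_psis F z x * fderiv_psi G z x \<partial>lborel)
     + (\<integral>x. fderiv F PHI z x * fderiv G PPHI z x - fderiv F PPHI z x * fderiv G PHI z x \<partial>lborel)"

definition lie :: "fnl \<Rightarrow> fnl \<Rightarrow> fnl" where
  "lie K F = bracket F K"

section \<open>Formal power series of functionals\<close>

text \<open>\<open>lie_exp m K\<close> is \<open>exp (\<epsilon>\<^sup>m L\<^sub>K)\<close>, i.e. composition with the flow of \<open>K\<close> at time \<open>\<epsilon>\<^sup>m\<close>; meaningful for
  \<open>m \<ge> 1\<close> only, where the index set of the sum is finite.\<close>

definition lie_exp :: "nat \<Rightarrow> fnl \<Rightarrow> fnl fps \<Rightarrow> fnl fps" where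
  "lie_exp m K A = Abs_fps (\<lambda>n z. \<Sum>j | m * j \<le> n. (lie K ^^ j) (fps_nth A (n - m * j)) z / fact j)"

definition bracket_fps :: "fnl fps \<Rightarrow> fnl fps \<Rightarrow> fnl fps" where
  "bracket_fps A B = Abs_fps (\<lambda>n. \<Sum>i\<le>n. bracket (fps_nth A i) (fps_nth B (n - i)))"

text \<open>A formal transformation, represented by its action \<open>F \<mapsto> F \<circ> T\<close> on functionals, is canonical if
  this action preserves Poisson brackets.\<close>

definition canonical :: "(fnl fps \<Rightarrow> fnl fps) \<Rightarrow> bool" where
  "canonical T \<longleftrightarrow> (\<forall>F G. is_functional F \<longrightarrow> is_functional G \<longrightarrow>
     T (fps_const (bracket F G)) = bracket_fps (T (fps_const F)) (T (fps_const G)))"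

definition of_order :: "nat \<Rightarrow> fnl fps \<Rightarrow> bool" where
  "of_order n R \<longleftrightarrow> (\<forall>j. is_functional (fps_nth R j)) \<and> (\<forall>j<n. fps_nth R j = 0)"

section \<open>The Klein-Gordon-Wave Hamiltonian\<close>

definition grad :: "(real^3 \<Rightarrow> complex) \<Rightarrow> real^3 \<Rightarrow> complex^3" where
  "grad f x = (\<chi> i. pd i f x)"

definition laplacian :: "(real^3 \<Rightarrow> complex) \<Rightarrow> real^3 \<Rightarrow> complex" where
  "laplacian f x = (\<Sum>i\<in>UNIV. pd i (pd i f) x)"

text \<open>The bilinear dot product on complex vectors (no conjugation).\<close>

definition bdot :: "complex^3 \<Rightarrow> complex^3 \<Rightarrow> complex" where
  "bdot v w = (\<Sum>i\<in>UNIV. v $ i * w $ i)"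

definition vabs2 :: "complex^3 \<Rightarrow> complex" where
  "vabs2 v = bdot v (\<chi> i. cnj (v $ i))"

definition abs2 :: "complex \<Rightarrow> complex" where
  "abs2 c = c * cnj c"

definition ham_h :: fnl where
  "ham_h z = (\<integral>x. abs2 (psi z x) \<partial>lborel)"

definition ham_k :: fnl where
  "ham_k z = (\<integral>x. (pphi z x)\<^sup>2 / 2 \<partial>lborel)"

definition ham_H0 :: fnl where
  "ham_H0 = ham_h + ham_k"

definition ham_H1 :: fnl where
  "ham_H1 z = (\<integral>x. vabs2 (grad (psi z) x + grad (psis z) x) / 4 + vabs2 (grad (phi z) x) / 2
                 + phi z x * (psi z x + psis z x)\<^sup>2 / 2 \<partial>lborel)"

definition ham_H :: "fnl fps" where
  "ham_H = fps_const ham_H0 + fps_const ham_H1 * fps_X"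

section \<open>Averages and inverse operators\<close>

definition flow_h :: "real \<Rightarrow> phase \<Rightarrow> phase" where
  "flow_h s z = z(U := cos s *\<^sub>R z U + sin s *\<^sub>R z PU, PU := cos s *\<^sub>R z PU - sin s *\<^sub>R z U)"

lemma flow_h_fields:
  "psi (flow_h s z) x = exp (- \<i> * of_real s) * psi z x"
  "psis (flow_h s z) x = exp (\<i> * of_real s) * psis z x"
  "phi (flow_h s z) x = phi z x"
  "pphi (flow_h s z) x = pphi z x"
proof -
  have e: "exp (\<i> * of_real s) = of_real (cos s) + \<i> * of_real (sin s)" for s :: real
    by (simp add: exp_Euler cos_of_real sin_of_real)
  have e': "exp (- \<i> * of_real s) = of_real (cos s) - \<i> * of_real (sin s)" for s :: real
    using e[of "- s"] by simp
  have d: "at_point (f - g) = (\<lambda>x. at_point f x - at_point g x)" for f g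
    by (simp only: minus_sfield_def uminus_sfield_def at_point_add at_point_scaleR) simp
  show "psi (flow_h s z) x = exp (- \<i> * of_real s) * psi z x"
    unfolding psi_def flow_h_def e'
    by (simp add: at_point_add at_point_scaleR d field_simps)
  show "psis (flow_h s z) x = exp (\<i> * of_real s) * psis z x"
    unfolding psis_def flow_h_def e
    by (simp add: at_point_add at_point_scaleR d field_simps)
qed (simp_all add: phi_def pphi_def flow_h_def)

definition avg :: "fnl \<Rightarrow> fnl" where
  "avg F z = integral {0..2 * pi} (\<lambda>s. F (flow_h s z)) / of_real (2 * pi)"

definition Lh_inv :: "fnl \<Rightarrow> fnl" where
  "Lh_inv F z = integral {0..2 * pi} (\<lambda>s. of_real s * F (flow_h s z)) / of_real (2 * pi)"

text \<open>\<open>(1 + L\<^sub>h\<^sup>-\<^sup>1 L\<^sub>k)\<^sup>-\<^sup>1\<close> as a Neumann series, summed pointwise on phase space; on functionals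
  depending polynomially on \<open>\<phi>\<close> only finitely many terms are nonzero.\<close>

definition one_plus_inv :: "fnl \<Rightarrow> fnl" where
  "one_plus_inv F z = (\<Sum>j. (- 1) ^ j * ((\<lambda>F. Lh_inv (lie ham_k F)) ^^ j) F z)"

end

theory Submission
  imports Defs "HOL-Probability.Sinc_Integral"
begin

text \<open>The fields \<open>\<psi>, \<psi>\<^sup>*, \<phi>, p\<^sub>\<phi>\<close> are treated as independent elements of the ring of complex
  Schwartz functions, on which \<open>D i\<close> is a derivation and the integral is a linear form that kills
  derivatives. A functional is then polynomial along every line, its functional derivatives come from
  the formal adjoint of its linearization, and the Jacobi identity reduces to the symmetry of second
  derivatives; hence Lie series preserve brackets.

  For the normal form, every functional is a finite sum of eigenvectors of the flow of \<open>h\<close>, of some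
  integer charge \<open>m\<close>, where \<open>L\<^sub>h\<close> is multiplication by \<open>\<i> m\<close>: the average is the part of charge \<open>0\<close>, and
  \<open>L\<^sub>h\<close> is invertible on the rest. Since \<open>L\<^sub>k\<close> is nilpotent and commutes with \<open>L\<^sub>h\<close>, the Neumann series is
  finite and \<open>G = (1 + L\<^sub>h\<^sup>-\<^sup>1 L\<^sub>k)\<^sup>-\<^sup>1 L\<^sub>h\<^sup>-\<^sup>1 \<delta>F\<close> solves \<open>(L\<^sub>h + L\<^sub>k) G = \<delta>F\<close>, that is \<open>L\<^sub>G H\<^sub>0 = - \<delta>F\<close>. With
  \<open>A\<close>, \<open>B\<close> the parts of \<open>H\<^sub>1\<close> of charge \<open>-2\<close>, \<open>2\<close> and \<open>G\<^sub>-\<close>, \<open>G\<^sub>+\<close> those of \<open>G\<^sub>1\<close>, only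
  \<open>{A, G\<^sub>+}/2 + {B, G\<^sub>-}/2\<close> survives in the average of \<open>F\<^sub>2\<close>.\<close>

section \<open>Schwartz functions\<close>

text \<open>\<open>fderiv\<close> is defined by \<open>THE\<close>, so every functional needs a
  derivative that exists and is unique. Uniqueness holds because the test directions are themselves
  Schwartz functions: the real part of a difference of two candidates can be paired with itself.
  Existence, second derivatives and closure of the functionals under the bracket depend on the shape
  of a functional, which a map on phase space does not expose; hence the syntax \<open>dterm\<close>
  and \<open>fterm\<close>, whose values are compared with the original maps only at the end.

  Only mixed brackets survive in the average of \<open>F2\<close> because charges add: brackets of
  the average of \<open>ham_H1\<close> with the parts of \<open>G1\<close> have charge -2 or 2, and
  those of parts of equal sign have charge -4 or 4. The factor 1/2 arises because L_G1 H_0 = -(A +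
  B), so half of L_G1 (A + B) is cancelled by the term (1/2) L_G1^2 H_0.

  The algebra is complex, but generators have to be real valued. Reality is recovered from
  uniqueness: the conjugate of a functional derivative of a real functional is again its functional
  derivative.\<close>

lemma schwartz_differentiable: "schwartz f \<Longrightarrow> f differentiable (at x)"
  unfolding schwartz_def by (auto dest: spec[of _ "[]"])

lemma schwartz_decay:
  assumes "schwartz f"
  shows "\<exists>C. \<forall>x. norm x ^ n * norm (f x) \<le> C"
  using assms unfolding schwartz_def by (auto dest: spec[of _ "[]"])

lemma schwartz_pd:
  assumes "schwartz f"
  shows "schwartz (pd i f)"
proof -
  have "foldr pd is (pd i f) = foldr pd (is @ [i]) f" for "is" by simp
  thus ?thesis using assms unfolding schwartz_def by presburger
qed

text \<open>Closure under \<open>pd\<close> carries differentiability and decay to all iterated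
  derivatives. This avoids a Leibniz formula for iterated derivatives of products.\<close>

lemma schwartz_coinduct:
  assumes "f \<in> S"
    and dif: "\<And>f x. f \<in> S \<Longrightarrow> f differentiable (at x)"
    and dec: "\<And>f n. f \<in> S \<Longrightarrow> \<exists>C. \<forall>x. norm x ^ n * norm (f x) \<le> C"
    and pd: "\<And>f i. f \<in> S \<Longrightarrow> pd i f \<in> S"
  shows "schwartz f"
proof -
  have "foldr pd is f \<in> S" for "is"
    by (induction "is") (use assms(1) pd in auto)
  thus ?thesis unfolding schwartz_def using dif dec by blast
qed

lemma pd_eqI: "(f has_derivative f') (at x) \<Longrightarrow> pd i f x = f' (axis i 1)"
  unfolding pd_def by (simp add: frechet_derivative_at[symmetric])

lemma pd_add:
  "f differentiable (at x) \<Longrightarrow> g differentiable (at x) \<Longrightarrow> pd i (\<lambda>x. f x + g x) x = pd i f x + pd i g x"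
  by (subst pd_eqI[OF has_derivative_add]) (auto simp: frechet_derivative_works pd_def)

lemma pd_linear:
  "bounded_linear L \<Longrightarrow> f differentiable (at x) \<Longrightarrow> pd i (\<lambda>x. L (f x)) x = L (pd i f x)"
  by (subst pd_eqI[OF bounded_linear.has_derivative]) (auto simp: frechet_derivative_works pd_def)

lemma pd_mult:
  fixes f g :: "real^3 \<Rightarrow> complex"
  shows "f differentiable (at x) \<Longrightarrow> g differentiable (at x) \<Longrightarrow>
    pd i (\<lambda>x. f x * g x) x = f x * pd i g x + pd i f x * g x"
  by (subst pd_eqI[OF has_derivative_mult]) (auto simp: frechet_derivative_works pd_def)

lemma schwartz_linear:
  assumes L: "bounded_linear L" and f: "schwartz f"
  shows "schwartz (\<lambda>x. L (f x))"
proof (rule schwartz_coinduct[where S = "{(\<lambda>x. L (f x)) | f. schwartz f}"])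
  show "(\<lambda>x. L (f x)) \<in> {(\<lambda>x. L (f x)) | f. schwartz f}" using f by blast
next
  fix g x assume "g \<in> {(\<lambda>x. L (f x)) | f. schwartz f}"
  thus "g differentiable (at x)"
    using bounded_linear.has_derivative[OF L] schwartz_differentiable unfolding differentiable_def by blast
next
  fix g and n :: nat assume "g \<in> {(\<lambda>x. L (f x)) | f. schwartz f}"
  then obtain f where g: "g = (\<lambda>x. L (f x))" and f: "schwartz f" by blast
  obtain C where C: "\<And>x. norm x ^ n * norm (f x) \<le> C" using schwartz_decay[OF f] by blast
  have "norm x ^ n * norm (g x) \<le> C * onorm L" for x
  proof -
    have "norm x ^ n * norm (g x) \<le> norm x ^ n * (onorm L * norm (f x))"
      unfolding g by (intro mult_left_mono onorm[OF L]) simp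
    also have "\<dots> = (norm x ^ n * norm (f x)) * onorm L" by simp
    also have "\<dots> \<le> C * onorm L" by (intro mult_right_mono C onorm_pos_le[OF L])
    finally show ?thesis .
  qed
  thus "\<exists>C. \<forall>x. norm x ^ n * norm (g x) \<le> C" by blast
next
  fix g i assume "g \<in> {(\<lambda>x. L (f x)) | f. schwartz f}"
  then obtain f where g: "g = (\<lambda>x. L (f x))" and f: "schwartz f" by blast
  have "pd i g = (\<lambda>x. L (pd i f x))"
    unfolding g by (rule ext) (rule pd_linear[OF L schwartz_differentiable[OF f]])
  thus "pd i g \<in> {(\<lambda>x. L (f x)) | f. schwartz f}" using schwartz_pd[OF f] by blast
qed

text \<open>Single products are not closed under \<open>pd\<close>, since the product rule yields a
  sum; finite sums of products are.\<close>

inductive_set schwartz_products :: "(real^3 \<Rightarrow> complex) set" where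
  "schwartz f \<Longrightarrow> schwartz g \<Longrightarrow> (\<lambda>x. f x * g x) \<in> schwartz_products"
| "f \<in> schwartz_products \<Longrightarrow> g \<in> schwartz_products \<Longrightarrow> (\<lambda>x. f x + g x) \<in> schwartz_products"

lemma schwartz_products_differentiable:
  "f \<in> schwartz_products \<Longrightarrow> f differentiable (at x)"
  by (induction rule: schwartz_products.induct)
     (simp_all add: schwartz_differentiable)

lemma schwartz_mult:
  fixes f g :: "real^3 \<Rightarrow> complex"
  assumes "schwartz f" "schwartz g"
  shows "schwartz (\<lambda>x. f x * g x)"
proof (rule schwartz_coinduct[where S = schwartz_products])
  show "(\<lambda>x. f x * g x) \<in> schwartz_products" using assms by (rule schwartz_products.intros)
next
  fix f and n :: nat assume "f \<in> schwartz_products"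
  thus "\<exists>C. \<forall>x. norm x ^ n * norm (f x) \<le> C"
  proof induction
    case (1 f g)
    \<comment> \<open>The whole weight is put on \<open>f\<close>; exponent 0 for \<open>g\<close>
      expresses plain boundedness.\<close>
    obtain C D where C: "\<And>x. norm x ^ n * norm (f x) \<le> C" and D: "\<And>x. norm x ^ 0 * norm (g x) \<le> D"
      using schwartz_decay[OF 1(1)] schwartz_decay[OF 1(2)] by metis
    have "norm x ^ n * norm (f x * g x) \<le> C * D" for x
    proof -
      have "C \<ge> 0" by (rule order.trans[OF _ C[of 0]]) simp
      have "norm x ^ n * norm (f x * g x) = (norm x ^ n * norm (f x)) * norm (g x)"
        by (simp add: norm_mult)
      also have "\<dots> \<le> C * D" using C[of x] D[of x] \<open>C \<ge> 0\<close> by (intro mult_mono) auto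
      finally show ?thesis .
    qed
    thus ?case by blast
  next
    case (2 f g)
    then obtain C D where C: "\<And>x. norm x ^ n * norm (f x) \<le> C" and D: "\<And>x. norm x ^ n * norm (g x) \<le> D"
      by blast
    have "norm x ^ n * norm (f x + g x) \<le> C + D" for x
    proof -
      have "norm x ^ n * norm (f x + g x) \<le> norm x ^ n * (norm (f x) + norm (g x))"
        by (intro mult_left_mono norm_triangle_ineq) simp
      also have "\<dots> \<le> C + D" using C[of x] D[of x] by (simp add: distrib_left)
      finally show ?thesis .
    qed
    thus ?case by blast
  qed
next
  fix f i assume "f \<in> schwartz_products"
  thus "pd i f \<in> schwartz_products"
  proof induction
    case (1 f g)
    have "pd i (\<lambda>x. f x * g x) = (\<lambda>x. f x * pd i g x + pd i f x * g x)"
      by (rule ext) (rule pd_mult[OF 1[THEN schwartz_differentiable]])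
    thus ?case using 1 by (auto intro!: schwartz_products.intros schwartz_pd)
  next
    case (2 f g)
    have "pd i (\<lambda>x. f x + g x) = (\<lambda>x. pd i f x + pd i g x)"
      by (rule ext) (rule pd_add[OF 2(1,2)[THEN schwartz_products_differentiable]])
    thus ?case using 2 by (auto intro!: schwartz_products.intros)
  qed
qed (rule schwartz_products_differentiable)

section \<open>Integrability of Schwartz functions and integrals of derivatives\<close>

lemma integrable_lorentzian: "integrable lborel (\<lambda>x::real. 1 / (1 + x\<^sup>2))"
  using integrable_inverse_1_plus_square
  by (simp add: set_integrable_def inverse_eq_divide)

text \<open>A product of one-dimensional Lorentzians serves as dominating function because its
  integral factorizes over the coordinates.\<close>

lemma integrable_decay_bound:
  "integrable lborel (\<lambda>x::'a::euclidean_space. \<Prod>b\<in>Basis. 1 / (1 + (x \<bullet> b)\<^sup>2))"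
proof (rule integrableI_bounded)
  have fin: "(\<integral>\<^sup>+x. ennreal (1 / (1 + x\<^sup>2)) \<partial>lborel) < \<infinity>"
    using integrable_lorentzian by (simp add: integrable_iff_bounded)
  have "(\<integral>\<^sup>+x. ennreal (norm (\<Prod>b\<in>Basis. 1 / (1 + (x \<bullet> b)\<^sup>2))) \<partial>(lborel::'a measure)) =
     (\<integral>\<^sup>+x. (\<Prod>b\<in>Basis. ennreal (1 / (1 + (x \<bullet> b)\<^sup>2))) \<partial>(lborel::'a measure))"
    by (intro nn_integral_cong) (simp add: prod_ennreal prod_nonneg)
  also have "\<dots> = (\<Prod>b\<in>(Basis::'a set). (\<integral>\<^sup>+x. ennreal (1 / (1 + x\<^sup>2)) \<partial>lborel))"
    by (subst nn_integral_lborel_prod) auto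
  also have "\<dots> < \<infinity>"
    using fin by (simp add: power_less_top_ennreal)
  finally show "(\<integral>\<^sup>+x. ennreal (norm (\<Prod>b\<in>Basis. 1 / (1 + (x \<bullet> b)\<^sup>2))) \<partial>(lborel::'a measure)) < \<infinity>" .
qed simp

text \<open>Each of the DIM factors costs two powers of \<open>1 + norm x\<close>, hence the
  exponent; polynomial decay of that order therefore implies domination by the product.\<close>

lemma decay_bound_ge:
  fixes x :: "'a::euclidean_space"
  shows "1 / (1 + norm x) ^ (2 * DIM('a)) \<le> (\<Prod>b\<in>Basis. 1 / (1 + (x \<bullet> b)\<^sup>2))"
proof -
  have "1 + (x \<bullet> b)\<^sup>2 \<le> (1 + norm x) ^ 2" if "b \<in> Basis" for b
  proof -
    have "(x \<bullet> b)\<^sup>2 \<le> (norm x)\<^sup>2" using Basis_le_norm[OF that, of x]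
      by (metis abs_le_square_iff abs_norm_cancel)
    thus ?thesis by (simp add: power2_sum add_increasing2)
  qed
  hence "(\<Prod>b\<in>(Basis::'a set). 1 / (1 + norm x) ^ 2) \<le> (\<Prod>b\<in>Basis. 1 / (1 + (x \<bullet> b)\<^sup>2))"
    by (intro prod_mono conjI frac_le) (auto intro: add_pos_nonneg)
  thus ?thesis by (simp add: power_mult power_divide)
qed

lemma schwartz_decay_bound:
  assumes "schwartz f"
  shows "\<exists>C\<ge>0. \<forall>x. (1 + norm x) ^ n * norm (f x) \<le> C"
proof -
  obtain C D where C: "\<And>x. norm x ^ 0 * norm (f x) \<le> C" and D: "\<And>x. norm x ^ n * norm (f x) \<le> D"
    using schwartz_decay[OF assms] by metis
  have "C \<ge> 0" "D \<ge> 0" by (rule order.trans[OF _ C[of 0]], simp, rule order.trans[OF _ D[of 0]], simp)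
  have "(1 + norm x) ^ n * norm (f x) \<le> 2 ^ n * (C + D)" for x
  proof -
    have "(1 + norm x) ^ n \<le> (2 * max 1 (norm x)) ^ n" by (intro power_mono) auto
    also have "\<dots> = 2 ^ n * max 1 (norm x) ^ n" by (simp add: power_mult_distrib)
    also have "max 1 (norm x) ^ n \<le> 1 + norm x ^ n" by (simp add: max_def)
    finally have "(1 + norm x) ^ n * norm (f x) \<le> 2 ^ n * (1 + norm x ^ n) * norm (f x)"
      by (intro mult_right_mono) auto
    also have "\<dots> = 2 ^ n * (norm (f x) + norm x ^ n * norm (f x))" by (simp add: algebra_simps)
    also have "\<dots> \<le> 2 ^ n * (C + D)" using C[of x] D[of x] by (intro mult_left_mono add_mono) auto
    finally show ?thesis .
  qed
  thus ?thesis using \<open>C \<ge> 0\<close> \<open>D \<ge> 0\<close> by (intro exI[of _ "2 ^ n * (C + D)"]) auto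
qed

lemma schwartz_continuous: "schwartz f \<Longrightarrow> continuous_on S f"
  by (intro differentiable_imp_continuous_on)
     (auto simp: differentiable_on_def intro: schwartz_differentiable differentiable_at_withinI)

lemma schwartz_measurable: "schwartz f \<Longrightarrow> f \<in> borel_measurable lborel"
  using borel_measurable_continuous_onI[OF schwartz_continuous] by simp

text \<open>The uniformity in shifts \<open>v\<close> of length at most 1 is what dominates
  difference quotients in \<open>integral_pd\<close>; \<open>v = 0\<close> gives
  integrability.\<close>

lemma schwartz_dominated:
  fixes f :: "real^3 \<Rightarrow> 'a::{real_normed_vector}"
  assumes "schwartz f"
  shows "\<exists>C\<ge>0. \<forall>x v. norm v \<le> 1 \<longrightarrow> norm (f (x + v)) \<le> C * (\<Prod>b\<in>Basis. 1 / (1 + (x \<bullet> b)\<^sup>2))"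
proof -
  obtain C where C: "C \<ge> 0" "\<And>x. (1 + norm x) ^ (2 * DIM(real^3)) * norm (f x) \<le> C"
    using schwartz_decay_bound[OF assms] by metis
  have "norm (f (x + v)) \<le> (C * 2 ^ (2 * DIM(real^3))) * (\<Prod>b\<in>Basis. 1 / (1 + (x \<bullet> b)\<^sup>2))"
    if "norm v \<le> 1" for x v
  proof -
    have "norm x \<le> norm (x + v) + norm v" by (metis add_diff_cancel norm_triangle_ineq4)
    hence le: "1 + norm x \<le> 2 * (1 + norm (x + v))" using that norm_ge_zero[of "x + v"] by (smt (verit))
    have "0 < (1 + norm (x + v)) ^ (2 * DIM(real^3))" by (intro zero_less_power add_pos_nonneg) auto
    hence "norm (f (x + v)) \<le> C / (1 + norm (x + v)) ^ (2 * DIM(real^3))"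
      using C(2)[of "x + v"] by (subst pos_le_divide_eq) (simp_all add: mult.commute)
    also have "\<dots> = (C * 2 ^ (2 * DIM(real^3))) * (1 / (2 * (1 + norm (x + v))) ^ (2 * DIM(real^3)))"
      by (simp only: power_mult_distrib) simp
    also have "\<dots> \<le> (C * 2 ^ (2 * DIM(real^3))) * (1 / (1 + norm x) ^ (2 * DIM(real^3)))"
      using le C(1) by (intro mult_left_mono divide_left_mono power_mono) (auto intro!: mult_pos_pos zero_less_power add_pos_nonneg)
    also have "\<dots> \<le> (C * 2 ^ (2 * DIM(real^3))) * (\<Prod>b\<in>Basis. 1 / (1 + (x \<bullet> b)\<^sup>2))"
      using C(1) by (intro mult_left_mono decay_bound_ge) auto
    finally show ?thesis .
  qed
  thus ?thesis using C(1) by (intro exI[of _ "C * 2 ^ (2 * DIM(real^3))"]) auto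
qed

lemma schwartz_integrable:
  fixes f :: "real^3 \<Rightarrow> 'a::{banach, second_countable_topology}"
  assumes "schwartz f"
  shows "integrable lborel f"
proof -
  obtain C where C: "C \<ge> 0" "\<And>x v. norm v \<le> 1 \<Longrightarrow> norm (f (x + v)) \<le> C * (\<Prod>b\<in>Basis. 1 / (1 + (x \<bullet> b)\<^sup>2))"
    using schwartz_dominated[OF assms] by metis
  show ?thesis
  proof (rule Bochner_Integration.integrable_bound)
    show "integrable lborel (\<lambda>x::real^3. C * (\<Prod>b\<in>Basis. 1 / (1 + (x \<bullet> b)\<^sup>2)))"
      by (intro integrable_mult_right integrable_decay_bound)
    show "AE x in lborel. norm (f x) \<le> norm (C * (\<Prod>b\<in>Basis. 1 / (1 + (x \<bullet> b)\<^sup>2)))"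
    proof (rule AE_I2)
      fix x
      have "norm (f x) \<le> C * (\<Prod>b\<in>Basis. 1 / (1 + (x \<bullet> b)\<^sup>2))" using C(2)[of 0 x] by simp
      thus "norm (f x) \<le> norm (C * (\<Prod>b\<in>Basis. 1 / (1 + (x \<bullet> b)\<^sup>2)))" by (simp add: abs_le_iff)
    qed
  qed (rule schwartz_measurable[OF assms])
qed

text \<open>The difference quotients of \<open>f\<close> in direction \<open>i\<close> have integral zero by translation
  invariance, and converge dominatedly to \<open>pd i f\<close>.\<close>

lemma integral_pd:
  fixes f :: "real^3 \<Rightarrow> complex"
  assumes f: "schwartz f"
  shows "(\<integral>x. pd i f x \<partial>lborel) = 0"
proof -
  define e :: "real^3" where "e = axis i 1"
  have ne: "norm e = 1" by (simp add: e_def)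
  define t :: "nat \<Rightarrow> real" where "t n = 1 / real (Suc n)" for n
  have t: "t n > 0" "t n \<le> 1" for n by (auto simp: t_def)
  have t0: "t \<longlonglongrightarrow> 0" unfolding t_def using LIMSEQ_inverse_real_of_nat by (simp add: inverse_eq_divide)
  define q where "q n x = (f (x + t n *\<^sub>R e) - f x) /\<^sub>R t n" for n x
  have der: "(f has_derivative frechet_derivative f (at x)) (at x)" for x
    using schwartz_differentiable[OF f] frechet_derivative_works by blast
  have dvec: "((\<lambda>s. f (x + s *\<^sub>R e)) has_vector_derivative pd i f (x + s *\<^sub>R e)) (at s)" for x s
  proof -
    have "((\<lambda>s. f (x + s *\<^sub>R e)) has_derivative (\<lambda>h. frechet_derivative f (at (x + s *\<^sub>R e)) (h *\<^sub>R e))) (at s)"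
      by (rule has_derivative_compose[OF _ der]) (auto intro!: derivative_eq_intros)
    moreover have "linear (frechet_derivative f (at (x + s *\<^sub>R e)))"
      using der has_derivative_linear by blast
    ultimately show ?thesis
      by (simp add: has_vector_derivative_def linear_scale pd_def e_def)
  qed
  have lim: "(\<lambda>n. q n x) \<longlonglongrightarrow> pd i f x" for x
  proof -
    have "((\<lambda>s. f (x + s *\<^sub>R e)) has_derivative (\<lambda>h. h *\<^sub>R pd i f x)) (at 0)"
      using dvec[of x 0] by (simp add: has_vector_derivative_def)
    hence "(\<lambda>h. norm (f (x + h *\<^sub>R e) - f x - h *\<^sub>R pd i f x) / norm h) \<midarrow>0\<rightarrow> 0"
      by (simp add: has_derivative_at)
    moreover have "filterlim t (at 0) sequentially"
      using t0 t(1) by (auto intro!: filterlim_atI always_eventually simp: less_imp_neq[symmetric])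
    ultimately have "(\<lambda>n. norm (f (x + t n *\<^sub>R e) - f x - t n *\<^sub>R pd i f x) / norm (t n)) \<longlonglongrightarrow> 0"
      by (rule filterlim_compose)
    moreover have "norm (f (x + t n *\<^sub>R e) - f x - t n *\<^sub>R pd i f x) / norm (t n) = norm (q n x - pd i f x)" for n
    proof -
      have "q n x - pd i f x = (f (x + t n *\<^sub>R e) - f x - t n *\<^sub>R pd i f x) /\<^sub>R t n"
        using t(1)[of n] by (simp add: q_def scaleR_diff_right)
      thus ?thesis using t(1)[of n] by (simp add: divide_inverse mult.commute)
    qed
    ultimately show ?thesis by (simp add: tendsto_norm_zero_iff LIM_zero_iff)
  qed
  obtain C where C: "C \<ge> 0"
    "\<And>x v. norm v \<le> 1 \<Longrightarrow> norm (pd i f (x + v)) \<le> C * (\<Prod>b\<in>Basis. 1 / (1 + (x \<bullet> b)\<^sup>2))"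
    using schwartz_dominated[OF schwartz_pd[OF f]] by metis
  \<comment> \<open>The mean value inequality on the segment from \<open>x\<close> to
    \<open>x + t n *\<^sub>R e\<close>, whose points lie within distance 1 of \<open>x\<close>
    because \<open>t n \<le> 1\<close>.\<close>
  have bound: "norm (q n x) \<le> C * (\<Prod>b\<in>Basis. 1 / (1 + (x \<bullet> b)\<^sup>2))" for n x
  proof -
    define B where "B = C * (\<Prod>b\<in>Basis. 1 / (1 + (x \<bullet> b)\<^sup>2))"
    have "norm (f (x + t n *\<^sub>R e) - f (x + 0 *\<^sub>R e)) \<le> B * norm (t n - 0)"
    proof (rule differentiable_bound[of "{0..t n}"])
      fix s assume s: "s \<in> {0..t n}"
      show "((\<lambda>s. f (x + s *\<^sub>R e)) has_derivative (\<lambda>h. h *\<^sub>R pd i f (x + s *\<^sub>R e))) (at s within {0..t n})"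
        using dvec[of x s] by (simp add: has_vector_derivative_def has_derivative_at_withinI)
      show "onorm (\<lambda>h. h *\<^sub>R pd i f (x + s *\<^sub>R e)) \<le> B"
      proof (rule onorm_bound)
        show "0 \<le> B" using C(1) unfolding B_def by (intro mult_nonneg_nonneg prod_nonneg) auto
        fix h :: real
        have "norm (s *\<^sub>R e) \<le> 1" using s t(2)[of n] ne by auto
        hence "norm (pd i f (x + s *\<^sub>R e)) \<le> B" unfolding B_def by (rule C(2))
        thus "norm (h *\<^sub>R pd i f (x + s *\<^sub>R e)) \<le> B * norm h"
          by (simp add: mult.commute[of B] mult_left_mono)
      qed
    qed (use t(1)[of n] in auto)
    hence "norm (q n x) \<le> B" using t(1)[of n] by (simp add: q_def pos_divide_le_eq divide_inverse_commute[symmetric])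
    thus ?thesis by (simp only: B_def)
  qed
  have qint: "(\<integral>x. q n x \<partial>lborel) = 0" for n
  proof -
    have i: "integrable lborel f" by (rule schwartz_integrable[OF f])
    have d: "distr lborel borel (\<lambda>x::real^3. t n *\<^sub>R e + x) = lborel" by (rule lborel_distr_plus)
    have "integrable (distr lborel borel (\<lambda>x::real^3. t n *\<^sub>R e + x)) f" using i d by simp
    hence i2: "integrable lborel (\<lambda>x. f (t n *\<^sub>R e + x))"
      by (subst (asm) integrable_distr_eq) (use schwartz_measurable[OF f] in auto)
    have "(\<integral>x. f (t n *\<^sub>R e + x) \<partial>lborel) = (\<integral>x. f x \<partial>(distr lborel borel (\<lambda>x::real^3. t n *\<^sub>R e + x)))"
      by (subst integral_distr) (use schwartz_measurable[OF f] in auto)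
    also have "\<dots> = (\<integral>x. f x \<partial>lborel)" using d by simp
    finally show ?thesis unfolding q_def using i i2
      by (simp add: add.commute Bochner_Integration.integral_diff)
  qed
  have "(\<lambda>n. \<integral>x. q n x \<partial>lborel) \<longlonglongrightarrow> (\<integral>x. pd i f x \<partial>lborel)"
  proof (rule integral_dominated_convergence)
    show "integrable lborel (\<lambda>x::real^3. C * (\<Prod>b\<in>Basis. 1 / (1 + (x \<bullet> b)\<^sup>2)))"
      by (intro integrable_mult_right integrable_decay_bound)
    have "continuous_on UNIV (\<lambda>x. f (x + t n *\<^sub>R e))" for n
      by (rule continuous_on_compose2[OF schwartz_continuous[OF f, of UNIV]]) (auto intro!: continuous_intros)
    hence "continuous_on UNIV (q n)" for n
      unfolding q_def by (intro continuous_on_scaleR continuous_on_const continuous_on_diff schwartz_continuous[OF f])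
    thus "q n \<in> borel_measurable lborel" for n using borel_measurable_continuous_onI by auto
  qed (use lim bound schwartz_measurable[OF schwartz_pd[OF f]] in auto)
  thus ?thesis unfolding qint by (metis LIMSEQ_unique tendsto_const)
qed

text \<open>The integral of the nonnegative continuous function \<open>f x * f x\<close> over a box
  around the point is squeezed between 0 and the total integral 0.\<close>

lemma schwartz_eq_0:
  fixes f :: "real^3 \<Rightarrow> real"
  assumes f: "schwartz f" and int: "(\<integral>x. f x * f x \<partial>lborel) = 0"
  shows "f x = 0"
proof -
  \<comment> \<open>The product rule \<open>schwartz_mult\<close> is stated for complex functions,
    so the real square is reached through them.\<close>
  have "schwartz (\<lambda>x. complex_of_real (f x) * complex_of_real (f x))"
    by (intro schwartz_mult schwartz_linear[OF bounded_linear_of_real f])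
  from schwartz_linear[OF bounded_linear_Re this] have s: "schwartz (\<lambda>x. f x * f x)" by simp
  have has: "((\<lambda>x. f x * f x) has_integral 0) UNIV"
    using has_integral_integral_lborel[OF schwartz_integrable[OF s]] int by simp
  have int_box: "(\<lambda>x. f x * f x) integrable_on cbox (x - 1) (x + 1)"
    by (rule integrable_continuous[OF schwartz_continuous[OF s]])
  hence "integral (cbox (x - 1) (x + 1)) (\<lambda>x. f x * f x) \<le> integral UNIV (\<lambda>x. f x * f x)"
    using has by (intro integral_subset_le) auto
  moreover have "integral (cbox (x - 1) (x + 1)) (\<lambda>x. f x * f x) \<ge> 0"
    by (rule integral_nonneg[OF int_box]) simp
  ultimately have "integral (cbox (x - 1) (x + 1)) (\<lambda>x. f x * f x) = 0"
    using integral_unique[OF has] by simp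
  hence "((\<lambda>x. f x * f x) has_integral 0) (cbox (x - 1) (x + 1))"
    using integrable_integral[OF int_box] by simp
  hence "f x * f x = 0"
    by (intro has_integral_0_cbox_imp_0[of "x - 1" "x + 1" "\<lambda>x. f x * f x"] schwartz_continuous[OF s])
       (auto simp: mem_box_cart interval_ne_empty_cart)
  thus ?thesis by simp
qed

section \<open>The ring of complex Schwartz functions\<close>

typedef cfield = "{f :: real^3 \<Rightarrow> complex. schwartz f}"
  morphisms fun_of Cfield
  using schwartz_zero by blast

setup_lifting type_definition_cfield

lemma schwartz_fun_of: "schwartz (fun_of f)"
  using fun_of by blast

text \<open>A commutative ring without unit: the constant function 1 does not decay.\<close>

instantiation cfield :: "{comm_ring, real_algebra}"
begin

lift_definition zero_cfield :: cfield is "\<lambda>x. 0" by (rule schwartz_zero)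
lift_definition plus_cfield :: "cfield \<Rightarrow> cfield \<Rightarrow> cfield" is "\<lambda>f g x. f x + g x" by (rule schwartz_add)
lift_definition times_cfield :: "cfield \<Rightarrow> cfield \<Rightarrow> cfield" is "\<lambda>f g x. f x * g x" by (rule schwartz_mult)
lift_definition uminus_cfield :: "cfield \<Rightarrow> cfield" is "\<lambda>f x. - f x"
  by (rule schwartz_linear) (auto intro: bounded_linear_minus bounded_linear_ident)
lift_definition scaleR_cfield :: "real \<Rightarrow> cfield \<Rightarrow> cfield" is "\<lambda>c f x. c *\<^sub>R f x" by (rule schwartz_scaleR)
definition "f - g = f + - (g :: cfield)"

instance
  by standard (unfold minus_cfield_def, (transfer, auto simp: fun_eq_iff algebra_simps)+)

end

lift_definition scaleC :: "complex \<Rightarrow> cfield \<Rightarrow> cfield" is "\<lambda>c f x. c * f x"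
  by (rule schwartz_linear[OF bounded_linear_mult_right])

lift_definition D :: "3 \<Rightarrow> cfield \<Rightarrow> cfield" is pd by (rule schwartz_pd)

lift_definition intg :: "cfield \<Rightarrow> complex" is "\<lambda>f. \<integral>x. f x \<partial>lborel" .

lemma fun_of_simps [simp]:
  "fun_of 0 x = 0" "fun_of (f + g) x = fun_of f x + fun_of g x"
  "fun_of (f * g) x = fun_of f x * fun_of g x" "fun_of (- f) x = - fun_of f x"
  "fun_of (f - g) x = fun_of f x - fun_of g x"
  "fun_of (scaleC c f) x = c * fun_of f x" "fun_of (D i f) x = pd i (fun_of f) x"
  "fun_of (r *\<^sub>R f) x = r *\<^sub>R fun_of f x"
  unfolding minus_cfield_def by (transfer, simp)+

lemma fun_of_D: "fun_of (D i f) = pd i (fun_of f)"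
  by (rule ext) simp

lemma fun_of_ext:
  "fun_of (f + g) = (\<lambda>x. fun_of f x + fun_of g x)"
  "fun_of (f - g) = (\<lambda>x. fun_of f x - fun_of g x)"
  "fun_of (f * g) = (\<lambda>x. fun_of f x * fun_of g x)"
  "fun_of (scaleC c f) = (\<lambda>x. c * fun_of f x)"
  by (rule ext, simp)+

lemma cfield_eqI: "(\<And>x. fun_of f x = fun_of g x) \<Longrightarrow> f = g"
  by (auto simp: fun_of_inject[symmetric])

lemma intg_eq: "intg f = (\<integral>x. fun_of f x \<partial>lborel)"
  by (simp add: intg.rep_eq)

lemma intg_eqI: "(\<And>x. fun_of f x = g x) \<Longrightarrow> (\<integral>x. g x \<partial>lborel) = intg f"
  by (simp add: intg_eq)

lemma integrable_fun_of: "integrable lborel (fun_of f)"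
  by (rule schwartz_integrable[OF schwartz_fun_of])

lemma scaleC_simps [simp]:
  "scaleC c 0 = 0" "scaleC 0 f = 0" "scaleC 1 f = f"
  "scaleC c (scaleC d f) = scaleC (c * d) f"
  "scaleC c f * g = scaleC c (f * g)" "f * scaleC c g = scaleC c (f * g)"
  by (auto intro: cfield_eqI)

lemma scaleC_distrib:
  "scaleC c (f + g) = scaleC c f + scaleC c g" "scaleC c (f - g) = scaleC c f - scaleC c g"
  "scaleC (c + d) f = scaleC c f + scaleC d f"  "scaleC (c - d) f = scaleC c f - scaleC d f"
  by (auto intro!: cfield_eqI simp: algebra_simps)

lemma scaleC_minus [simp]: "scaleC c (- f) = - scaleC c f" "scaleC (- c) f = - scaleC c f"
  by (auto intro: cfield_eqI)

lemma scaleC_of_real: "scaleC (of_real r) f = r *\<^sub>R f"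
  by (rule cfield_eqI) (simp add: scaleR_conv_of_real)

lemma D_add [simp]: "D i (f + g) = D i f + D i g"
  by (rule cfield_eqI, simp, transfer, rule pd_add) (auto intro: schwartz_differentiable)

lemma D_mult: "D i (f * g) = f * D i g + D i f * g"
  by (rule cfield_eqI, simp, transfer, rule pd_mult) (auto intro: schwartz_differentiable)

lemma D_scaleC [simp]: "D i (scaleC c f) = scaleC c (D i f)"
  by (rule cfield_eqI, simp, transfer, rule pd_linear[OF bounded_linear_mult_right])
     (auto intro: schwartz_differentiable)

lemma D_minus [simp]: "D i (- f) = - D i f"
  using D_scaleC[of i "- 1" f] by simp

lemma D_zero [simp]: "D i 0 = 0"
  using D_scaleC[of i 0 0] by simp

lemma D_scaleR [simp]: "D i (r *\<^sub>R f) = r *\<^sub>R D i f"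
  by (simp add: scaleC_of_real[symmetric])

lemma linear_D: "linear (D i)"
  by (intro linearI) simp_all

lemma intg_add [simp]: "intg (f + g) = intg f + intg g"
  by (simp add: intg_eq integrable_fun_of)

lemma intg_minus [simp]: "intg (- f) = - intg f"
  by (simp add: intg_eq)

lemma intg_zero [simp]: "intg 0 = 0"
  by (simp add: intg_eq)

lemma intg_diff [simp]: "intg (f - g) = intg f - intg g"
  by (simp add: intg_eq integrable_fun_of)

lemma intg_scaleC [simp]: "intg (scaleC c f) = c * intg f"
  by (simp add: intg_eq)

lemma intg_scaleR [simp]: "intg (r *\<^sub>R f) = r *\<^sub>R intg f"
  by (simp add: intg_eq)

lemma linear_intg: "linear intg"
  by (intro linearI) simp_all

lemma intg_sum: "intg (\<Sum>i\<in>A. f i) = (\<Sum>i\<in>A. intg (f i))"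
  by (induction A rule: infinite_finite_induct) simp_all

lemma intg_D [simp]: "intg (D i f) = 0"
  unfolding intg_eq fun_of_D by (rule integral_pd[OF schwartz_fun_of])

lemma intg_by_parts: "intg (f * D i g) = - intg (D i f * g)"
  using intg_D[of i "f * g"] unfolding D_mult by (simp add: eq_neg_iff_add_eq_0)

lemma linear_scaleC: "linear (scaleC c)"
  by (intro linearI) (simp_all add: scaleC_distrib scaleC_of_real[symmetric] mult.commute)

section \<open>Polynomial curves\<close>

text \<open>\<open>pcurve n c c0 c1\<close>: the curve \<open>c\<close> is polynomial in \<open>t\<close> of degree at most \<open>n\<close>, with
  value \<open>c0\<close> and derivative \<open>c1\<close> at \<open>t = 0\<close>. Polynomial curves can be integrated coefficientwise, so no
  differentiation under the integral sign is needed.\<close>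

inductive pcurve :: "nat \<Rightarrow> (real \<Rightarrow> 'a::real_vector) \<Rightarrow> 'a \<Rightarrow> 'a \<Rightarrow> bool" where
  const: "pcurve n (\<lambda>t. f) f 0"
| shift: "pcurve n c c0 c1 \<Longrightarrow> pcurve (Suc n) (\<lambda>t. t *\<^sub>R c t) 0 c0"
| add: "pcurve n c c0 c1 \<Longrightarrow> pcurve n d d0 d1 \<Longrightarrow> pcurve n (\<lambda>t. c t + d t) (c0 + d0) (c1 + d1)"

lemma pcurve_mono: "pcurve n c c0 c1 \<Longrightarrow> n \<le> m \<Longrightarrow> pcurve m c c0 c1"
proof (induction arbitrary: m rule: pcurve.induct)
  case (shift n c c0 c1)
  then obtain m' where "m = Suc m'" "n \<le> m'" by (cases m) auto
  thus ?case using shift by (auto intro: pcurve.shift)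
qed (auto intro: pcurve.intros)

lemma pcurve_linear:
  assumes "pcurve n c c0 c1" "linear L"
  shows "pcurve n (\<lambda>t. L (c t)) (L c0) (L c1)"
  using assms(1)
proof induction
  case (const n f)
  show ?case using pcurve.const[of n "L f"] linear_0[OF assms(2)] by simp
next
  case (shift n c c0 c1)
  thus ?case using pcurve.shift[OF shift.IH] by (simp add: linear_scale[OF assms(2)] linear_0[OF assms(2)])
next
  case (add n c c0 c1 d d0 d1)
  thus ?case using pcurve.add[OF add.IH] by (simp add: linear_add[OF assms(2)])
qed

text \<open>The derivative is the Leibniz rule. Induction on the first curve suffices: for constant
  \<open>c\<close> the claim is \<open>pcurve_linear\<close> applied to the second.\<close>

lemma pcurve_bilinear:
  assumes c: "pcurve n c c0 c1" and d: "pcurve m d d0 d1"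
    and l: "\<And>x. linear (B x)" and r: "\<And>y. linear (\<lambda>x. B x y)"
  shows "pcurve (n + m) (\<lambda>t. B (c t) (d t)) (B c0 d0) (B c0 d1 + B c1 d0)"
  using c
proof induction
  case (const n f)
  show ?case using pcurve_mono[OF pcurve_linear[OF d l], of "n + m" f] linear_0[OF r] by simp
next
  case (shift n c c0 c1)
  show ?case using pcurve.shift[OF shift.IH] linear_scale[OF r] linear_0[OF r] by simp
next
  case (add n c c0 c1 d d0 d1)
  show ?case using pcurve.add[OF add.IH] by (simp add: linear_add[OF r] algebra_simps)
qed

lemma pcurve_mult:
  fixes c d :: "real \<Rightarrow> 'a::real_algebra"
  assumes "pcurve n c c0 c1" "pcurve m d d0 d1"
  shows "pcurve (n + m) (\<lambda>t. c t * d t) (c0 * d0) (c0 * d1 + c1 * d0)"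
  by (rule pcurve_bilinear[OF assms]) (auto intro!: linearI simp: algebra_simps)

lemma pcurve_scaleC:
  assumes "pcurve n c c0 c1" "pcurve m d d0 d1"
  shows "pcurve (n + m) (\<lambda>t. scaleC (c t) (d t)) (scaleC c0 d0) (scaleC c0 d1 + scaleC c1 d0)"
proof (rule pcurve_bilinear[OF assms])
  show "linear (\<lambda>x. scaleC x y)" for y
    by (intro linearI) (simp_all add: scaleC_distrib scaleC_of_real[symmetric] scaleR_conv_of_real)
qed (rule linear_scaleC)

lemma pcurve_line: "pcurve 1 (\<lambda>t. f + t *\<^sub>R g) f g"
  using pcurve.add[OF pcurve.const[of "Suc 0" f] pcurve.shift[OF pcurve.const[of 0 g]]] by simp

text \<open>The degree bound is kept along with the derivative: it later bounds the number of
  nonzero iterates of \<open>lie ham_k\<close>.\<close>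

lemma pcurve_poly:
  fixes c :: "real \<Rightarrow> complex"
  assumes "pcurve n c c0 c1"
  obtains p where "degree p \<le> n" "\<And>t. c t = poly p (of_real t)" "coeff p 1 = c1"
proof -
  have "\<exists>p. degree p \<le> n \<and> (\<forall>t. c t = poly p (of_real t)) \<and> coeff p 0 = c0 \<and> coeff p 1 = c1"
    using assms
  proof induction
    case (const n f)
    show ?case by (rule exI[of _ "[:f:]"]) simp
  next
    case (shift n c c0 c1)
    then obtain p where p: "degree p \<le> n" "\<And>t. c t = poly p (of_real t)" "coeff p 0 = c0" by blast
    show ?case using p
      by (intro exI[of _ "pCons 0 p"]) (auto simp: scaleR_conv_of_real degree_pCons_eq_if)
  next
    case (add n c c0 c1 d d0 d1)
    then obtain p q where "degree p \<le> n" "\<And>t. c t = poly p (of_real t)" "coeff p 0 = c0" "coeff p 1 = c1"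
      "degree q \<le> n" "\<And>t. d t = poly q (of_real t)" "coeff q 0 = d0" "coeff q 1 = d1" by blast
    thus ?case by (intro exI[of _ "p + q"]) (auto intro: degree_add_le)
  qed
  thus ?thesis using that by blast
qed

lemma poly_has_vector_derivative:
  "((\<lambda>t. poly p (of_real t :: complex)) has_vector_derivative poly (pderiv p) (of_real t)) (at t)"
  by (rule has_vector_derivative_real_field[OF poly_DERIV])

lemma pcurve_has_vector_derivative:
  fixes c :: "real \<Rightarrow> complex"
  assumes "pcurve n c c0 c1"
  shows "(c has_vector_derivative c1) (at 0)"
proof -
  obtain p where p: "\<And>t. c t = poly p (of_real t)" "coeff p 1 = c1"
    using pcurve_poly[OF assms] by metis
  have "poly (pderiv p) 0 = c1" using p(2) by (simp add: poly_0_coeff_0 coeff_pderiv)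
  moreover have "c = (\<lambda>t. poly p (of_real t))" using p(1) by (rule ext)
  ultimately show ?thesis using poly_has_vector_derivative[of p 0] by simp
qed

section \<open>Differential polynomials and functionals as terms\<close>

datatype var = Psi | Psis | Phi | PPhi

lemma UNIV_var: "UNIV = {Psi, Psis, Phi, PPhi}"
proof -
  have "x \<in> {Psi, Psis, Phi, PPhi}" for x by (cases x) auto
  thus ?thesis by blast
qed

instance var :: finite
  by standard (simp add: UNIV_var)

lemma sum_var: "(\<Sum>a\<in>UNIV. f a) = f Psi + f Psis + f Phi + f PPhi"
  by (simp add: UNIV_var add.assoc)

text \<open>The field variables range over independent complex Schwartz functions; the phase space is
  the real subspace on which \<open>\<psi>\<close> and \<open>\<psi>\<^sup>*\<close> are conjugate and \<open>\<phi>\<close>, \<open>p\<^sub>\<phi>\<close> are real.\<close>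

type_synonym fields = "var \<Rightarrow> cfield"

definition line :: "fields \<Rightarrow> fields \<Rightarrow> real \<Rightarrow> fields" where
  "line w v t a = w a + t *\<^sub>R v a"

text \<open>One differential polynomial has many presentations. Syntax allows degree, linearization
  and adjoint to be defined by recursion on a chosen one.\<close>

datatype dterm = Var var | Plus dterm dterm | Times dterm dterm | Scale complex dterm | Deriv 3 dterm

primrec ev :: "dterm \<Rightarrow> fields \<Rightarrow> cfield" where
  "ev (Var a) w = w a"
| "ev (Plus P Q) w = ev P w + ev Q w"
| "ev (Times P Q) w = ev P w * ev Q w"
| "ev (Scale c P) w = scaleC c (ev P w)"
| "ev (Deriv i P) w = D i (ev P w)"

primrec deg :: "dterm \<Rightarrow> nat" where
  "deg (Var a) = 1"
| "deg (Plus P Q) = max (deg P) (deg Q)"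
| "deg (Times P Q) = deg P + deg Q"
| "deg (Scale c P) = deg P"
| "deg (Deriv i P) = deg P"

primrec lin :: "dterm \<Rightarrow> fields \<Rightarrow> fields \<Rightarrow> cfield" where
  "lin (Var a) w v = v a"
| "lin (Plus P Q) w v = lin P w v + lin Q w v"
| "lin (Times P Q) w v = ev P w * lin Q w v + lin P w v * ev Q w"
| "lin (Scale c P) w v = scaleC c (lin P w v)"
| "lin (Deriv i P) w v = D i (lin P w v)"

text \<open>The derivative of \<open>lin P w v\<close> in direction \<open>v'\<close>. The summands
  stand in the order in which \<open>pcurve_mult\<close> produces them, so that
  \<open>pcurve_lin\<close> follows by simplification.\<close>

primrec lin2 :: "dterm \<Rightarrow> fields \<Rightarrow> fields \<Rightarrow> fields \<Rightarrow> cfield" where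
  "lin2 (Var a) w v v' = 0"
| "lin2 (Plus P Q) w v v' = lin2 P w v v' + lin2 Q w v v'"
| "lin2 (Times P Q) w v v' = ev P w * lin2 Q w v v' + lin P w v' * lin Q w v
     + (lin P w v * lin Q w v' + lin2 P w v v' * ev Q w)"
| "lin2 (Scale c P) w v v' = scaleC c (lin2 P w v v')"
| "lin2 (Deriv i P) w v v' = D i (lin2 P w v v')"

text \<open>Symmetry of second derivatives is purely algebraic here; through
  \<open>d2val_commute\<close> it becomes the source of the Jacobi identity.\<close>

lemma lin2_commute: "lin2 P w v v' = lin2 P w v' v"
  by (induction P) (auto simp: algebra_simps)

lemma pcurve_ev: "pcurve (deg P) (\<lambda>t. ev P (line w v t)) (ev P w) (lin P w v)"
proof (induction P)
  case (Var a)
  show ?case using pcurve_line by (simp add: line_def)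
next
  case (Plus P Q)
  show ?case using pcurve.add[OF pcurve_mono[OF Plus(1)] pcurve_mono[OF Plus(2)], of "deg (Plus P Q)"] by simp
next
  case (Times P Q)
  show ?case using pcurve_mult[OF Times] by simp
next
  case (Scale c P)
  show ?case using pcurve_linear[OF Scale linear_scaleC] by simp
next
  case (Deriv i P)
  show ?case using pcurve_linear[OF Deriv linear_D] by simp
qed

lemma pcurve_lin: "pcurve (deg P) (\<lambda>t. lin P (line w v' t) v) (lin P w v) (lin2 P w v v')"
proof (induction P)
  case (Var a)
  show ?case by (simp add: pcurve.const)
next
  case (Plus P Q)
  show ?case using pcurve.add[OF pcurve_mono[OF Plus(1)] pcurve_mono[OF Plus(2)], of "deg (Plus P Q)"] by simp
next
  case (Times P Q)
  show ?case
    using pcurve.add[OF pcurve_mult[OF pcurve_ev[of P] Times(2)] pcurve_mult[OF Times(1) pcurve_ev[of Q]]]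
    by simp
next
  case (Scale c P)
  show ?case using pcurve_linear[OF Scale linear_scaleC] by simp
next
  case (Deriv i P)
  show ?case using pcurve_linear[OF Deriv linear_D] by simp
qed

text \<open>The formal adjoint of \<open>lin P w\<close>, obtained by integration by parts.\<close>

primrec adj :: "dterm \<Rightarrow> var \<Rightarrow> fields \<Rightarrow> cfield \<Rightarrow> cfield" where
  "adj (Var b) a w \<xi> = (if a = b then \<xi> else 0)"
| "adj (Plus P Q) a w \<xi> = adj P a w \<xi> + adj Q a w \<xi>"
| "adj (Times P Q) a w \<xi> = adj Q a w (\<xi> * ev P w) + adj P a w (\<xi> * ev Q w)"
| "adj (Scale c P) a w \<xi> = adj P a w (scaleC c \<xi>)"
| "adj (Deriv i P) a w \<xi> = adj P a w (- D i \<xi>)"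

lemma intg_lin: "intg (\<xi> * lin P w v) = (\<Sum>a\<in>UNIV. intg (adj P a w \<xi> * v a))"
proof (induction P arbitrary: \<xi>)
  case (Var b)
  show ?case by (cases b) (simp_all add: sum_var)
next
  case (Plus P Q)
  thus ?case by (simp add: algebra_simps sum.distrib)
next
  case (Times P Q)
  have "\<xi> * lin (Times P Q) w v = \<xi> * ev P w * lin Q w v + \<xi> * ev Q w * lin P w v"
    by (simp add: algebra_simps)
  thus ?case by (simp add: Times distrib_right sum.distrib)
next
  case (Scale c P)
  have "\<xi> * lin (Scale c P) w v = scaleC c \<xi> * lin P w v" by simp
  thus ?case by (simp add: Scale del: scaleC_simps)
next
  case (Deriv i P)
  have "intg (\<xi> * lin (Deriv i P) w v) = intg (- D i \<xi> * lin P w v)" by (simp add: intg_by_parts)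
  thus ?case by (simp add: Deriv del: minus_mult_left[symmetric] mult_minus_left)
qed

text \<open>Functional derivatives stay differential polynomials, which is what closes the
  functionals under the bracket. The argument \<open>Q\<close> must be general because
  \<open>adj\<close> accumulates factors and derivatives in it.\<close>

lemma ev_adj: "\<exists>R. \<forall>w. ev R w = adj P a w (ev Q w)"
proof (induction P arbitrary: Q)
  case (Var b)
  show ?case by (cases "a = b") (auto intro: exI[of _ Q] exI[of _ "Scale 0 Q"])
next
  case (Plus P1 P2)
  obtain R1 R2 where "\<forall>w. ev R1 w = adj P1 a w (ev Q w)" "\<forall>w. ev R2 w = adj P2 a w (ev Q w)"
    using Plus by metis
  thus ?case by (intro exI[of _ "Plus R1 R2"]) simp
next
  case (Times P1 P2)
  obtain R1 R2 where "\<forall>w. ev R1 w = adj P2 a w (ev (Times Q P1) w)"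
    "\<forall>w. ev R2 w = adj P1 a w (ev (Times Q P2) w)"
    using Times by metis
  thus ?case by (intro exI[of _ "Plus R1 R2"]) simp
next
  case (Scale c P)
  obtain R where "\<forall>w. ev R w = adj P a w (ev (Scale c Q) w)" using Scale by metis
  thus ?case by (intro exI[of _ R]) simp
next
  case (Deriv i P)
  obtain R where "\<forall>w. ev R w = adj P a w (ev (Scale (-1) (Deriv i Q)) w)" using Deriv by metis
  thus ?case by (intro exI[of _ R]) simp
qed

text \<open>The derivative is left unspecified: \<open>dval_br\<close> needs only its pairings, and
  these are determined by uniqueness of derivatives.\<close>

lemma pcurve_adj:
  "pcurve n c c0 c1 \<Longrightarrow> \<exists>m d1. pcurve m (\<lambda>t. adj P a (line w v t) (c t)) (adj P a w c0) d1"
proof (induction P arbitrary: n c c0 c1)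
  case (Var b)
  thus ?case by (cases "a = b") (auto intro: pcurve.const)
next
  case (Plus P Q)
  obtain m d1 m' d1' where "pcurve m (\<lambda>t. adj P a (line w v t) (c t)) (adj P a w c0) d1"
    "pcurve m' (\<lambda>t. adj Q a (line w v t) (c t)) (adj Q a w c0) d1'" using Plus by meson
  from pcurve.add[OF pcurve_mono[OF this(1), of "m + m'"] pcurve_mono[OF this(2), of "m + m'"]]
  show ?case by auto
next
  case (Times P Q)
  obtain m d1 m' d1' where
    "pcurve m (\<lambda>t. adj Q a (line w v t) (c t * ev P (line w v t))) (adj Q a w (c0 * ev P w)) d1"
    "pcurve m' (\<lambda>t. adj P a (line w v t) (c t * ev Q (line w v t))) (adj P a w (c0 * ev Q w)) d1'"
    using Times(2)[OF pcurve_mult[OF Times(3) pcurve_ev]] Times(1)[OF pcurve_mult[OF Times(3) pcurve_ev]]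
    by meson
  from pcurve.add[OF pcurve_mono[OF this(1), of "m + m'"] pcurve_mono[OF this(2), of "m + m'"]]
  show ?case by auto
next
  case (Scale b P)
  show ?case using Scale.IH[OF pcurve_linear[OF Scale.prems linear_scaleC[of b]]] by simp
next
  case (Deriv i P)
  have "linear (\<lambda>x. - D i x)" by (intro linearI) simp_all
  from Deriv.IH[OF pcurve_linear[OF Deriv.prems this]] show ?case by simp
qed

section \<open>Functionals, their gradients and second derivatives\<close>

datatype fterm = IntProd dterm dterm | FPlus fterm fterm | FTimes fterm fterm | FScale complex fterm

primrec val :: "fterm \<Rightarrow> fields \<Rightarrow> complex" where
  "val (IntProd P Q) w = intg (ev P w * ev Q w)"
| "val (FPlus f g) w = val f w + val g w"
| "val (FTimes f g) w = val f w * val g w"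
| "val (FScale c f) w = c * val f w"

primrec fdeg :: "fterm \<Rightarrow> nat" where
  "fdeg (IntProd P Q) = deg P + deg Q"
| "fdeg (FPlus f g) = max (fdeg f) (fdeg g)"
| "fdeg (FTimes f g) = fdeg f + fdeg g"
| "fdeg (FScale c f) = fdeg f"

primrec dval :: "fterm \<Rightarrow> fields \<Rightarrow> fields \<Rightarrow> complex" where
  "dval (IntProd P Q) w v = intg (ev P w * lin Q w v + lin P w v * ev Q w)"
| "dval (FPlus f g) w v = dval f w v + dval g w v"
| "dval (FTimes f g) w v = val f w * dval g w v + dval f w v * val g w"
| "dval (FScale c f) w v = c * dval f w v"

primrec d2val :: "fterm \<Rightarrow> fields \<Rightarrow> fields \<Rightarrow> fields \<Rightarrow> complex" where
  "d2val (IntProd P Q) w v v' = intg (ev P w * lin2 Q w v v' + lin P w v' * lin Q w v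
     + (lin P w v * lin Q w v' + lin2 P w v v' * ev Q w))"
| "d2val (FPlus f g) w v v' = d2val f w v v' + d2val g w v v'"
| "d2val (FTimes f g) w v v' = val f w * d2val g w v v' + dval f w v' * dval g w v
     + (dval f w v * dval g w v' + d2val f w v v' * val g w)"
| "d2val (FScale c f) w v v' = c * d2val f w v v'"

text \<open>The gradient of \<open>val f\<close> for the pairing by \<open>intg\<close>, see
  \<open>dval_grd\<close>. Products of functionals give it nonlocal scalar coefficients
  \<open>val f w\<close>, hence the class \<open>grd_like\<close>.\<close>

primrec grd :: "fterm \<Rightarrow> var \<Rightarrow> fields \<Rightarrow> cfield" where
  "grd (IntProd P Q) a w = adj Q a w (ev P w) + adj P a w (ev Q w)"
| "grd (FPlus f g) a w = grd f a w + grd g a w"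
| "grd (FTimes f g) a w = scaleC (val f w) (grd g a w) + scaleC (val g w) (grd f a w)"
| "grd (FScale c f) a w = scaleC c (grd f a w)"

lemma d2val_commute: "d2val f w v v' = d2val f w v' v"
  by (induction f) (auto simp: algebra_simps lin2_commute[of _ w v v'])

lemma pcurve_val: "pcurve (fdeg f) (\<lambda>t. val f (line w v t)) (val f w) (dval f w v)"
proof (induction f)
  case (IntProd P Q)
  show ?case using pcurve_linear[OF pcurve_mult[OF pcurve_ev[of P w v] pcurve_ev[of Q w v]] linear_intg] by simp
next
  case (FPlus f g)
  show ?case
    using pcurve.add[OF pcurve_mono[OF FPlus(1)] pcurve_mono[OF FPlus(2)], of "fdeg (FPlus f g)"] by simp
next
  case (FTimes f g)
  show ?case using pcurve_mult[OF FTimes] by simp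
next
  case (FScale c f)
  show ?case using pcurve_mult[OF pcurve.const[of 0 c] FScale] by simp
qed

lemma pcurve_dval: "\<exists>n. pcurve n (\<lambda>t. dval f (line w v' t) v) (dval f w v) (d2val f w v v')"
proof (induction f)
  case (IntProd P Q)
  show ?case
    using pcurve_linear[OF pcurve.add[OF
        pcurve_mult[OF pcurve_ev[of P w v'] pcurve_lin[of Q w v' v]]
        pcurve_mult[OF pcurve_lin[of P w v' v] pcurve_ev[of Q w v']]] linear_intg] by auto
next
  case (FPlus f g)
  then obtain m n where "pcurve m (\<lambda>t. dval f (line w v' t) v) (dval f w v) (d2val f w v v')"
    "pcurve n (\<lambda>t. dval g (line w v' t) v) (dval g w v) (d2val g w v v')" by blast
  from pcurve.add[OF pcurve_mono[OF this(1), of "m + n"] pcurve_mono[OF this(2), of "m + n"]]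
  show ?case by auto
next
  case (FTimes f g)
  then obtain m n where "pcurve m (\<lambda>t. dval f (line w v' t) v) (dval f w v) (d2val f w v v')"
    "pcurve n (\<lambda>t. dval g (line w v' t) v) (dval g w v) (d2val g w v v')" by blast
  from pcurve.add[OF pcurve_mono[OF pcurve_mult[OF pcurve_val[of f w v'] this(2)], of "fdeg f + n + (m + fdeg g)"]
      pcurve_mono[OF pcurve_mult[OF this(1) pcurve_val[of g w v']], of "fdeg f + n + (m + fdeg g)"]]
  show ?case by auto
next
  case (FScale c f)
  then obtain n where "pcurve n (\<lambda>t. dval f (line w v' t) v) (dval f w v) (d2val f w v v')" by blast
  from pcurve_mult[OF pcurve.const[of 0 c] this] show ?case by auto
qed

lemma dval_grd: "dval f w v = (\<Sum>a\<in>UNIV. intg (grd f a w * v a))"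
proof (induction f)
  case (IntProd P Q)
  have "dval (IntProd P Q) w v = intg (ev P w * lin Q w v) + intg (ev Q w * lin P w v)"
    by (simp add: mult.commute)
  thus ?case by (simp add: intg_lin distrib_right sum.distrib)
qed (simp_all add: sum_var algebra_simps)

lemma pcurve_grd: "\<exists>n g1. pcurve n (\<lambda>t. grd f a (line w v t)) (grd f a w) g1"
proof (induction f)
  case (IntProd P Q)
  obtain m d m' d' where
    "pcurve m (\<lambda>t. adj Q a (line w v t) (ev P (line w v t))) (adj Q a w (ev P w)) d"
    "pcurve m' (\<lambda>t. adj P a (line w v t) (ev Q (line w v t))) (adj P a w (ev Q w)) d'"
    using pcurve_adj[OF pcurve_ev] by meson
  from pcurve.add[OF pcurve_mono[OF this(1), of "m + m'"] pcurve_mono[OF this(2), of "m + m'"]]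
  show ?case by auto
next
  case (FPlus f g)
  then obtain m d m' d' where "pcurve m (\<lambda>t. grd f a (line w v t)) (grd f a w) d"
    "pcurve m' (\<lambda>t. grd g a (line w v t)) (grd g a w) d'" by blast
  from pcurve.add[OF pcurve_mono[OF this(1), of "m + m'"] pcurve_mono[OF this(2), of "m + m'"]]
  show ?case by auto
next
  case (FTimes f g)
  then obtain m d m' d' where "pcurve m (\<lambda>t. grd f a (line w v t)) (grd f a w) d"
    "pcurve m' (\<lambda>t. grd g a (line w v t)) (grd g a w) d'" by blast
  from pcurve.add[OF pcurve_mono[OF pcurve_scaleC[OF pcurve_val[of f w v] this(2)], of "fdeg f + m' + (fdeg g + m)"]
      pcurve_mono[OF pcurve_scaleC[OF pcurve_val[of g w v] this(1)], of "fdeg f + m' + (fdeg g + m)"]]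
  show ?case by auto
next
  case (FScale c f)
  then obtain n d where "pcurve n (\<lambda>t. grd f a (line w v t)) (grd f a w) d" by blast
  from pcurve_linear[OF this linear_scaleC] show ?case by auto
qed

text \<open>Maps of the form \<open>\<Sum> val f \<cdot> ev P\<close>, the shape of a functional derivative.\<close>

inductive grd_like :: "(fields \<Rightarrow> cfield) \<Rightarrow> bool" where
  ev: "grd_like (ev P)"
| add: "grd_like d \<Longrightarrow> grd_like e \<Longrightarrow> grd_like (\<lambda>w. d w + e w)"
| scale: "grd_like d \<Longrightarrow> grd_like (\<lambda>w. scaleC (val f w) (d w))"
| scale_const: "grd_like d \<Longrightarrow> grd_like (\<lambda>w. scaleC c (d w))"

lemma grd_like_grd: "grd_like (grd f a)"
proof (induction f)
  case (IntProd P Q)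
  obtain R S where "\<forall>w. ev R w = adj Q a w (ev P w)" "\<forall>w. ev S w = adj P a w (ev Q w)"
    using ev_adj by metis
  hence "grd (IntProd P Q) a = ev (Plus R S)" by (auto simp: fun_eq_iff)
  thus ?case by (metis grd_like.ev)
next
  case (FPlus f g)
  have "grd (FPlus f g) a = (\<lambda>w. grd f a w + grd g a w)" by (rule ext) simp
  thus ?case using grd_like.add[OF FPlus] by simp
next
  case (FTimes f g)
  have "grd (FTimes f g) a = (\<lambda>w. scaleC (val f w) (grd g a w) + scaleC (val g w) (grd f a w))"
    by (rule ext) simp
  thus ?case using grd_like.add[OF grd_like.scale[OF FTimes(2), of f] grd_like.scale[OF FTimes(1), of g]] by simp
next
  case (FScale c f)
  have "grd (FScale c f) a = (\<lambda>w. scaleC c (grd f a w))" by (rule ext) simp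
  thus ?case using grd_like.scale_const[OF FScale] by simp
qed

text \<open>The scalars \<open>val f w\<close> leave the integral as factors, and a product of
  integrals is again a functional. This gives closure under the bracket in
  \<open>ex_br\<close>.\<close>

lemma intg_grd_like:
  assumes "grd_like d" "grd_like e"
  shows "\<exists>h. \<forall>w. val h w = intg (d w * e w)"
  using assms(1)
proof induction
  case (ev P)
  show ?case using assms(2)
  proof induction
    case (ev Q)
    show ?case by (rule exI[of _ "IntProd P Q"]) simp
  next
    case (add d e)
    then obtain h k where "\<forall>w. val h w = intg (ev P w * d w)" "\<forall>w. val k w = intg (ev P w * e w)" by blast
    thus ?case by (intro exI[of _ "FPlus h k"]) (simp add: distrib_left)
  next
    case (scale d f)
    then obtain h where "\<forall>w. val h w = intg (ev P w * d w)" by blast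
    thus ?case by (intro exI[of _ "FTimes f h"]) simp
  next
    case (scale_const d c)
    then obtain h where "\<forall>w. val h w = intg (ev P w * d w)" by blast
    thus ?case by (intro exI[of _ "FScale c h"]) simp
  qed
next
  case (add d d')
  then obtain h k where "\<forall>w. val h w = intg (d w * e w)" "\<forall>w. val k w = intg (d' w * e w)" by blast
  thus ?case by (intro exI[of _ "FPlus h k"]) (simp add: distrib_right)
next
  case (scale d f)
  then obtain h where "\<forall>w. val h w = intg (d w * e w)" by blast
  thus ?case by (intro exI[of _ "FTimes f h"]) simp
next
  case (scale_const d c)
  then obtain h where "\<forall>w. val h w = intg (d w * e w)" by blast
  thus ?case by (intro exI[of _ "FScale c h"]) simp
qed

section \<open>The bracket on independent fields and the Jacobi identity\<close>

definition br :: "fterm \<Rightarrow> fterm \<Rightarrow> fields \<Rightarrow> complex" where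
  "br f g w = - \<i> * intg (grd f Psi w * grd g Psis w - grd f Psis w * grd g Psi w)
     + intg (grd f Phi w * grd g PPhi w - grd f PPhi w * grd g Phi w)"

text \<open>The Hamiltonian vector field of \<open>g\<close>: bracketing with \<open>g\<close> on
  the right is differentiation along it (\<open>br_dval\<close>).\<close>

primrec ham_field :: "fterm \<Rightarrow> fields \<Rightarrow> fields" where
  "ham_field g w Psi = scaleC (- \<i>) (grd g Psis w)"
| "ham_field g w Psis = scaleC \<i> (grd g Psi w)"
| "ham_field g w Phi = grd g PPhi w"
| "ham_field g w PPhi = - grd g Phi w"

lemma br_dval: "br f g w = dval f w (ham_field g w)"
  by (simp add: br_def dval_grd sum_var algebra_simps)

lemma br_dval': "br f g w = - dval g w (ham_field f w)"
  by (simp add: br_def dval_grd sum_var algebra_simps)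

lemma ex_br: "\<exists>h. \<forall>w. val h w = br f g w"
proof -
  obtain h where h: "\<And>a b w. val (h a b) w = intg (grd f a w * grd g b w)"
    using intg_grd_like[OF grd_like_grd[of f] grd_like_grd[of g]] by metis
  let ?h = "FPlus (FScale (- \<i>) (FPlus (h Psi Psis) (FScale (-1) (h Psis Psi))))
      (FPlus (h Phi PPhi) (FScale (-1) (h PPhi Phi)))"
  have "\<forall>w. val ?h w = br f g w" by (simp add: h br_def)
  thus ?thesis by blast
qed

lemma pcurve_unique:
  fixes c :: "real \<Rightarrow> complex"
  assumes "pcurve n c c0 c1" "pcurve m c c0' c1'"
  shows "c1 = c1'"
  using assms[THEN pcurve_has_vector_derivative] vector_derivative_unique_at by blast

text \<open>Differentiating the bilinear expression \<open>br f g\<close> hits one gradient at a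
  time, and the derivative of a gradient, paired with a vector field, is a second
  derivative.\<close>

lemma dval_br:
  assumes h: "\<forall>w. val h w = br f g w"
  shows "dval h w v = d2val f w (ham_field g w) v - d2val g w (ham_field f w) v"
proof -
  have ex: "\<exists>n G. \<forall>a. pcurve (n a) (\<lambda>t. grd k a (line w v t)) (grd k a w) (G a)" for k
    using choice[of "\<lambda>a p. pcurve (fst p) (\<lambda>t. grd k a (line w v t)) (grd k a w) (snd p)"]
      pcurve_grd[of k _ w v] by (metis fst_conv snd_conv)
  obtain nf Gf where F: "\<And>a. pcurve (nf a) (\<lambda>t. grd f a (line w v t)) (grd f a w) (Gf a)"
    using ex[of f] by blast
  obtain ng Gg where G: "\<And>a. pcurve (ng a) (\<lambda>t. grd g a (line w v t)) (grd g a w) (Gg a)"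
    using ex[of g] by blast
  \<comment> \<open>Both sides are the derivative at \<open>t = 0\<close> of
    \<open>dval k (line w v t) u\<close>, once directly and once through
    \<open>dval_grd\<close>.\<close>
  have second: "d2val k w u v = (\<Sum>a\<in>UNIV. intg (Gk a * u a))"
    if K: "\<And>a. pcurve (nk a) (\<lambda>t. grd k a (line w v t)) (grd k a w) (Gk a)" for k u nk Gk
  proof -
    obtain n where 1: "pcurve n (\<lambda>t. dval k (line w v t) u) (dval k w u) (d2val k w u v)"
      using pcurve_dval by blast
    have "pcurve (nk a + 0) (\<lambda>t. grd k a (line w v t) * u a) (grd k a w * u a) (Gk a * u a)" for a
      using pcurve_mult[OF K pcurve.const[of 0 "u a"]] by simp
    hence c: "pcurve (nk a) (\<lambda>t. intg (grd k a (line w v t) * u a)) (intg (grd k a w * u a)) (intg (Gk a * u a))" for a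
      using pcurve_linear[OF _ linear_intg] by simp
    define N where "N = nk Psi + nk Psis + nk Phi + nk PPhi"
    have "pcurve N (\<lambda>t. \<Sum>a\<in>UNIV. intg (grd k a (line w v t) * u a))
        (\<Sum>a\<in>UNIV. intg (grd k a w * u a)) (\<Sum>a\<in>UNIV. intg (Gk a * u a))"
      unfolding sum_var
      by (intro pcurve.add; rule pcurve_mono[OF c]; simp add: N_def)
    thus ?thesis using pcurve_unique[OF 1[unfolded dval_grd]] by blast
  qed
  define N where "N = (\<Sum>a\<in>UNIV. nf a) + (\<Sum>a\<in>UNIV. ng a)"
  have m: "pcurve N (\<lambda>t. intg (grd f a (line w v t) * grd g b (line w v t)))
      (intg (grd f a w * grd g b w)) (intg (grd f a w * Gg b + Gf a * grd g b w))" for a b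
    by (rule pcurve_linear[OF pcurve_mono[OF pcurve_mult[OF F G]] linear_intg])
       (auto simp: N_def intro!: add_mono member_le_sum)
  have m': "pcurve N (\<lambda>t. c * intg (grd f a (line w v t) * grd g b (line w v t)))
      (c * intg (grd f a w * grd g b w)) (c * intg (grd f a w * Gg b + Gf a * grd g b w))" for a b c
    using pcurve_mult[OF pcurve.const[of 0 c] m] by simp
  have "pcurve N (\<lambda>t. br f g (line w v t)) (br f g w)
      (- \<i> * intg (grd f Psi w * Gg Psis + Gf Psi * grd g Psis w)
       + \<i> * intg (grd f Psis w * Gg Psi + Gf Psis * grd g Psi w)
       + (1 * intg (grd f Phi w * Gg PPhi + Gf Phi * grd g PPhi w)
       + (- 1) * intg (grd f PPhi w * Gg Phi + Gf PPhi * grd g Phi w)))"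
    using pcurve.add[OF pcurve.add[OF m'[of "- \<i>" Psi Psis] m'[of \<i> Psis Psi]]
       pcurve.add[OF m'[of 1 Phi PPhi] m'[of "- 1" PPhi Phi]]]
    by (simp add: br_def algebra_simps)
  moreover have "pcurve (fdeg h) (\<lambda>t. br f g (line w v t)) (br f g w) (dval h w v)"
    using pcurve_val[of h w v] h by simp
  ultimately have "dval h w v = - \<i> * intg (grd f Psi w * Gg Psis + Gf Psi * grd g Psis w)
       + \<i> * intg (grd f Psis w * Gg Psi + Gf Psis * grd g Psi w)
       + (1 * intg (grd f Phi w * Gg PPhi + Gf Phi * grd g PPhi w)
       + (- 1) * intg (grd f PPhi w * Gg Phi + Gf PPhi * grd g Phi w))"
    by (blast dest: pcurve_unique)
  also have "\<dots> = d2val f w (ham_field g w) v - d2val g w (ham_field f w) v"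
    unfolding second[OF F] second[OF G] sum_var by (simp add: algebra_simps)
  finally show ?thesis .
qed

text \<open>By \<open>dval_br\<close> every double bracket is a difference of two second derivatives
  along Hamiltonian fields; those of \<open>k\<close> cancel by symmetry, those of \<open>f\<close>
  and \<open>g\<close> match.\<close>

lemma br_jacobi:
  assumes "\<forall>w. val fg w = br f g w" "\<forall>w. val fk w = br f k w" "\<forall>w. val gk w = br g k w"
  shows "br fg k w = br fk g w + br f gk w"
proof -
  have "br f gk w = - dval gk w (ham_field f w)" by (rule br_dval')
  thus ?thesis
    using d2val_commute[of f w "ham_field g w" "ham_field k w"]
      d2val_commute[of g w "ham_field f w" "ham_field k w"]
      d2val_commute[of k w "ham_field f w" "ham_field g w"]
    by (simp add: br_dval dval_br[OF assms(1)] dval_br[OF assms(2)] dval_br[OF assms(3)])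
qed

section \<open>Functionals on phase space\<close>

lift_definition complexify :: "sfield \<Rightarrow> cfield" is "\<lambda>\<eta> x. complex_of_real (at_point \<eta> x)"
  using schwartz_linear[OF bounded_linear_of_real] at_point by blast

lemma fun_of_complexify [simp]: "fun_of (complexify \<eta>) x = of_real (at_point \<eta> x)"
  by transfer simp

lemma complexify_add: "complexify (\<eta> + \<zeta>) = complexify \<eta> + complexify \<zeta>"
  by (rule cfield_eqI) (simp add: at_point_add)

lemma complexify_scaleR: "complexify (t *\<^sub>R \<eta>) = t *\<^sub>R complexify \<eta>"
  by (rule cfield_eqI) (simp add: at_point_scaleR scaleR_conv_of_real)

primrec fields_of :: "phase \<Rightarrow> fields" where
  "fields_of z Psi = scaleC (1 / of_real (sqrt 2)) (complexify (z U) + scaleC \<i> (complexify (z PU)))"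
| "fields_of z Psis = scaleC (1 / of_real (sqrt 2)) (complexify (z U) - scaleC \<i> (complexify (z PU)))"
| "fields_of z Phi = complexify (z PHI)"
| "fields_of z PPhi = complexify (z PPHI)"

lemma fun_of_fields:
  "fun_of (fields_of z Psi) = psi z" "fun_of (fields_of z Psis) = psis z"
  "fun_of (fields_of z Phi) = phi z" "fun_of (fields_of z PPhi) = pphi z"
  by (auto simp: psi_def psis_def phi_def pphi_def)

lemma diff_poly_ev: "diff_poly (\<lambda>z. fun_of (ev P (fields_of z)))"
proof (induction P)
  case (Var a)
  show ?case by (cases a) (simp_all add: fun_of_fields diff_poly.intros del: fields_of.simps)
next
  case (Plus P Q)
  show ?case using diff_poly.intros(5)[OF Plus] by (simp add: fun_of_ext)
next
  case (Times P Q)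
  show ?case using diff_poly.intros(6)[OF Times] by (simp add: fun_of_ext)
next
  case (Scale c P)
  show ?case using diff_poly.intros(7)[OF Scale] by (simp add: fun_of_ext)
next
  case (Deriv i P)
  show ?case using diff_poly.intros(8)[OF Deriv] by (simp add: fun_of_D)
qed

lemma diff_polyE:
  assumes "diff_poly P"
  obtains p where "P = (\<lambda>z. fun_of (ev p (fields_of z)))"
proof -
  have "\<exists>p. P = (\<lambda>z. fun_of (ev p (fields_of z)))"
    using assms
  proof induction
    case (5 P Q)
    then obtain p q where "P = (\<lambda>z. fun_of (ev p (fields_of z)))" "Q = (\<lambda>z. fun_of (ev q (fields_of z)))" by blast
    thus ?case by (intro exI[of _ "Plus p q"]) (simp add: fun_eq_iff)
  next
    case (6 P Q)
    then obtain p q where "P = (\<lambda>z. fun_of (ev p (fields_of z)))" "Q = (\<lambda>z. fun_of (ev q (fields_of z)))" by blast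
    thus ?case by (intro exI[of _ "Times p q"]) (simp add: fun_eq_iff)
  next
    case (7 P c)
    then obtain p where "P = (\<lambda>z. fun_of (ev p (fields_of z)))" by blast
    thus ?case by (intro exI[of _ "Scale c p"]) (simp add: fun_eq_iff)
  next
    case (8 P i)
    then obtain p where "P = (\<lambda>z. fun_of (ev p (fields_of z)))" by blast
    thus ?case by (intro exI[of _ "Deriv i p"]) (simp add: fun_of_D)
  qed (rule exI[of _ "Var Psi"] exI[of _ "Var Psis"] exI[of _ "Var Phi"] exI[of _ "Var PPhi"],
       simp add: fun_of_fields del: fields_of.simps)+
  thus ?thesis using that by blast
qed

definition fnl_of :: "fterm \<Rightarrow> fnl" where
  "fnl_of f z = val f (fields_of z)"

lemma is_functional_fnl_of: "is_functional (fnl_of f)"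
proof (induction f)
  case (IntProd P Q)
  have "fnl_of (IntProd P Q) = (\<lambda>z. \<integral>x. fun_of (ev P (fields_of z)) x * fun_of (ev Q (fields_of z)) x \<partial>lborel)"
    by (simp add: fnl_of_def fun_eq_iff intg_eq fun_of_ext)
  thus ?case using is_functional.intros(1)[OF diff_poly_ev diff_poly_ev, of P Q] by (simp only:)
next
  case (FPlus f g)
  have "fnl_of (FPlus f g) = (\<lambda>z. fnl_of f z + fnl_of g z)" by (simp add: fnl_of_def fun_eq_iff)
  thus ?case using is_functional.intros(2)[OF FPlus] by (simp only:)
next
  case (FTimes f g)
  have "fnl_of (FTimes f g) = (\<lambda>z. fnl_of f z * fnl_of g z)" by (simp add: fnl_of_def fun_eq_iff)
  thus ?case using is_functional.intros(3)[OF FTimes] by (simp only:)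
next
  case (FScale c f)
  have "fnl_of (FScale c f) = (\<lambda>z. c * fnl_of f z)" by (simp add: fnl_of_def fun_eq_iff)
  thus ?case using is_functional.intros(4)[OF FScale] by (simp only:)
qed

lemma functionalE:
  assumes "is_functional F"
  obtains f where "F = fnl_of f"
proof -
  have "\<exists>f. F = fnl_of f"
    using assms
  proof induction
    case (1 P Q)
    obtain p q where "P = (\<lambda>z. fun_of (ev p (fields_of z)))" "Q = (\<lambda>z. fun_of (ev q (fields_of z)))"
      using 1 by (auto elim!: diff_polyE)
    thus ?case by (intro exI[of _ "IntProd p q"]) (simp add: fun_eq_iff fnl_of_def intg_eq fun_of_ext)
  next
    case (2 F G)
    then obtain f g where "F = fnl_of f" "G = fnl_of g" by blast
    thus ?case by (intro exI[of _ "FPlus f g"]) (simp add: fun_eq_iff fnl_of_def)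
  next
    case (3 F G)
    then obtain f g where "F = fnl_of f" "G = fnl_of g" by blast
    thus ?case by (intro exI[of _ "FTimes f g"]) (simp add: fun_eq_iff fnl_of_def)
  next
    case (4 F c)
    then obtain f where "F = fnl_of f" by blast
    thus ?case by (intro exI[of _ "FScale c f"]) (simp add: fun_eq_iff fnl_of_def)
  qed
  thus ?thesis using that by blast
qed

text \<open>The velocities of the four complex fields when a single real coordinate moves; the
  factors are the derivatives of \<psi> and its conjugate by \<open>U\<close> and \<open>PU\<close>.
  \<open>coord_grd\<close> is the transposed chain rule.\<close>

primrec direction :: "coord \<Rightarrow> cfield \<Rightarrow> fields" where
  "direction U \<eta> = (\<lambda>a. case a of Psi \<Rightarrow> scaleC (1 / of_real (sqrt 2)) \<eta>
     | Psis \<Rightarrow> scaleC (1 / of_real (sqrt 2)) \<eta> | _ \<Rightarrow> 0)"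
| "direction PU \<eta> = (\<lambda>a. case a of Psi \<Rightarrow> scaleC (\<i> / of_real (sqrt 2)) \<eta>
     | Psis \<Rightarrow> scaleC (- \<i> / of_real (sqrt 2)) \<eta> | _ \<Rightarrow> 0)"
| "direction PHI \<eta> = (\<lambda>a. if a = Phi then \<eta> else 0)"
| "direction PPHI \<eta> = (\<lambda>a. if a = PPhi then \<eta> else 0)"

primrec coord_grd :: "fterm \<Rightarrow> coord \<Rightarrow> fields \<Rightarrow> cfield" where
  "coord_grd f U w = scaleC (1 / of_real (sqrt 2)) (grd f Psi w + grd f Psis w)"
| "coord_grd f PU w = scaleC (\<i> / of_real (sqrt 2)) (grd f Psi w - grd f Psis w)"
| "coord_grd f PHI w = grd f Phi w"
| "coord_grd f PPHI w = grd f PPhi w"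

lemma fields_of_line:
  "fields_of (z(c := z c + t *\<^sub>R \<eta>)) = line (fields_of z) (direction c (complexify \<eta>)) t"
proof (rule ext)
  fix a
  show "fields_of (z(c := z c + t *\<^sub>R \<eta>)) a = line (fields_of z) (direction c (complexify \<eta>)) t a"
    by (cases a; cases c; intro cfield_eqI)
       (simp_all add: line_def at_point_add at_point_scaleR scaleR_conv_of_real add_divide_distrib
          diff_divide_distrib distrib_left right_diff_distrib distrib_right)
qed

lemma dval_direction: "dval f w (direction c \<eta>) = intg (coord_grd f c w * \<eta>)"
  by (cases c) (simp_all add: dval_grd sum_var algebra_simps)

lemma has_fderiv_fnl_of: "has_fderiv (fnl_of f) c z (fun_of (coord_grd f c (fields_of z)))"
  unfolding has_fderiv_def
proof (intro conjI allI)
  fix \<eta>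
  have "((\<lambda>t. fnl_of f (z(c := z c + t *\<^sub>R \<eta>))) has_vector_derivative
      dval f (fields_of z) (direction c (complexify \<eta>))) (at 0)"
    unfolding fnl_of_def fields_of_line by (rule pcurve_has_vector_derivative[OF pcurve_val])
  thus "((\<lambda>t. fnl_of f (z(c := z c + t *\<^sub>R \<eta>))) has_vector_derivative
      (\<integral>x. fun_of (coord_grd f c (fields_of z)) x * of_real (at_point \<eta> x) \<partial>lborel)) (at 0)"
    by (simp add: dval_direction intg_eq fun_of_ext)
qed (rule schwartz_fun_of)

text \<open>The fundamental lemma of the calculus of variations without bump functions: the real
  part of \<open>d\<close> is itself an admissible test function.\<close>

lemma schwartz_test_zero:
  fixes d :: cfield
  assumes "\<And>\<eta>. intg (d * complexify \<eta>) = 0"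
  shows "d = 0"
proof -
  have Re_zero: "Re (fun_of d x) = 0" if d: "\<And>\<eta>. intg (d * complexify \<eta>) = 0" for d x
  proof -
    have s: "schwartz (\<lambda>x. Re (fun_of d x))"
      by (rule schwartz_linear[OF bounded_linear_Re schwartz_fun_of])
    define \<eta> where "\<eta> = Abs_sfield (\<lambda>x. Re (fun_of d x))"
    have \<eta>: "at_point \<eta> x = Re (fun_of d x)" for x
      unfolding \<eta>_def using s by (simp add: Abs_sfield_inverse)
    have "0 = Re (intg (d * complexify \<eta>))" using d by simp
    also have "\<dots> = (\<integral>x. Re (fun_of (d * complexify \<eta>) x) \<partial>lborel)"
      unfolding intg_eq by (rule integral_bounded_linear[OF bounded_linear_Re integrable_fun_of, symmetric])
    finally have "(\<integral>x. Re (fun_of d x) * Re (fun_of d x) \<partial>lborel) = 0" by (simp add: \<eta>)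
    thus ?thesis using schwartz_eq_0[OF s] by blast
  qed
  \<comment> \<open>The real part of \<open>- \<i>\<close> times \<open>d\<close> is the imaginary
    part of \<open>d\<close>.\<close>
  have "intg (scaleC (- \<i>) d * complexify \<eta>) = 0" for \<eta> using assms by simp
  from Re_zero[OF assms] Re_zero[OF this] show ?thesis
    by (intro cfield_eqI complex_eqI) auto
qed

lemma has_fderiv_unique:
  assumes "has_fderiv F c z d" "has_fderiv F c z e"
  shows "d = e"
proof -
  obtain d' e' where [simp]: "d = fun_of d'" "e = fun_of e'"
    using assms by (metis Cfield_inverse has_fderiv_def mem_Collect_eq)
  have "intg (d' * complexify \<eta>) = intg (e' * complexify \<eta>)" for \<eta>
    using assms unfolding has_fderiv_def by (auto simp: intg_eq fun_of_ext intro: vector_derivative_unique_at)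
  hence "d' - e' = 0" by (intro schwartz_test_zero) (simp add: left_diff_distrib)
  thus ?thesis by simp
qed

lemma fderiv_fnl_of: "fderiv (fnl_of f) c z = fun_of (coord_grd f c (fields_of z))"
  unfolding fderiv_def using has_fderiv_fnl_of has_fderiv_unique by blast

lemma fderiv_psi_fnl_of:
  "fderiv_psi (fnl_of f) z x = fun_of (grd f Psi (fields_of z)) x"
  "fderiv_psis (fnl_of f) z x = fun_of (grd f Psis (fields_of z)) x"
proof -
  have "complex_of_real (sqrt 2) * complex_of_real (sqrt 2) = 2"
    by (simp flip: of_real_mult)
  thus "fderiv_psi (fnl_of f) z x = fun_of (grd f Psi (fields_of z)) x"
    "fderiv_psis (fnl_of f) z x = fun_of (grd f Psis (fields_of z)) x"
    unfolding fderiv_psi_def fderiv_psis_def fderiv_fnl_of by (simp_all add: field_simps)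
qed

text \<open>The bridge from the analytic bracket, defined by limits and integrals, to the algebraic
  \<open>br\<close>; the algebraic bracket laws below are transported along it.\<close>

lemma bracket_fnl_of: "bracket (fnl_of f) (fnl_of g) z = br f g (fields_of z)"
  unfolding bracket_def fderiv_psi_fnl_of fderiv_fnl_of br_def intg_eq by (simp only: fun_of_ext coord_grd.simps)

lemma fnl_of_br:
  assumes "\<forall>w. val h w = br f g w"
  shows "bracket (fnl_of f) (fnl_of g) = fnl_of h"
  by (rule ext) (simp add: bracket_fnl_of fnl_of_def assms)

lemma is_functional_bracket:
  assumes "is_functional F" "is_functional G"
  shows "is_functional (bracket F G)"
proof -
  obtain f g where [simp]: "F = fnl_of f" "G = fnl_of g" using assms by (elim functionalE) (rule that)
  obtain h where "\<forall>w. val h w = br f g w" using ex_br by blast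
  thus ?thesis by (simp add: fnl_of_br is_functional_fnl_of)
qed

lemma is_functional_add: "is_functional F \<Longrightarrow> is_functional G \<Longrightarrow> is_functional (F + G)"
  unfolding plus_fun_def by (rule is_functional.intros)

lemma is_functional_scale: "is_functional F \<Longrightarrow> is_functional (\<lambda>z. c * F z)"
  by (rule is_functional.intros)

lemma is_functional_zero: "is_functional 0"
  using is_functional_scale[OF is_functional_fnl_of, of 0] by (simp add: zero_fun_def)

lemma is_functional_diff:
  assumes "is_functional F" "is_functional G"
  shows "is_functional (F - G)"
proof -
  have "F - G = F + (\<lambda>z. (- 1) * G z)" by (simp add: fun_eq_iff)
  thus ?thesis using is_functional_add[OF assms(1) is_functional_scale[OF assms(2)]] by (simp only:)
qed

lemma is_functional_sum:
  "(\<And>i. i \<in> A \<Longrightarrow> is_functional (f i)) \<Longrightarrow> is_functional (\<Sum>i\<in>A. f i)"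
  by (induction A rule: infinite_finite_induct) (auto intro: is_functional_zero is_functional_add)

lemma bracket_add_left:
  assumes "is_functional F" "is_functional G" "is_functional K"
  shows "bracket (F + G) K = bracket F K + bracket G K"
proof -
  obtain f g k where [simp]: "F = fnl_of f" "G = fnl_of g" "K = fnl_of k" using assms by (elim functionalE) (rule that)
  have FG: "F + G = fnl_of (FPlus f g)" by (simp add: fun_eq_iff fnl_of_def)
  show ?thesis unfolding FG by (simp add: fun_eq_iff bracket_fnl_of br_dval)
qed

lemma bracket_scale_left:
  assumes "is_functional F" "is_functional K"
  shows "bracket (\<lambda>z. c * F z) K = (\<lambda>z. c * bracket F K z)"
proof -
  obtain f k where [simp]: "F = fnl_of f" "K = fnl_of k" using assms by (elim functionalE) (rule that)
  have cF: "(\<lambda>z. c * F z) = fnl_of (FScale c f)" by (simp add: fun_eq_iff fnl_of_def)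
  show ?thesis unfolding cF by (simp add: fun_eq_iff bracket_fnl_of br_dval)
qed

lemma bracket_antisym:
  assumes "is_functional F" "is_functional G"
  shows "bracket F G = - bracket G F"
proof -
  obtain f g where [simp]: "F = fnl_of f" "G = fnl_of g" using assms by (elim functionalE) (rule that)
  show ?thesis by (rule ext) (simp add: bracket_fnl_of br_dval[of g] br_dval'[of f])
qed

lemma bracket_add_right:
  assumes "is_functional F" "is_functional G" "is_functional K"
  shows "bracket K (F + G) = bracket K F + bracket K G"
  using assms by (simp add: bracket_antisym[of K F] bracket_antisym[of K G] bracket_antisym[of K "F + G"] is_functional_add bracket_add_left)

lemma bracket_scale_right:
  assumes "is_functional F" "is_functional K"
  shows "bracket K (\<lambda>z. c * F z) = (\<lambda>z. c * bracket K F z)"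
  using assms by (simp add: bracket_antisym[of K F] bracket_antisym[of K "\<lambda>z. c * F z"] is_functional_scale bracket_scale_left fun_eq_iff)

lemma bracket_zero_left: "is_functional K \<Longrightarrow> bracket 0 K = 0"
  using bracket_scale_left[OF is_functional_zero, of K 0] by (simp add: zero_fun_def)

lemma bracket_zero_right: "is_functional K \<Longrightarrow> bracket K 0 = 0"
  using bracket_scale_right[OF is_functional_zero, of K 0] by (simp add: zero_fun_def)

text \<open>The Jacobi identity is arranged as the derivation property of bracketing with
  \<open>K\<close> on the right, the form used by \<open>lie_bracket\<close>.\<close>

lemma bracket_jacobi:
  assumes "is_functional F" "is_functional G" "is_functional K"
  shows "bracket (bracket F G) K = bracket (bracket F K) G + bracket F (bracket G K)"
proof -
  obtain f g k where [simp]: "F = fnl_of f" "G = fnl_of g" "K = fnl_of k" using assms by (elim functionalE) (rule that)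
  obtain fg where fg: "\<forall>w. val fg w = br f g w" using ex_br by blast
  obtain fk where fk: "\<forall>w. val fk w = br f k w" using ex_br by blast
  obtain gk where gk: "\<forall>w. val gk w = br g k w" using ex_br by blast
  show ?thesis
    using br_jacobi[OF fg fk gk]
    by (simp add: fun_eq_iff fnl_of_br[OF fg] fnl_of_br[OF fk] fnl_of_br[OF gk] bracket_fnl_of)
qed

section \<open>Lie series are canonical\<close>

lemma fnl_sum_apply: "(\<Sum>i\<in>A. f i :: 'b \<Rightarrow> complex) z = (\<Sum>i\<in>A. f i z)"
  by (induction A rule: infinite_finite_induct) simp_all

lemma bracket_sum_left:
  assumes "is_functional G"
  shows "(\<And>i. i \<in> A \<Longrightarrow> is_functional (f i)) \<Longrightarrow> bracket (\<Sum>i\<in>A. f i) G = (\<Sum>i\<in>A. bracket (f i) G)"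
  using assms
  by (induction A rule: infinite_finite_induct)
     (simp_all add: bracket_zero_left bracket_add_left is_functional_sum)

lemma bracket_sum_right:
  assumes "is_functional G"
  shows "(\<And>i. i \<in> A \<Longrightarrow> is_functional (f i)) \<Longrightarrow> bracket G (\<Sum>i\<in>A. f i) = (\<Sum>i\<in>A. bracket G (f i))"
  using assms
  by (induction A rule: infinite_finite_induct)
     (simp_all add: bracket_zero_right bracket_add_right is_functional_sum)

lemma is_functional_lie: "is_functional K \<Longrightarrow> is_functional F \<Longrightarrow> is_functional (lie K F)"
  unfolding lie_def by (rule is_functional_bracket)

lemma lie_zero: "is_functional K \<Longrightarrow> lie K 0 = 0"
  unfolding lie_def by (rule bracket_zero_left)

lemma lie_scale: "is_functional K \<Longrightarrow> is_functional F \<Longrightarrow> lie K (\<lambda>z. c * F z) = (\<lambda>z. c * lie K F z)"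
  unfolding lie_def by (rule bracket_scale_left)

lemma lie_add: "is_functional K \<Longrightarrow> is_functional F \<Longrightarrow> is_functional G \<Longrightarrow> lie K (F + G) = lie K F + lie K G"
  unfolding lie_def by (rule bracket_add_left)

text \<open>Divided powers turn the iterated Leibniz rule into a convolution without binomial
  coefficients.\<close>

definition lie_div_power :: "fnl \<Rightarrow> nat \<Rightarrow> fnl \<Rightarrow> fnl" where
  "lie_div_power K j F z = (lie K ^^ j) F z / fact j"

lemma is_functional_lie_power: "is_functional K \<Longrightarrow> is_functional F \<Longrightarrow> is_functional ((lie K ^^ j) F)"
  by (induction j) (auto intro: is_functional_lie)

lemma is_functional_lie_div_power:
  assumes "is_functional K" "is_functional F"
  shows "is_functional (lie_div_power K j F)"
proof -
  have "lie_div_power K j F = (\<lambda>z. (1 / fact j) * (lie K ^^ j) F z)"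
    by (simp add: lie_div_power_def fun_eq_iff)
  thus ?thesis using is_functional_scale[OF is_functional_lie_power[OF assms]] by (simp only:)
qed

lemma lie_div_power_0 [simp]: "lie_div_power K 0 F = F"
  by (simp add: lie_div_power_def fun_eq_iff)

lemma lie_div_power_1: "lie_div_power K 1 F = lie K F"
  by (simp add: lie_div_power_def fun_eq_iff)

lemma lie_lie_div_power:
  assumes "is_functional K" "is_functional F"
  shows "lie K (lie_div_power K j F) z = of_nat (Suc j) * lie_div_power K (Suc j) F z"
proof -
  have "lie_div_power K j F = (\<lambda>z. (1 / fact j) * (lie K ^^ j) F z)"
    by (simp add: lie_div_power_def fun_eq_iff)
  hence "lie K (lie_div_power K j F) z = (1 / fact j) * lie K ((lie K ^^ j) F) z"
    by (simp only: lie_scale[OF assms(1) is_functional_lie_power[OF assms]])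
  also have "\<dots> = of_nat (Suc j) * lie_div_power K (Suc j) F z"
    using of_nat_neq_0[of j, where 'a = complex] unfolding lie_div_power_def fact_Suc by (simp del: of_nat_Suc)
  finally show ?thesis .
qed

lemma lie_bracket:
  assumes "is_functional K" "is_functional F" "is_functional G"
  shows "lie K (bracket F G) = bracket (lie K F) G + bracket F (lie K G)"
  unfolding lie_def by (rule bracket_jacobi[OF assms(2,3,1)])

lemma lie_div_power_bracket:
  assumes K: "is_functional K" and F: "is_functional F" and G: "is_functional G"
  shows "lie_div_power K n (bracket F G) = (\<Sum>i\<le>n. bracket (lie_div_power K i F) (lie_div_power K (n - i) G))"
proof (induction n)
  case (Suc n)
  note fn = is_functional_lie_div_power[OF K F] is_functional_lie_div_power[OF K G]
  define b where "b i j z = bracket (lie_div_power K i F) (lie_div_power K j G) z" for i j z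
  have l: "bracket (lie K (lie_div_power K i F)) (lie_div_power K j G) z = of_nat (Suc i) * b (Suc i) j z" for i j z
  proof -
    have "lie K (lie_div_power K i F) = (\<lambda>z. of_nat (Suc i) * lie_div_power K (Suc i) F z)"
      by (rule ext) (rule lie_lie_div_power[OF K F])
    thus ?thesis by (simp only: bracket_scale_left[OF fn] b_def)
  qed
  have r: "bracket (lie_div_power K i F) (lie K (lie_div_power K j G)) z = of_nat (Suc j) * b i (Suc j) z" for i j z
  proof -
    have "lie K (lie_div_power K j G) = (\<lambda>z. of_nat (Suc j) * lie_div_power K (Suc j) G z)"
      by (rule ext) (rule lie_lie_div_power[OF K G])
    thus ?thesis by (simp only: bracket_scale_right[OF fn(2,1)] b_def)
  qed
  show ?case
  proof (rule ext)
    fix z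
    have "of_nat (Suc n) * lie_div_power K (Suc n) (bracket F G) z = lie K (lie_div_power K n (bracket F G)) z"
      by (rule lie_lie_div_power[OF K is_functional_bracket[OF F G], symmetric])
    also have "\<dots> = (\<Sum>i\<le>n. lie K (bracket (lie_div_power K i F) (lie_div_power K (n - i) G))) z"
      unfolding Suc.IH lie_def using fn is_functional_bracket by (subst bracket_sum_left[OF K]) auto
    also have "\<dots> = (\<Sum>i\<le>n. of_nat (Suc i) * b (Suc i) (n - i) z + of_nat (Suc (n - i)) * b i (Suc (n - i)) z)"
      by (simp add: fnl_sum_apply lie_bracket[OF K fn] l r del: of_nat_Suc)
    also have "\<dots> = (\<Sum>i\<le>n. of_nat (Suc i) * b (Suc i) (Suc n - Suc i) z) + (\<Sum>i\<le>n. of_nat (Suc n - i) * b i (Suc n - i) z)"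
      by (simp add: sum.distrib Suc_diff_le del: of_nat_Suc)
    \<comment> \<open>Both sums are extended to \<open>i \<le> Suc n\<close> by a term with
      coefficient 0, at \<open>i = 0\<close> here and at \<open>i = Suc n\<close> in the next step;
      the weights then add up to \<open>Suc n\<close>.\<close>
    also have "(\<Sum>i\<le>n. of_nat (Suc i) * b (Suc i) (Suc n - Suc i) z) = (\<Sum>i\<le>Suc n. of_nat i * b i (Suc n - i) z)"
      by (subst sum.atMost_Suc_shift) simp
    also have "(\<Sum>i\<le>n. of_nat (Suc n - i) * b i (Suc n - i) z) = (\<Sum>i\<le>Suc n. of_nat (Suc n - i) * b i (Suc n - i) z)"
      by simp
    also have "(\<Sum>i\<le>Suc n. of_nat i * b i (Suc n - i) z) + (\<Sum>i\<le>Suc n. of_nat (Suc n - i) * b i (Suc n - i) z)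
        = (\<Sum>i\<le>Suc n. of_nat (Suc n) * b i (Suc n - i) z)"
      unfolding sum.distrib[symmetric]
      by (intro sum.cong refl) (simp add: distrib_right[symmetric] of_nat_add[symmetric] del: of_nat_add of_nat_Suc)
    finally have "of_nat (Suc n) * lie_div_power K (Suc n) (bracket F G) z = of_nat (Suc n) * (\<Sum>i\<le>Suc n. b i (Suc n - i) z)"
      unfolding sum_distrib_left .
    thus "lie_div_power K (Suc n) (bracket F G) z =
        (\<Sum>i\<le>Suc n. bracket (lie_div_power K i F) (lie_div_power K (Suc n - i) G)) z"
      using of_nat_neq_0[of n, where 'a = complex] unfolding fnl_sum_apply b_def by (simp del: of_nat_Suc sum.atMost_Suc)
  qed
qed simp

lemma lie_exp_nth: "fps_nth (lie_exp m K A) n = (\<Sum>j | m * j \<le> n. lie_div_power K j (fps_nth A (n - m * j)))"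
  by (rule ext) (simp add: lie_exp_def lie_div_power_def fnl_sum_apply)

lemma is_functional_lie_exp:
  assumes "is_functional K" "\<And>n. is_functional (fps_nth A n)"
  shows "is_functional (fps_nth (lie_exp m K A) n)"
  unfolding lie_exp_nth by (intro is_functional_sum is_functional_lie_div_power assms)

lemma lie_div_power_sum:
  assumes "is_functional K" "\<And>i. i \<in> A \<Longrightarrow> is_functional (f i)"
  shows "lie_div_power K j (\<Sum>i\<in>A. f i) = (\<Sum>i\<in>A. lie_div_power K j (f i))"
proof -
  have "(lie K ^^ j) (\<Sum>i\<in>A. f i) = (\<Sum>i\<in>A. (lie K ^^ j) (f i))"
  proof (induction j)
    case (Suc j)
    thus ?case using assms
      by (simp add: lie_def bracket_sum_left is_functional_lie_power[unfolded lie_def])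
  qed simp
  thus ?thesis by (simp add: lie_div_power_def fun_eq_iff fnl_sum_apply sum_divide_distrib)
qed

lemma lie_exp_bracket:
  assumes m: "m \<ge> 1" and K: "is_functional K"
    and A: "\<And>n. is_functional (fps_nth A n)" and B: "\<And>n. is_functional (fps_nth B n)"
  shows "lie_exp m K (bracket_fps A B) = bracket_fps (lie_exp m K A) (lie_exp m K B)"
proof (rule fps_ext)
  fix n
  note [intro] = is_functional_bracket is_functional_lie_div_power[OF K] A B is_functional_sum
  \<comment> \<open>This is where \<open>m \<ge> 1\<close> enters: the index sets of the Lie series
    are finite.\<close>
  have "j \<le> k" if "m * j \<le> k" for j k using m that by (metis mult_le_mono1 nat_mult_1 order.trans)
  hence fin [simp]: "finite {j. m * j \<le> k}" for k
    by (rule_tac finite_subset[of _ "{..k}"]) auto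
  have aux: "p + i * m \<le> n" if "j * m \<le> n" "p \<le> n - j * m" "i \<le> j" for i j p
    using mult_le_mono1[OF that(3), of m] that(1,2) by linarith
  define b where "b i p i' p' = bracket (lie_div_power K i (fps_nth A p)) (lie_div_power K i' (fps_nth B p'))" for i p i' p'
  have "fps_nth (lie_exp m K (bracket_fps A B)) n =
      (\<Sum>j | m * j \<le> n. \<Sum>p\<le>n - m * j. \<Sum>i\<le>j. b i p (j - i) (n - m * j - p))"
    unfolding lie_exp_nth bracket_fps_def fps_nth_Abs_fps b_def
    by (subst lie_div_power_sum[OF K]) (auto simp: lie_div_power_bracket[OF K A B])
  also have "\<dots> = (\<Sum>(j, p, i)\<in>(SIGMA j:{j. m * j \<le> n}. {..n - m * j} \<times> {..j}). b i p (j - i) (n - m * j - p))"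
    by (simp add: sum.cartesian_product sum.Sigma)
  \<comment> \<open>The new index \<open>q = p + m * i\<close> is the order in \<epsilon>
    contributed by the first factor, and \<open>i' = j - i\<close> counts the brackets applied to
    the second.\<close>
  also have "\<dots> = (\<Sum>(q, i, i')\<in>(SIGMA q:{..n}. {i. m * i \<le> q} \<times> {i. m * i \<le> n - q}). b i (q - m * i) i' (n - q - m * i'))"
    by (rule sum.reindex_bij_witness[of _ "\<lambda>(q, i, i'). (i + i', q - m * i, i)" "\<lambda>(j, p, i). (p + m * i, i, j - i)"])
       (auto simp: algebra_simps diff_mult_distrib2 intro: aux)
  also have "\<dots> = (\<Sum>q\<le>n. \<Sum>i | m * i \<le> q. \<Sum>i' | m * i' \<le> n - q. b i (q - m * i) i' (n - q - m * i'))"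
    by (simp add: sum.cartesian_product sum.Sigma)
  also have "\<dots> = fps_nth (bracket_fps (lie_exp m K A) (lie_exp m K B)) n"
  proof -
    have "bracket (\<Sum>i | m * i \<le> q. lie_div_power K i (fps_nth A (q - m * i)))
        (\<Sum>i | m * i \<le> n - q. lie_div_power K i (fps_nth B (n - q - m * i))) =
      (\<Sum>i | m * i \<le> q. \<Sum>i' | m * i' \<le> n - q. b i (q - m * i) i' (n - q - m * i'))" for q
      unfolding b_def by (subst bracket_sum_left; (subst bracket_sum_right)?) auto
    thus ?thesis unfolding bracket_fps_def fps_nth_Abs_fps lie_exp_nth by simp
  qed
  finally show "fps_nth (lie_exp m K (bracket_fps A B)) n = fps_nth (bracket_fps (lie_exp m K A) (lie_exp m K B)) n" .
qed

lemma bracket_fps_const: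
  assumes "is_functional F" "is_functional G"
  shows "bracket_fps (fps_const F) (fps_const G) = fps_const (bracket F G)"
proof (rule fps_ext)
  fix n
  show "fps_nth (bracket_fps (fps_const F) (fps_const G)) n = fps_nth (fps_const (bracket F G)) n"
  proof (cases n)
    case (Suc k)
    have "bracket (fps_nth (fps_const F) i) (fps_nth (fps_const G) (n - i)) = 0" if "i \<le> n" for i
      using assms Suc that by (cases i) (auto simp: bracket_zero_left bracket_zero_right is_functional_zero)
    thus ?thesis using Suc by (simp add: bracket_fps_def)
  qed (simp add: bracket_fps_def)
qed

lemma is_functional_fps_const: "is_functional F \<Longrightarrow> is_functional (fps_nth (fps_const F) n)"
  by (cases n) (simp_all add: is_functional_zero)

lemma canonical_lie_exp:
  assumes "m \<ge> 1" "m' \<ge> 1" "is_functional K" "is_functional K'"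
  shows "canonical (\<lambda>A. lie_exp m K (lie_exp m' K' A))"
  unfolding canonical_def
proof (intro allI impI)
  fix F G assume F: "is_functional F" and G: "is_functional G"
  note fn = is_functional_fps_const[OF F] is_functional_fps_const[OF G]
  have "lie_exp m' K' (fps_const (bracket F G))
      = bracket_fps (lie_exp m' K' (fps_const F)) (lie_exp m' K' (fps_const G))"
    unfolding bracket_fps_const[OF F G, symmetric] by (rule lie_exp_bracket[OF assms(2,4) fn])
  thus "lie_exp m K (lie_exp m' K' (fps_const (bracket F G)))
      = bracket_fps (lie_exp m K (lie_exp m' K' (fps_const F))) (lie_exp m K (lie_exp m' K' (fps_const G)))"
    using lie_exp_bracket[OF assms(1,3) is_functional_lie_exp[OF assms(4) fn(1)] is_functional_lie_exp[OF assms(4) fn(2)]]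
    by simp
qed

section \<open>Charge decomposition with respect to the flow of h\<close>

definition term_h :: fterm where "term_h = IntProd (Var Psi) (Var Psis)"
definition term_k :: fterm where "term_k = FScale (1/2) (IntProd (Var PPhi) (Var PPhi))"

lemma cnj_psi: "cnj (psi z x) = psis z x" "cnj (psis z x) = psi z x"
  by (simp_all add: psi_def psis_def)

lemma ham_h_eq: "ham_h = fnl_of term_h"
  by (simp add: fun_eq_iff ham_h_def fnl_of_def term_h_def abs2_def cnj_psi intg_eq fun_of_ext fun_of_fields
      del: fields_of.simps)

lemma ham_k_eq: "ham_k = fnl_of term_k"
  by (simp add: fun_eq_iff ham_k_def fnl_of_def term_k_def intg_eq fun_of_ext fun_of_fields power2_eq_square
      del: fields_of.simps)

lemma is_functional_h: "is_functional ham_h" and is_functional_k: "is_functional ham_k"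
  by (simp_all add: ham_h_eq ham_k_eq is_functional_fnl_of)

lemma ham_field_h:
  "ham_field term_h w Psi = scaleC (- \<i>) (w Psi)" "ham_field term_h w Psis = scaleC \<i> (w Psis)"
  "ham_field term_h w Phi = 0" "ham_field term_h w PPhi = 0"
  by (simp_all add: term_h_def)

lemma ham_field_k:
  "ham_field term_k w Psi = 0" "ham_field term_k w Psis = 0"
  "ham_field term_k w Phi = w PPhi" "ham_field term_k w PPhi = 0"
proof -
  show "ham_field term_k w Phi = w PPhi"
    by (simp add: term_k_def scaleC_distrib[symmetric] flip: scaleC_distrib(3))
       (simp add: scaleC_distrib flip: scaleC_distrib(3))
qed (simp_all add: term_k_def)

lemma bracket_h_k: "bracket ham_h ham_k = 0"
  by (rule ext)
     (simp add: ham_h_eq ham_k_eq bracket_fnl_of br_dval ham_field_k term_h_def del: ham_field.simps)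

primrec rot :: "real \<Rightarrow> fields \<Rightarrow> fields" where
  "rot s w Psi = scaleC (exp (- \<i> * of_real s)) (w Psi)"
| "rot s w Psis = scaleC (exp (\<i> * of_real s)) (w Psis)"
| "rot s w Phi = w Phi"
| "rot s w PPhi = w PPhi"

lemma fields_of_flow_h: "fields_of (flow_h s z) = rot s (fields_of z)"
proof (rule ext)
  fix a
  show "fields_of (flow_h s z) a = rot s (fields_of z) a"
    by (cases a; intro cfield_eqI)
       (simp_all add: fun_of_fields flow_h_fields del: fields_of.simps)
qed

text \<open>Covariance under the rotation and the infinitesimal eigenvalue equation are carried
  together: both pass through products and derivatives, the first evaluates the integrals over the
  period, and the second gives L_h. \<psi> has charge -1 and its conjugate charge 1.\<close>

definition dcharged :: "int \<Rightarrow> dterm \<Rightarrow> bool" where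
  "dcharged m P \<longleftrightarrow> (\<forall>s w. ev P (rot s w) = scaleC (exp (\<i> * of_int m * of_real s)) (ev P w)) \<and>
     (\<forall>w. lin P w (ham_field term_h w) = scaleC (\<i> * of_int m) (ev P w))"

inductive dcharge_sum :: "(fields \<Rightarrow> cfield) \<Rightarrow> bool" where
  base: "dcharged m P \<Longrightarrow> dcharge_sum (ev P)"
| add: "dcharge_sum d \<Longrightarrow> dcharge_sum e \<Longrightarrow> dcharge_sum (\<lambda>w. d w + e w)"

lemma exp_add_charge:
  "exp (\<i> * of_int m * of_real s) * exp (\<i> * of_int n * of_real s) = exp (\<i> * of_int (m + n) * of_real s)"
  by (simp add: exp_add[symmetric] algebra_simps)

lemma dcharged_Times: "dcharged m P \<Longrightarrow> dcharged n Q \<Longrightarrow> dcharged (m + n) (Times P Q)"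
  unfolding dcharged_def
  by (auto simp: exp_add_charge add.commute simp del: of_int_add)
     (simp add: scaleC_distrib(3) distrib_left add.commute)

lemma dcharged_Scale: "dcharged m P \<Longrightarrow> dcharged m (Scale c P)"
  unfolding dcharged_def by (auto simp: mult.commute)

lemma dcharged_Deriv: "dcharged m P \<Longrightarrow> dcharged m (Deriv i P)"
  unfolding dcharged_def by auto

lemma dcharged_Var: "dcharged (case a of Psi \<Rightarrow> -1 | Psis \<Rightarrow> 1 | _ \<Rightarrow> 0) (Var a)"
  unfolding dcharged_def by (cases a) (auto simp: ham_field_h simp del: ham_field.simps)

text \<open>Products of sums are expanded into homogeneous terms, whose charges add;
  \<open>Scale\<close> and \<open>Deriv\<close> preserve the charge.\<close>

lemma dcharge_sum_ev: "dcharge_sum (ev P)"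
proof (induction P)
  case (Var a)
  show ?case by (rule dcharge_sum.base[OF dcharged_Var])
next
  case (Plus P Q)
  have "ev (Plus P Q) = (\<lambda>w. ev P w + ev Q w)" by (rule ext) simp
  thus ?case using dcharge_sum.add[OF Plus] by simp
next
  case (Times P Q)
  have "dcharge_sum (\<lambda>w. d w * e w)" if "dcharge_sum d" "dcharge_sum e" for d e
    using that(1)
  proof induction
    case (base m P)
    show ?case using that(2)
    proof induction
      case (base n Q)
      have "ev (Times P Q) = (\<lambda>w. ev P w * ev Q w)" by (rule ext) simp
      thus ?case using dcharge_sum.base[OF dcharged_Times[OF \<open>dcharged m P\<close> base]] by simp
    next
      case (add d e)
      thus ?case using dcharge_sum.add[OF add.IH] by (simp add: distrib_left)
    qed
  next
    case (add d e)
    thus ?case using dcharge_sum.add[OF add.IH] by (simp add: distrib_right)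
  qed
  moreover have "ev (Times P Q) = (\<lambda>w. ev P w * ev Q w)" by (rule ext) simp
  ultimately show ?case using Times by simp
next
  case (Scale c P)
  have "dcharge_sum (\<lambda>w. scaleC c (d w))" if "dcharge_sum d" for d
    using that
  proof induction
    case (base m P)
    have "ev (Scale c P) = (\<lambda>w. scaleC c (ev P w))" by (rule ext) simp
    thus ?case using dcharge_sum.base[OF dcharged_Scale[OF base]] by metis
  next
    case (add d e)
    thus ?case using dcharge_sum.add[OF add.IH] by (simp add: scaleC_distrib)
  qed
  moreover have "ev (Scale c P) = (\<lambda>w. scaleC c (ev P w))" by (rule ext) simp
  ultimately show ?case using Scale by simp
next
  case (Deriv i P)
  have "dcharge_sum (\<lambda>w. D i (d w))" if "dcharge_sum d" for d
    using that
  proof induction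
    case (base m P)
    have "ev (Deriv i P) = (\<lambda>w. D i (ev P w))" by (rule ext) simp
    thus ?case using dcharge_sum.base[OF dcharged_Deriv[OF base]] by metis
  next
    case (add d e)
    thus ?case using dcharge_sum.add[OF add.IH] by simp
  qed
  moreover have "ev (Deriv i P) = (\<lambda>w. D i (ev P w))" by (rule ext) simp
  ultimately show ?case using Deriv by simp
qed

definition charged :: "int \<Rightarrow> fnl \<Rightarrow> bool" where
  "charged m F \<longleftrightarrow> is_functional F \<and>
     (\<forall>s z. F (flow_h s z) = exp (\<i> * of_int m * of_real s) * F z) \<and>
     lie ham_h F = (\<lambda>z. \<i> * of_int m * F z)"

inductive charge_sum :: "fnl \<Rightarrow> bool" where
  base: "charged m F \<Longrightarrow> charge_sum F"
| add: "charge_sum F \<Longrightarrow> charge_sum G \<Longrightarrow> charge_sum (F + G)"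

lemma lie_h_fnl_of: "lie ham_h (fnl_of f) z = dval f (fields_of z) (ham_field term_h (fields_of z))"
  unfolding lie_def ham_h_eq by (simp add: bracket_fnl_of br_dval)

lemma charged_IntProd:
  assumes "dcharged m P" "dcharged n Q"
  shows "charged (m + n) (fnl_of (IntProd P Q))"
  unfolding charged_def
proof (intro conjI allI ext)
  show "is_functional (fnl_of (IntProd P Q))" by (rule is_functional_fnl_of)
  show "fnl_of (IntProd P Q) (flow_h s z) = exp (\<i> * of_int (m + n) * of_real s) * fnl_of (IntProd P Q) z" for s z
    using assms unfolding dcharged_def
    by (auto simp: fnl_of_def fields_of_flow_h exp_add_charge add.commute simp del: of_int_add)
  show "lie ham_h (fnl_of (IntProd P Q)) z = \<i> * of_int (m + n) * fnl_of (IntProd P Q) z" for z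
    using assms unfolding dcharged_def
    by (simp add: lie_h_fnl_of fnl_of_def algebra_simps)
qed

lemma charged_scale: "charged m F \<Longrightarrow> charged m (\<lambda>z. c * F z)"
  unfolding charged_def
  by (auto simp: lie_scale[OF is_functional_h] fun_eq_iff intro: is_functional_scale)

lemma charged_add: "charged m F \<Longrightarrow> charged m G \<Longrightarrow> charged m (F + G)"
  unfolding charged_def
  by (auto simp: lie_add[OF is_functional_h] fun_eq_iff algebra_simps intro: is_functional_add)

lemma charged_mult:
  assumes F: "charged m F" and G: "charged n G"
  shows "charged (m + n) (F * G)"
proof -
  obtain f g where fg: "F = fnl_of f" "G = fnl_of g"
    using F G unfolding charged_def by (auto elim!: functionalE)
  have FG: "F * G = fnl_of (FTimes f g)" by (simp add: fg fnl_of_def fun_eq_iff)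
  have "lie ham_h (F * G) z = F z * lie ham_h G z + lie ham_h F z * G z" for z
    unfolding FG by (simp add: lie_h_fnl_of fg fnl_of_def)
  moreover have "is_functional (F * G)" unfolding FG by (rule is_functional_fnl_of)
  ultimately show ?thesis
    using F G unfolding charged_def exp_add_charge[symmetric] by (auto simp: fun_eq_iff distrib_left distrib_right mult_ac)
qed

lemma charge_sum_scale: "charge_sum F \<Longrightarrow> charge_sum (\<lambda>z. c * F z)"
proof (induction rule: charge_sum.induct)
  case (add F G)
  thus ?case using charge_sum.add[OF add.IH] by (simp add: plus_fun_def distrib_left)
qed (blast intro: charge_sum.base charged_scale)

lemma charge_sum_mult:
  assumes "charge_sum F" "charge_sum G"
  shows "charge_sum (F * G)"
  using assms(1)
proof induction
  case (base m F)
  show ?case using assms(2)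
  proof induction
    case (base n G)
    show ?case by (rule charge_sum.base[OF charged_mult[OF \<open>charged m F\<close> base]])
  next
    case (add G G')
    show ?case unfolding distrib_left by (rule charge_sum.add[OF add.IH])
  qed
next
  case (add F F')
  show ?case unfolding distrib_right by (rule charge_sum.add[OF add.IH])
qed

lemma charge_sum_intg:
  assumes "dcharge_sum d" "dcharge_sum e"
  shows "charge_sum (\<lambda>z. intg (d (fields_of z) * e (fields_of z)))"
  using assms(1)
proof induction
  case (base m P)
  show ?case using assms(2)
  proof induction
    case (base n Q)
    have "(\<lambda>z. intg (ev P (fields_of z) * ev Q (fields_of z))) = fnl_of (IntProd P Q)"
      by (simp add: fnl_of_def fun_eq_iff)
    thus ?case using charge_sum.base[OF charged_IntProd[OF \<open>dcharged m P\<close> base]] by simp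
  next
    case (add d e)
    thus ?case using charge_sum.add[OF add.IH] by (simp add: plus_fun_def distrib_left)
  qed
next
  case (add d e)
  thus ?case using charge_sum.add[OF add.IH] by (simp add: plus_fun_def distrib_right)
qed

text \<open>A finite Fourier decomposition under the circle action generated by
  \<open>ham_h\<close>; finiteness comes from polynomiality.\<close>

lemma charge_sum_functional:
  assumes "is_functional F"
  shows "charge_sum F"
proof -
  have "charge_sum (fnl_of f)" for f
  proof (induction f)
    case (IntProd P Q)
    have "fnl_of (IntProd P Q) = (\<lambda>z. intg (ev P (fields_of z) * ev Q (fields_of z)))"
      by (simp add: fnl_of_def fun_eq_iff)
    thus ?case using charge_sum_intg[OF dcharge_sum_ev dcharge_sum_ev, of P Q] by simp
  next
    case (FPlus f g)
    have "fnl_of (FPlus f g) = fnl_of f + fnl_of g" by (simp add: fnl_of_def fun_eq_iff)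
    thus ?case using charge_sum.add[OF FPlus] by (simp only:)
  next
    case (FTimes f g)
    have "fnl_of (FTimes f g) = fnl_of f * fnl_of g" by (simp add: fnl_of_def fun_eq_iff)
    thus ?case using charge_sum_mult[OF FTimes] by (simp only:)
  next
    case (FScale c f)
    have "fnl_of (FScale c f) = (\<lambda>z. c * fnl_of f z)" by (simp add: fnl_of_def fun_eq_iff)
    thus ?case using charge_sum_scale[OF FScale] by simp
  qed
  thus ?thesis using assms by (auto elim: functionalE)
qed

text \<open>Sums of functionals of nonzero charge: the space on which \<open>L\<^sub>h\<close> is invertible.\<close>

inductive zero_mean :: "fnl \<Rightarrow> bool" where
  base: "charged m F \<Longrightarrow> m \<noteq> 0 \<Longrightarrow> zero_mean F"
| add: "zero_mean F \<Longrightarrow> zero_mean G \<Longrightarrow> zero_mean (F + G)"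

lemma charged_zero: "charged m 0"
  unfolding charged_def by (simp add: is_functional_zero lie_zero is_functional_h fun_eq_iff)

lemma zero_mean_zero: "zero_mean 0"
  by (rule zero_mean.base[OF charged_zero[of 1]]) simp

lemma zero_mean_functional: "zero_mean F \<Longrightarrow> is_functional F"
proof (induction rule: zero_mean.induct)
  case (add F G)
  show ?case by (rule is_functional_add[OF add.IH])
qed (simp add: charged_def)

lemma zero_mean_scale: "zero_mean F \<Longrightarrow> zero_mean (\<lambda>z. c * F z)"
proof (induction rule: zero_mean.induct)
  case (add F G)
  thus ?case using zero_mean.add[OF add.IH] by (simp add: plus_fun_def distrib_left)
qed (blast intro: zero_mean.base charged_scale)

lemma zero_mean_sum: "(\<And>i. i \<in> A \<Longrightarrow> zero_mean (f i)) \<Longrightarrow> zero_mean (\<Sum>i\<in>A. f i)"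
  by (induction A rule: infinite_finite_induct) (auto intro: zero_mean_zero zero_mean.add)

lemma functional_split:
  assumes "is_functional F"
  obtains F0 F1 where "charged 0 F0" "zero_mean F1" "F = F0 + F1"
proof -
  have "\<exists>F0 F1. charged 0 F0 \<and> zero_mean F1 \<and> F = F0 + F1"
    using charge_sum_functional[OF assms]
  proof induction
    case (base m F)
    show ?case
    proof (cases "m = 0")
      case True
      hence "charged 0 F \<and> zero_mean 0 \<and> F = F + 0" using base zero_mean_zero by simp
      thus ?thesis by blast
    next
      case False
      hence "charged 0 0 \<and> zero_mean F \<and> F = 0 + F" using zero_mean.base[OF base] charged_zero by simp
      thus ?thesis by blast
    qed
  next
    case (add F G)
    then obtain F0 F1 G0 G1 where "charged 0 F0" "zero_mean F1" "F = F0 + F1"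
      "charged 0 G0" "zero_mean G1" "G = G0 + G1" by blast
    hence "charged 0 (F0 + G0) \<and> zero_mean (F1 + G1) \<and> F + G = (F0 + G0) + (F1 + G1)"
      by (simp add: charged_add zero_mean.add ac_simps)
    thus "\<exists>H0 H1. charged 0 H0 \<and> zero_mean H1 \<and> F + G = H0 + H1" by blast
  qed
  thus ?thesis using that by blast
qed

section \<open>Average and inverse of L_h as integrals over the period\<close>

lemma charged_continuous: "charged m F \<Longrightarrow> continuous_on S (\<lambda>s. F (flow_h s z))"
  unfolding charged_def by (auto intro!: continuous_intros)

lemma functional_flow_continuous:
  assumes "is_functional F"
  shows "continuous_on S (\<lambda>s. F (flow_h s z))"
  using charge_sum_functional[OF assms]
  by induction (auto intro: charged_continuous continuous_on_add)

text \<open>The exponential is 1 at both ends of the period, so integration by parts leaves only the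
  boundary term of \<open>s\<close>. Hence the weight \<open>s / (2 * pi)\<close> in
  \<open>Lh_inv\<close> yields division by \<open>\<i> * of_int m\<close>.\<close>

lemma integral_exp_charge:
  assumes "m \<noteq> 0"
  shows "((\<lambda>s. exp (\<i> * of_int m * of_real s)) has_integral 0) {0..2 * pi}"
    and "((\<lambda>s. of_real s * exp (\<i> * of_int m * of_real s)) has_integral of_real (2 * pi) / (\<i> * of_int m)) {0..2 * pi}"
proof -
  define c where "c = \<i> * of_int m"
  have c: "c \<noteq> 0" using assms by (simp add: c_def)
  have e: "exp (c * of_real (2 * pi)) = 1"
    unfolding c_def exp_eq_1 by (auto intro!: exI[of _ m])
  have d: "((\<lambda>s. exp (c * of_real s)) has_vector_derivative c * exp (c * of_real s)) (at s within S)" for s :: real and S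
    by (rule has_vector_derivative_real_field) (auto intro!: derivative_eq_intros)
  have "((\<lambda>s. exp (c * of_real s)) has_integral (exp (c * of_real (2 * pi)) / c - exp (c * of_real 0) / c)) {0..2 * pi}"
    using c by (intro fundamental_theorem_of_calculus) (auto intro!: derivative_eq_intros d)
  thus "((\<lambda>s. exp (\<i> * of_int m * of_real s)) has_integral 0) {0..2 * pi}"
    unfolding e by (simp add: c_def)
  have "((\<lambda>s. of_real s * exp (c * of_real s)) has_integral
     ((of_real (2 * pi) * exp (c * of_real (2 * pi)) / c - exp (c * of_real (2 * pi)) / c\<^sup>2)
      - (of_real 0 * exp (c * of_real 0) / c - exp (c * of_real 0) / c\<^sup>2))) {0..2 * pi}"
  proof (rule fundamental_theorem_of_calculus)
    fix s assume "s \<in> {0..2 * pi}"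
    have "((\<lambda>s. complex_of_real s) has_vector_derivative of_real 1) (at s within {0..2 * pi})"
      by (intro has_vector_derivative_of_real derivative_intros)
    from has_vector_derivative_diff[OF has_vector_derivative_divide[OF has_vector_derivative_mult[OF this d]]
        has_vector_derivative_divide[OF d], of c "c\<^sup>2"]
    show "((\<lambda>s. of_real s * exp (c * of_real s) / c - exp (c * of_real s) / c\<^sup>2) has_vector_derivative
       of_real s * exp (c * of_real s)) (at s within {0..2 * pi})"
      using c by (simp add: power2_eq_square add_divide_distrib)
  qed simp
  thus "((\<lambda>s. of_real s * exp (\<i> * of_int m * of_real s)) has_integral of_real (2 * pi) / (\<i> * of_int m)) {0..2 * pi}"
    unfolding e by (simp add: c_def)
qed

lemma avg_charged: "charged m F \<Longrightarrow> avg F = (if m = 0 then F else 0)"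
proof (rule ext)
  fix z assume F: "charged m F"
  hence flow: "F (flow_h s z) = exp (\<i> * of_int m * of_real s) * F z" for s by (simp add: charged_def)
  show "avg F z = (if m = 0 then F else 0) z"
  proof (cases "m = 0")
    case False
    show ?thesis unfolding avg_def flow
      using integral_unique[OF has_integral_mult_left[OF integral_exp_charge(1)[OF False]], of "F z"] False by simp
  qed (simp add: avg_def flow scaleR_conv_of_real)
qed

lemma Lh_inv_charged:
  assumes F: "charged m F" and m: "m \<noteq> 0"
  shows "Lh_inv F = (\<lambda>z. (1 / (\<i> * of_int m)) * F z)"
proof (rule ext)
  fix z
  have flow: "of_real s * F (flow_h s z) = of_real s * exp (\<i> * of_int m * of_real s) * F z" for s
    using F by (simp add: charged_def)
  show "Lh_inv F z = (1 / (\<i> * of_int m)) * F z"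
    unfolding Lh_inv_def flow
    using integral_unique[OF has_integral_mult_left[OF integral_exp_charge(2)[OF m]], of "F z"] m by simp
qed

lemma avg_add:
  assumes "is_functional F" "is_functional G"
  shows "avg (F + G) = avg F + avg G"
proof (rule ext)
  fix z
  have "(\<lambda>s. F (flow_h s z)) integrable_on {0..2*pi}" "(\<lambda>s. G (flow_h s z)) integrable_on {0..2*pi}"
    using assms by (auto intro!: integrable_continuous_real functional_flow_continuous)
  thus "avg (F + G) z = (avg F + avg G) z"
    by (simp add: avg_def Henstock_Kurzweil_Integration.integral_add add_divide_distrib)
qed

lemma Lh_inv_add:
  assumes "is_functional F" "is_functional G"
  shows "Lh_inv (F + G) = Lh_inv F + Lh_inv G"
proof (rule ext)
  fix z
  have "(\<lambda>s. of_real s * F (flow_h s z)) integrable_on {0..2*pi}" "(\<lambda>s. of_real s * G (flow_h s z)) integrable_on {0..2*pi}"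
    using assms by (auto intro!: integrable_continuous_real continuous_intros functional_flow_continuous)
  thus "Lh_inv (F + G) z = (Lh_inv F + Lh_inv G) z"
    by (simp add: Lh_inv_def Henstock_Kurzweil_Integration.integral_add add_divide_distrib distrib_left)
qed

lemma Lh_inv_scale: "Lh_inv (\<lambda>z. c * F z) = (\<lambda>z. c * Lh_inv F z)"
proof (rule ext)
  fix z
  have "integral {0..2 * pi} (\<lambda>s. of_real s * (c * F (flow_h s z))) = c * integral {0..2 * pi} (\<lambda>s. of_real s * F (flow_h s z))"
    by (subst integral_mult_right[symmetric]) (simp add: mult.left_commute)
  thus "Lh_inv (\<lambda>z. c * F z) z = c * Lh_inv F z" by (simp add: Lh_inv_def)
qed

lemma avg_zero_mean: "zero_mean F \<Longrightarrow> avg F = 0"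
proof (induction rule: zero_mean.induct)
  case (add F G)
  have "avg F = 0" "avg G = 0" by (rule add.IH)+
  thus "avg (F + G) = 0" by (simp add: avg_add add.hyps[THEN zero_mean_functional])
qed (simp add: avg_charged)

lemma charged_functional: "charged m F \<Longrightarrow> is_functional F"
  by (simp add: charged_def)

text \<open>Explicit averages are later found by exhibiting such a splitting, without evaluating an
  integral.\<close>

lemma avg_split: "charged 0 F0 \<Longrightarrow> zero_mean F1 \<Longrightarrow> avg (F0 + F1) = F0"
  by (simp add: avg_add avg_zero_mean avg_charged zero_mean_functional charged_functional)

lemma charged_avg: "is_functional F \<Longrightarrow> charged 0 (avg F)"
  by (erule functional_split) (simp add: avg_split)

lemma zero_mean_minus_avg: "is_functional F \<Longrightarrow> zero_mean (F - avg F)"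
  by (erule functional_split) (simp add: avg_split)

lemma zero_mean_Lh_inv: "zero_mean F \<Longrightarrow> zero_mean (Lh_inv F)"
proof (induction rule: zero_mean.induct)
  case (base m F)
  show ?case unfolding Lh_inv_charged[OF base] by (rule zero_mean.base[OF charged_scale[OF base(1)] base(2)])
next
  case (add F G)
  have "zero_mean (Lh_inv F + Lh_inv G)" by (rule zero_mean.add[OF add.IH])
  thus "zero_mean (Lh_inv (F + G))" using add.hyps by (simp add: Lh_inv_add zero_mean_functional)
qed

lemma lie_h_Lh_inv: "zero_mean F \<Longrightarrow> lie ham_h (Lh_inv F) = F"
proof (induction rule: zero_mean.induct)
  case (base m F)
  hence F: "is_functional F" "lie ham_h F = (\<lambda>z. \<i> * of_int m * F z)" by (auto simp: charged_def)
  show ?case unfolding Lh_inv_charged[OF base] lie_scale[OF is_functional_h F(1)] F(2)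
    using base(2) by (simp add: fun_eq_iff)
next
  case (add F G)
  show "lie ham_h (Lh_inv (F + G)) = F + G"
    using add by (simp add: Lh_inv_add lie_add[OF is_functional_h] zero_mean_functional zero_mean_Lh_inv)
qed

lemma charge_sum_is_functional: "charge_sum F \<Longrightarrow> is_functional F"
proof (induction rule: charge_sum.induct)
  case (add F G)
  show ?case by (rule is_functional_add[OF add.IH])
qed (rule charged_functional)

lemma flow_h_has_derivative:
  assumes "is_functional F"
  shows "((\<lambda>s. F (flow_h s z)) has_vector_derivative lie ham_h F (flow_h s z)) (at s)"
  using charge_sum_functional[OF assms]
proof induction
  case (base m F)
  hence flow: "F (flow_h s z) = exp ((\<i> * of_int m) * of_real s) * F z" for s
    by (simp add: charged_def)
  have lie: "lie ham_h F = (\<lambda>z. \<i> * of_int m * F z)"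
    using base by (simp add: charged_def)
  have "((\<lambda>s. exp ((\<i> * of_int m) * of_real s) * F z) has_vector_derivative
      \<i> * of_int m * (exp ((\<i> * of_int m) * of_real s) * F z)) (at s)"
    by (rule has_vector_derivative_real_field) (auto intro!: derivative_eq_intros)
  thus ?case by (simp only: flow lie)
next
  case (add F G)
  have "is_functional F" "is_functional G" using add.hyps by (auto intro: charge_sum_is_functional)
  hence "lie ham_h (F + G) = lie ham_h F + lie ham_h G" by (rule lie_add[OF is_functional_h])
  thus "((\<lambda>s. (F + G) (flow_h s z)) has_vector_derivative lie ham_h (F + G) (flow_h s z)) (at s)"
    using has_vector_derivative_add[OF add.IH] by simp
qed

text \<open>By the eigenvalue equation, F along the flow times the inverse phase has derivative
  zero. For brackets the eigenvalue equation is immediate from the Jacobi identity, and covariance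
  is obtained from it here.\<close>

lemma chargedI:
  assumes F: "is_functional F" and eig: "lie ham_h F = (\<lambda>z. \<i> * of_int m * F z)"
  shows "charged m F"
  unfolding charged_def
proof (intro conjI allI F eig)
  fix s z
  let ?c = "- (\<i> * of_int m)"
  have 0: "((\<lambda>s. exp (?c * of_real s) * F (flow_h s z)) has_vector_derivative 0) (at s)" for s
  proof -
    have "((\<lambda>s. exp (?c * of_real s)) has_vector_derivative ?c * exp (?c * of_real s)) (at s)"
      by (rule has_vector_derivative_real_field) (auto intro!: derivative_eq_intros)
    from has_vector_derivative_mult[OF this flow_h_has_derivative[OF F, of z s]]
    show ?thesis by (simp add: eig algebra_simps)
  qed
  obtain k where k: "\<And>s. exp (?c * of_real s) * F (flow_h s z) = k"
    by (rule has_vector_derivative_zero_constant[OF convex_UNIV 0]) simp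
  have "flow_h 0 z = z" by (simp add: flow_h_def fun_eq_iff)
  hence "exp (?c * of_real s) * F (flow_h s z) = F z" using k[of s] k[of 0] by simp
  hence "exp (\<i> * of_int m * of_real s) * (exp (?c * of_real s) * F (flow_h s z)) = exp (\<i> * of_int m * of_real s) * F z"
    by simp
  thus "F (flow_h s z) = exp (\<i> * of_int m * of_real s) * F z"
    by (simp add: mult.assoc[symmetric] exp_add[symmetric])
qed

lemma charged_bracket:
  assumes F: "charged m F" and G: "charged n G"
  shows "charged (m + n) (bracket F G)"
proof (rule chargedI)
  have fn: "is_functional F" "is_functional G" using F G by (auto simp: charged_def)
  show "is_functional (bracket F G)" by (rule is_functional_bracket[OF fn])
  have "lie ham_h (bracket F G) = bracket (lie ham_h F) G + bracket F (lie ham_h G)"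
    by (rule lie_bracket[OF is_functional_h fn])
  also have "\<dots> = (\<lambda>z. \<i> * of_int m * bracket F G z) + (\<lambda>z. \<i> * of_int n * bracket F G z)"
    using F G unfolding charged_def by (simp add: bracket_scale_left bracket_scale_right)
  finally show "lie ham_h (bracket F G) = (\<lambda>z. \<i> * of_int (m + n) * bracket F G z)"
    by (simp add: fun_eq_iff algebra_simps)
qed

section \<open>The flow of k\<close>

definition flow_k :: "real \<Rightarrow> phase \<Rightarrow> phase" where
  "flow_k t z = z(PHI := z PHI + t *\<^sub>R z PPHI)"

lemma flow_k_flow_h: "flow_k t (flow_h s z) = flow_h s (flow_k t z)"
  by (simp add: flow_k_def flow_h_def fun_eq_iff)

lemma flow_k_flow_k: "flow_k s (flow_k t z) = flow_k (t + s) z"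
  by (simp add: flow_k_def fun_eq_iff algebra_simps)

lemma flow_k_0: "flow_k 0 z = z"
  by (simp add: flow_k_def)

text \<open>Since \<open>p\<^sub>\<phi>\<close> is constant along the flow of \<open>ham_k\<close>,
  the flow is a straight line along the Hamiltonian field, and \<open>pcurve_val\<close>
  applies.\<close>

lemma fields_of_flow_k: "fields_of (flow_k t z) = line (fields_of z) (ham_field term_k (fields_of z)) t"
proof (rule ext)
  fix a
  show "fields_of (flow_k t z) a = line (fields_of z) (ham_field term_k (fields_of z)) t a"
    by (cases a) (simp_all add: flow_k_def line_def ham_field_k complexify_add complexify_scaleR del: ham_field.simps)
qed

lemma lie_k_has_derivative:
  assumes "is_functional F"
  shows "((\<lambda>t. F (flow_k t z)) has_vector_derivative lie ham_k F z) (at 0)"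
  using assms
  by (elim functionalE)
     (simp add: fnl_of_def[abs_def] fields_of_flow_k lie_def ham_k_eq bracket_fnl_of[unfolded fnl_of_def[abs_def]]
        br_dval pcurve_has_vector_derivative[OF pcurve_val])

text \<open>Covariance follows by differentiating along the commuting flow of \<open>ham_k\<close>,
  the eigenvalue equation from the Jacobi identity with \<open>bracket_h_k\<close>.\<close>

lemma charged_lie_k:
  assumes F: "charged m F"
  shows "charged m (lie ham_k F)"
  unfolding charged_def
proof (intro conjI allI)
  have fn: "is_functional F" and fl: "\<And>s z. F (flow_h s z) = exp (\<i> * of_int m * of_real s) * F z"
    and lh: "lie ham_h F = (\<lambda>z. \<i> * of_int m * F z)" using F by (auto simp: charged_def)
  show "is_functional (lie ham_k F)" by (rule is_functional_lie[OF is_functional_k fn])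
  show "lie ham_k F (flow_h s z) = exp (\<i> * of_int m * of_real s) * lie ham_k F z" for s z
  proof -
    have "((\<lambda>t. F (flow_k t (flow_h s z))) has_vector_derivative lie ham_k F (flow_h s z)) (at 0)"
      by (rule lie_k_has_derivative[OF fn])
    moreover have "((\<lambda>t. exp (\<i> * of_int m * of_real s) * F (flow_k t z)) has_vector_derivative
        exp (\<i> * of_int m * of_real s) * lie ham_k F z) (at 0)"
      using lie_k_has_derivative[OF fn] by (rule has_vector_derivative_mult_right)
    ultimately show ?thesis unfolding flow_k_flow_h fl by (rule vector_derivative_unique_at)
  qed
  have "lie ham_h (lie ham_k F) = bracket (bracket F ham_h) ham_k + bracket F (bracket ham_k ham_h)"
    unfolding lie_def by (rule bracket_jacobi[OF fn is_functional_k is_functional_h])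
  also have "bracket ham_k ham_h = 0"
    using bracket_antisym[OF is_functional_k is_functional_h] bracket_h_k by simp
  also have "bracket F 0 = 0" by (rule bracket_zero_right[OF fn])
  also have "bracket (bracket F ham_h) ham_k = lie ham_k (lie ham_h F)" by (simp add: lie_def)
  also have "\<dots> = (\<lambda>z. \<i> * of_int m * lie ham_k F z)"
    unfolding lh by (rule lie_scale[OF is_functional_k fn])
  finally show "lie ham_h (lie ham_k F) = (\<lambda>z. \<i> * of_int m * lie ham_k F z)" by simp
qed

lemma zero_mean_lie_k: "zero_mean F \<Longrightarrow> zero_mean (lie ham_k F)"
proof (induction rule: zero_mean.induct)
  case (base m F)
  thus ?case by (blast intro: zero_mean.base charged_lie_k)
next
  case (add F G)
  show "zero_mean (lie ham_k (F + G))"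
    using add by (simp add: lie_add[OF is_functional_k] zero_mean_functional zero_mean.add)
qed

lemma Lh_inv_lie_k: "zero_mean F \<Longrightarrow> Lh_inv (lie ham_k F) = lie ham_k (Lh_inv F)"
proof (induction rule: zero_mean.induct)
  case (base m F)
  hence "is_functional F" by (simp add: charged_def)
  thus ?case
    unfolding Lh_inv_charged[OF base] Lh_inv_charged[OF charged_lie_k[OF base(1)] base(2)]
    by (rule lie_scale[OF is_functional_k, symmetric])
next
  case (add F G)
  show "Lh_inv (lie ham_k (F + G)) = lie ham_k (Lh_inv (F + G))"
    using add
    by (simp add: lie_add[OF is_functional_k] Lh_inv_add zero_mean_functional zero_mean_Lh_inv zero_mean_lie_k)
qed

lemma pderiv_iterate_eq_0:
  fixes p :: "complex poly"
  shows "degree p \<le> n \<Longrightarrow> (pderiv ^^ Suc n) p = 0"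
proof (induction n arbitrary: p)
  case 0
  thus ?case by (simp add: pderiv_eq_0_iff)
next
  case (Suc n)
  have "(pderiv ^^ Suc n) (pderiv p) = 0" by (rule Suc.IH) (use Suc.prems in \<open>simp add: degree_pderiv\<close>)
  thus ?case by (subst funpow_Suc_right) simp
qed

text \<open>Along the flow of \<open>k\<close> a functional is polynomial in \<open>t\<close>, and \<open>L\<^sub>k\<close> acts as \<open>d/dt\<close>.\<close>

lemma lie_k_nilpotent:
  assumes "is_functional F"
  shows "\<exists>d. (lie ham_k ^^ d) F = 0"
proof -
  obtain f where f: "F = fnl_of f" using assms by (rule functionalE)
  have "(lie ham_k ^^ Suc (fdeg f)) F z = 0" for z
  proof -
    obtain p where p: "degree p \<le> fdeg f" "\<And>t. F (flow_k t z) = poly p (of_real t)"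
      using pcurve_poly[OF pcurve_val[of f "fields_of z" "ham_field term_k (fields_of z)"]]
      by (metis f fields_of_flow_k fnl_of_def)
    \<comment> \<open>The claim is made for every \<open>t\<close> because the induction step
      differentiates in \<open>t\<close>; \<open>flow_k_flow_k\<close> shifts the base
      point.\<close>
    have iter: "(lie ham_k ^^ j) F (flow_k t z) = poly ((pderiv ^^ j) p) (of_real t)" for j t
    proof (induction j arbitrary: t)
      case (Suc j)
      let ?q = "(pderiv ^^ j) p"
      have "((\<lambda>s. poly ?q (of_real (t + s))) has_vector_derivative (lie ham_k ^^ Suc j) F (flow_k t z)) (at 0)"
        using lie_k_has_derivative[OF is_functional_lie_power[OF is_functional_k assms], of j "flow_k t z"]
        by (simp add: flow_k_flow_k Suc.IH)
      moreover have "((\<lambda>s. poly ?q (of_real (t + s))) has_vector_derivative poly (pderiv ?q) (of_real t)) (at 0)"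
        using poly_has_vector_derivative[of "?q \<circ>\<^sub>p [:of_real t, 1:]" 0]
        by (simp add: poly_pcompose pderiv_pcompose pderiv_pCons)
      ultimately have "(lie ham_k ^^ Suc j) F (flow_k t z) = poly (pderiv ?q) (of_real t)"
        by (rule vector_derivative_unique_at)
      thus ?case by simp
    qed (simp add: p)
    show ?thesis using iter[of "Suc (fdeg f)" 0] pderiv_iterate_eq_0[OF p(1)] by (simp add: flow_k_0)
  qed
  thus ?thesis by (intro exI[of _ "Suc (fdeg f)"] ext) simp
qed

section \<open>The homological equation\<close>

abbreviation shift_op :: "fnl \<Rightarrow> fnl" where
  "shift_op F \<equiv> Lh_inv (lie ham_k F)"

lemma zero_mean_shift_power: "zero_mean F \<Longrightarrow> zero_mean ((shift_op ^^ j) F)"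
  by (induction j) (auto intro: zero_mean_Lh_inv zero_mean_lie_k)

text \<open>Commutation gathers all factors \<open>lie ham_k\<close> next to \<open>F\<close>, so
  that \<open>shift_op\<close> inherits nilpotency from \<open>lie_k_nilpotent\<close>.\<close>

lemma shift_power_eq: "zero_mean F \<Longrightarrow> (shift_op ^^ j) F = (Lh_inv ^^ j) ((lie ham_k ^^ j) F)"
proof (induction j)
  case (Suc j)
  have zm: "zero_mean ((Lh_inv ^^ i) ((lie ham_k ^^ j') F))" for i j'
  proof (induction i)
    case 0
    show ?case by (induction j') (use Suc.prems in \<open>auto intro: zero_mean_lie_k\<close>)
  qed (auto intro: zero_mean_Lh_inv)
  have comm: "lie ham_k ((Lh_inv ^^ i) ((lie ham_k ^^ j') F)) = (Lh_inv ^^ i) ((lie ham_k ^^ Suc j') F)" for i j'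
    by (induction i) (simp_all add: Lh_inv_lie_k[OF zm, symmetric])
  show ?case using Suc comm[of j j] by simp
qed simp

lemma Lh_inv_zero: "Lh_inv 0 = 0"
  by (simp add: Lh_inv_def fun_eq_iff)

lemma shift_nilpotent:
  assumes "zero_mean F"
  shows "\<exists>d. \<forall>j\<ge>d. (shift_op ^^ j) F = 0"
proof -
  obtain d where d: "(lie ham_k ^^ d) F = 0"
    using lie_k_nilpotent[OF zero_mean_functional[OF assms]] by blast
  have "(Lh_inv ^^ i) 0 = 0" for i
    by (induction i) (simp_all only: funpow.simps comp_apply id_apply Lh_inv_zero)
  hence "(shift_op ^^ d) F = 0" by (simp add: shift_power_eq[OF assms] d)
  hence "(shift_op ^^ (i + d)) F = 0" for i
    by (induction i) (simp_all add: lie_zero[OF is_functional_k] Lh_inv_zero)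
  thus ?thesis by (metis le_add_diff_inverse2)
qed

lemma one_plus_inv_eq:
  assumes "\<And>j. j \<ge> d \<Longrightarrow> (shift_op ^^ j) F = 0"
  shows "one_plus_inv F = (\<Sum>j<d. (\<lambda>z. (- 1) ^ j * (shift_op ^^ j) F z))"
proof (rule ext)
  fix z
  show "one_plus_inv F z = (\<Sum>j<d. (\<lambda>z. (- 1) ^ j * (shift_op ^^ j) F z)) z"
    unfolding one_plus_inv_def fnl_sum_apply
    by (rule suminf_finite) (use assms in auto)
qed

lemma shift_op_sum:
  assumes "\<And>i. i \<in> A \<Longrightarrow> zero_mean (f i)"
  shows "shift_op (\<Sum>i\<in>A. f i) = (\<Sum>i\<in>A. shift_op (f i))"
  using assms
  by (induction A rule: infinite_finite_induct)
     (simp_all add: lie_zero[OF is_functional_k] Lh_inv_zero lie_add[OF is_functional_k] Lh_inv_add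
        zero_mean_functional zero_mean_sum zero_mean_lie_k)

text \<open>The alternating series telescopes to \<open>s 0 - s d\<close>, and \<open>s d\<close>
  vanishes by nilpotency.\<close>

lemma one_plus_inv_inverse:
  assumes F: "zero_mean F"
  shows "zero_mean (one_plus_inv F)" "one_plus_inv F + shift_op (one_plus_inv F) = F"
proof -
  obtain d where d: "\<And>j. j \<ge> d \<Longrightarrow> (shift_op ^^ j) F = 0" using shift_nilpotent[OF F] by blast
  define s where "s j = (\<lambda>z. (- 1) ^ j * (shift_op ^^ j) F z)" for j
  have zm: "zero_mean (s j)" for j unfolding s_def by (intro zero_mean_scale zero_mean_shift_power F)
  have eq: "one_plus_inv F = (\<Sum>j<d. s j)" unfolding s_def by (rule one_plus_inv_eq[OF d])
  show "zero_mean (one_plus_inv F)" unfolding eq by (rule zero_mean_sum[OF zm])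
  have "shift_op (s j) = - s (Suc j)" for j
    unfolding s_def
    by (simp add: lie_scale[OF is_functional_k] Lh_inv_scale zero_mean_functional zero_mean_shift_power F fun_eq_iff)
  hence "one_plus_inv F + shift_op (one_plus_inv F) = (\<Sum>j<d. s j - s (Suc j))"
    unfolding eq shift_op_sum[OF zm] sum.distrib[symmetric] by simp
  also have "\<dots> = s 0 - s d" by (rule sum_lessThan_telescope')
  also have "\<dots> = F" using d[of d] by (simp add: s_def fun_eq_iff)
  finally show "one_plus_inv F + shift_op (one_plus_inv F) = F" .
qed

lemma is_functional_H0: "is_functional ham_H0"
  unfolding ham_H0_def by (intro is_functional_add is_functional_h is_functional_k)

lemma homological_equation:
  assumes F: "is_functional F" and G: "G = one_plus_inv (Lh_inv (F - avg F))"
  shows "zero_mean G" "lie G ham_H0 = avg F - F"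
proof -
  have zm: "zero_mean (F - avg F)" by (rule zero_mean_minus_avg[OF F])
  note inv = one_plus_inv_inverse[OF zero_mean_Lh_inv[OF zm], folded G]
  show zG: "zero_mean G" by (rule inv)
  note fG = zero_mean_functional[OF zG]
  \<comment> \<open>\<open>lie ham_k G\<close> again has zero mean, hence equals
    \<open>lie ham_h\<close> of \<open>shift_op G\<close>; this factors out \<open>lie ham_h\<close>
    and exposes \<open>G + shift_op G\<close>.\<close>
  have "lie ham_h G + lie ham_k G = lie ham_h G + lie ham_h (shift_op G)"
    by (simp add: lie_h_Lh_inv zero_mean_lie_k zG)
  also have "\<dots> = lie ham_h (G + shift_op G)"
    by (rule lie_add[OF is_functional_h fG, symmetric]) (intro zero_mean_functional zero_mean_Lh_inv zero_mean_lie_k zG)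
  also have "\<dots> = F - avg F" unfolding inv(2) by (rule lie_h_Lh_inv[OF zm])
  finally have eq: "lie ham_h G + lie ham_k G = F - avg F" .
  have "lie G ham_H0 = - (lie ham_h G + lie ham_k G)"
    unfolding lie_def ham_H0_def
    using bracket_antisym[OF is_functional_H0 fG] bracket_add_right[OF is_functional_h is_functional_k fG]
    by (simp add: ham_H0_def)
  thus "lie G ham_H0 = avg F - F" unfolding eq by simp
qed

section \<open>Reality\<close>

lemma has_fderiv_real:
  assumes "has_fderiv F c z d" "\<forall>z. F z \<in> \<real>"
  shows "d x \<in> \<real>"
proof -
  have "has_fderiv F c z (\<lambda>x. cnj (d x))"
    unfolding has_fderiv_def
  proof (intro conjI allI)
    show "schwartz (\<lambda>x. cnj (d x))"
      using assms(1) unfolding has_fderiv_def by (auto intro: schwartz_linear[OF bounded_linear_cnj])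
    fix \<eta>
    have "((\<lambda>t. cnj (F (z(c := z c + t *\<^sub>R \<eta>)))) has_vector_derivative
        cnj (\<integral>x. d x * of_real (at_point \<eta> x) \<partial>lborel)) (at 0)"
      using assms(1) unfolding has_fderiv_def
      by (intro bounded_linear.has_vector_derivative[OF bounded_linear_cnj]) auto
    moreover have "cnj (F z) = F z" for z using assms(2) by (simp add: Reals_cnj_iff)
    ultimately show "((\<lambda>t. F (z(c := z c + t *\<^sub>R \<eta>))) has_vector_derivative
        (\<integral>x. cnj (d x) * of_real (at_point \<eta> x) \<partial>lborel)) (at 0)"
      by (simp flip: Bochner_Integration.integral_cnj)
  qed
  from fun_cong[OF has_fderiv_unique[OF assms(1) this], of x] have "d x = cnj (d x)" .
  thus ?thesis by (simp add: Reals_cnj_iff)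
qed

lemma fderiv_real:
  assumes "is_functional F" "\<forall>z. F z \<in> \<real>"
  shows "fderiv F c z x \<in> \<real>"
  using assms by (elim functionalE) (simp add: fderiv_fnl_of has_fderiv_real[OF has_fderiv_fnl_of])

text \<open>For real functionals the derivatives by \<psi> and its conjugate are conjugate to each
  other. The first integrand is then purely imaginary, which the factor \<open>- \<i>\<close>
  compensates.\<close>

lemma bracket_real:
  assumes "is_functional F" "is_functional G" "\<forall>z. F z \<in> \<real>" "\<forall>z. G z \<in> \<real>"
  shows "bracket F G z \<in> \<real>"
proof -
  have c: "cnj (fderiv F c z x) = fderiv F c z x" "cnj (fderiv G c z x) = fderiv G c z x" for c x
    using fderiv_real assms Reals_cnj_iff by blast+
  define f where "f x = fderiv_psi F z x * fderiv_psis G z x - fderiv_psis F z x * fderiv_psi G z x" for x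
  define g where "g x = fderiv F PHI z x * fderiv G PPHI z x - fderiv F PPHI z x * fderiv G PHI z x" for x
  have "cnj (f x) = - f x" for x
    unfolding f_def fderiv_psi_def fderiv_psis_def by (simp add: c)
  hence f: "cnj (integral\<^sup>L lborel f) = - integral\<^sup>L lborel f"
    by (simp flip: Bochner_Integration.integral_cnj)
  have "cnj (g x) = g x" for x unfolding g_def by (simp add: c)
  hence g: "cnj (integral\<^sup>L lborel g) = integral\<^sup>L lborel g"
    by (simp flip: Bochner_Integration.integral_cnj)
  have "bracket F G z = - \<i> * integral\<^sup>L lborel f + integral\<^sup>L lborel g"
    unfolding bracket_def f_def g_def ..
  thus ?thesis by (simp add: f g Reals_cnj_iff)
qed

lemma integral_real:
  fixes f :: "real \<Rightarrow> complex"
  assumes "\<And>s. f s \<in> \<real>"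
  shows "integral S f \<in> \<real>"
proof -
  have "cnj (f s) = f s" for s using assms by (simp add: Reals_cnj_iff)
  thus ?thesis using integral_cnj[of S f] by (simp add: Reals_cnj_iff)
qed

lemma avg_real: "\<forall>z. F z \<in> \<real> \<Longrightarrow> avg F z \<in> \<real>"
  unfolding avg_def by (intro Reals_divide integral_real) auto

lemma Lh_inv_real: "\<forall>z. F z \<in> \<real> \<Longrightarrow> Lh_inv F z \<in> \<real>"
  unfolding Lh_inv_def by (intro Reals_divide integral_real Reals_mult) auto

lemma ham_k_real: "ham_k z \<in> \<real>"
proof -
  have "cnj (ham_k z) = ham_k z" unfolding ham_k_def by (simp flip: Bochner_Integration.integral_cnj add: pphi_def)
  thus ?thesis by (simp add: Reals_cnj_iff)
qed

lemma one_plus_inv_real: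
  assumes F: "zero_mean F" and real: "\<forall>z. F z \<in> \<real>"
  shows "one_plus_inv F z \<in> \<real>"
proof -
  obtain d where d: "\<And>j. j \<ge> d \<Longrightarrow> (shift_op ^^ j) F = 0" using shift_nilpotent[OF F] by blast
  have "\<forall>z. (shift_op ^^ j) F z \<in> \<real>" for j
  proof (induction j)
    case (Suc j)
    have "lie ham_k ((shift_op ^^ j) F) z \<in> \<real>" for z
      unfolding lie_def[of ham_k "(shift_op ^^ j) F"]
      by (intro bracket_real is_functional_k zero_mean_functional zero_mean_shift_power F Suc allI ham_k_real)
    thus ?case by (simp add: Lh_inv_real)
  qed (use real in simp)
  moreover have eq: "one_plus_inv F = (\<Sum>j<d. (\<lambda>z. (- 1) ^ j * (shift_op ^^ j) F z))"
    by (rule one_plus_inv_eq[OF d])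
  ultimately show ?thesis unfolding eq fnl_sum_apply
    by (intro sum_in_Reals Reals_mult Reals_power) auto
qed

section \<open>The Klein-Gordon-Wave system\<close>

definition grad_term :: "var \<Rightarrow> var \<Rightarrow> fterm" where
  "grad_term a b = FPlus (FPlus (IntProd (Deriv 1 (Var a)) (Deriv 1 (Var b)))
     (IntProd (Deriv 2 (Var a)) (Deriv 2 (Var b)))) (IntProd (Deriv 3 (Var a)) (Deriv 3 (Var b)))"

text \<open>\<open>pair_term Psi\<close> and \<open>pair_term Psis\<close> are the components of \<open>H\<^sub>1\<close> of charge \<open>-2\<close> and \<open>2\<close>,
  and \<open>pair_term'\<close> are their images under \<open>L\<^sub>k\<close>.\<close>

definition pair_term :: "var \<Rightarrow> fterm" where
  "pair_term a = FPlus (FScale (1/4) (grad_term a a)) (FScale (1/2) (IntProd (Var Phi) (Times (Var a) (Var a))))"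

definition pair_term' :: "var \<Rightarrow> fterm" where
  "pair_term' a = FScale (1/2) (IntProd (Var PPhi) (Times (Var a) (Var a)))"

text \<open>The charge 0 part of the integrand of \<open>ham_H1\<close>: the two cross terms of each
  expanded square coincide, which doubles 1/4 to 1/2 and 1/2 to 1.\<close>

definition Z1_term :: fterm where
  "Z1_term = FPlus (FPlus (FScale (1/2) (grad_term Phi Phi)) (FScale (1/2) (grad_term Psi Psis)))
     (IntProd (Var Phi) (Times (Var Psi) (Var Psis)))"

lemma charged_FPlus: "charged m (fnl_of f) \<Longrightarrow> charged m (fnl_of g) \<Longrightarrow> charged m (fnl_of (FPlus f g))"
  using charged_add[of m "fnl_of f" "fnl_of g"] by (simp add: fnl_of_def[abs_def] plus_fun_def)

lemma charged_FScale: "charged m (fnl_of f) \<Longrightarrow> charged m (fnl_of (FScale c f))"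
  using charged_scale[of m "fnl_of f" c] by (simp add: fnl_of_def[abs_def])

lemma charged_grad_term:
  assumes "dcharged m (Var a)" "dcharged n (Var b)"
  shows "charged (m + n) (fnl_of (grad_term a b))"
  unfolding grad_term_def by (intro charged_FPlus charged_IntProd dcharged_Deriv assms)

lemma charged_pair_terms:
  assumes "dcharged m (Var a)"
  shows "charged (m + m) (fnl_of (pair_term a))" "charged (m + m) (fnl_of (pair_term' a))"
proof -
  have "dcharged 0 (Var Phi)" "dcharged 0 (Var PPhi)" using dcharged_Var[of Phi] dcharged_Var[of PPhi] by simp_all
  hence "charged (0 + (m + m)) (fnl_of (IntProd (Var Phi) (Times (Var a) (Var a))))"
    "charged (0 + (m + m)) (fnl_of (IntProd (Var PPhi) (Times (Var a) (Var a))))"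
    by (intro charged_IntProd dcharged_Times assms; simp)+
  hence quad: "charged (m + m) (fnl_of (IntProd (Var Phi) (Times (Var a) (Var a))))"
    "charged (m + m) (fnl_of (IntProd (Var PPhi) (Times (Var a) (Var a))))"
    by (simp_all only: add_0)
  show "charged (m + m) (fnl_of (pair_term a))"
    unfolding pair_term_def by (intro charged_FPlus charged_FScale charged_grad_term assms quad)
  show "charged (m + m) (fnl_of (pair_term' a))"
    unfolding pair_term'_def by (intro charged_FScale quad)
qed

lemma charged_pair_Psi: "charged (- 2) (fnl_of (pair_term Psi))" "charged (- 2) (fnl_of (pair_term' Psi))"
  and charged_pair_Psis: "charged 2 (fnl_of (pair_term Psis))" "charged 2 (fnl_of (pair_term' Psis))"
  using charged_pair_terms[OF dcharged_Var[of Psi]] charged_pair_terms[OF dcharged_Var[of Psis]] by simp_all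

lemma charged_Z1_term: "charged 0 (fnl_of Z1_term)"
proof -
  have d: "dcharged 0 (Var Phi)" "dcharged (-1) (Var Psi)" "dcharged 1 (Var Psis)"
    using dcharged_Var[of Phi] dcharged_Var[of Psi] dcharged_Var[of Psis] by simp_all
  have "charged 0 (fnl_of (IntProd (Var Phi) (Times (Var Psi) (Var Psis))))"
    using charged_IntProd[OF d(1) dcharged_Times[OF d(2,3)]] by simp
  thus ?thesis unfolding Z1_term_def
    using charged_grad_term[OF d(1) d(1)] charged_grad_term[OF d(2,3)]
    by (auto intro!: charged_FPlus charged_FScale)
qed

lemma val_grad_term: "val (grad_term a b) w = intg (\<Sum>i\<in>UNIV. D i (w a) * D i (w b))"
  by (simp add: grad_term_def sum_3)

lemma fun_of_sum: "fun_of (\<Sum>i\<in>A. f i) x = (\<Sum>i\<in>A. fun_of (f i) x)"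
  by (induction A rule: infinite_finite_induct) simp_all

lemma cnj_pd_psi: "cnj (pd i (psi z) x) = pd i (psis z) x" "cnj (pd i (psis z) x) = pd i (psi z) x"
proof -
  have d: "psi z differentiable (at x)" "psis z differentiable (at x)"
    by (metis fun_of_fields(1) schwartz_differentiable schwartz_fun_of,
        metis fun_of_fields(2) schwartz_differentiable schwartz_fun_of)
  show "cnj (pd i (psi z) x) = pd i (psis z) x" "cnj (pd i (psis z) x) = pd i (psi z) x"
    using pd_linear[OF bounded_linear_cnj d(1), of i] pd_linear[OF bounded_linear_cnj d(2), of i]
    by (simp_all add: cnj_psi)
qed

lemma cnj_pd_phi: "cnj (pd i (phi z) x) = pd i (phi z) x"
proof -
  have d: "phi z differentiable (at x)"
    by (metis fun_of_fields(3) schwartz_differentiable schwartz_fun_of)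
  have "(\<lambda>x. cnj (phi z x)) = phi z" by (simp add: phi_def fun_eq_iff)
  thus ?thesis using pd_linear[OF bounded_linear_cnj d, of i] by simp
qed

lemma H1_eq: "ham_H1 = fnl_of Z1_term + (fnl_of (pair_term Psi) + fnl_of (pair_term Psis))"
proof (rule ext)
  fix z
  define w where "w = fields_of z"
  \<comment> \<open>The integrand as an element of \<open>cfield\<close>: conjugation has become the
    exchange of \<open>Psi\<close> and \<open>Psis\<close>, and the rest is ring algebra.\<close>
  define E where "E = scaleC (1/4) (\<Sum>i\<in>UNIV. (D i (w Psi) + D i (w Psis)) * (D i (w Psis) + D i (w Psi)))
    + scaleC (1/2) (\<Sum>i\<in>UNIV. D i (w Phi) * D i (w Phi))
    + scaleC (1/2) (w Phi * ((w Psi + w Psis) * (w Psi + w Psis)))"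
  have "ham_H1 z = intg E" unfolding ham_H1_def
    by (rule intg_eqI)
       (simp add: E_def w_def fun_of_sum fun_of_fields vabs2_def bdot_def grad_def cnj_pd_psi cnj_pd_phi
          power2_eq_square del: fields_of.simps)
  also have "\<dots> = (fnl_of Z1_term + (fnl_of (pair_term Psi) + fnl_of (pair_term Psis))) z"
    by (simp add: E_def fnl_of_def w_def[symmetric] Z1_term_def pair_term_def val_grad_term intg_sum sum_3 algebra_simps)
  finally show "ham_H1 z = (fnl_of Z1_term + (fnl_of (pair_term Psi) + fnl_of (pair_term Psis))) z" .
qed

lemma Z1_explicit:
  "fnl_of Z1_term z = (\<integral>x. vabs2 (grad (phi z) x) / 2 + vabs2 (grad (psi z) x) / 2 + phi z x * abs2 (psi z x) \<partial>lborel)"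
proof -
  define w where "w = fields_of z"
  define E where "E = scaleC (1/2) (\<Sum>i\<in>UNIV. D i (w Phi) * D i (w Phi))
    + scaleC (1/2) (\<Sum>i\<in>UNIV. D i (w Psi) * D i (w Psis)) + w Phi * (w Psi * w Psis)"
  have "(\<integral>x. vabs2 (grad (phi z) x) / 2 + vabs2 (grad (psi z) x) / 2 + phi z x * abs2 (psi z x) \<partial>lborel) = intg E"
    by (rule intg_eqI)
       (simp add: E_def w_def fun_of_sum fun_of_fields vabs2_def bdot_def grad_def cnj_pd_psi cnj_pd_phi
          abs2_def cnj_psi del: fields_of.simps)
  also have "\<dots> = fnl_of Z1_term z"
    by (simp add: E_def fnl_of_def w_def[symmetric] Z1_term_def val_grad_term)
  finally show ?thesis by simp
qed

text \<open>Charge -2 makes \<open>Lh_inv\<close> the division by \<open>-2 * \<i>\<close>, that is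
  multiplication by \<open>\<i>/2\<close>. The second Neumann term has coefficient
  \<open>- (\<i>/2)^2 = 1/4\<close>. In \<open>G_plus\<close> the charge is 2 and
  \<open>\<i>/2\<close> changes sign, its square does not.\<close>

definition G_minus :: fterm where
  "G_minus = FPlus (FScale (\<i>/2) (pair_term Psi)) (FScale (1/4) (pair_term' Psi))"

definition G_plus :: fterm where
  "G_plus = FPlus (FScale (- \<i>/2) (pair_term Psis)) (FScale (1/4) (pair_term' Psis))"

lemma G1_explicit:
  "(fnl_of G_minus + fnl_of G_plus) z =
    (\<integral>x. (\<i>/8) * (bdot (grad (psi z) x) (grad (psi z) x) - bdot (grad (psis z) x) (grad (psis z) x))
        + (\<i>/4) * (phi z x * ((psi z x)\<^sup>2 - (psis z x)\<^sup>2))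
        + (1/8) * (pphi z x * ((psi z x)\<^sup>2 + (psis z x)\<^sup>2)) \<partial>lborel)"
proof -
  define w where "w = fields_of z"
  define E where "E = scaleC (\<i>/8) ((\<Sum>i\<in>UNIV. D i (w Psi) * D i (w Psi)) - (\<Sum>i\<in>UNIV. D i (w Psis) * D i (w Psis)))
    + scaleC (\<i>/4) (w Phi * (w Psi * w Psi - w Psis * w Psis))
    + scaleC (1/8) (w PPhi * (w Psi * w Psi + w Psis * w Psis))"
  have "(\<integral>x. (\<i>/8) * (bdot (grad (psi z) x) (grad (psi z) x) - bdot (grad (psis z) x) (grad (psis z) x))
        + (\<i>/4) * (phi z x * ((psi z x)\<^sup>2 - (psis z x)\<^sup>2))
        + (1/8) * (pphi z x * ((psi z x)\<^sup>2 + (psis z x)\<^sup>2)) \<partial>lborel) = intg E"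
    by (rule intg_eqI)
       (simp add: E_def w_def fun_of_sum fun_of_fields bdot_def grad_def power2_eq_square del: fields_of.simps)
  also have "\<dots> = (fnl_of G_minus + fnl_of G_plus) z"
    by (simp add: E_def fnl_of_def w_def[symmetric] G_minus_def G_plus_def pair_term_def pair_term'_def
        val_grad_term algebra_simps)
  finally show ?thesis by simp
qed

lemma lie_k_pair_term: "a \<in> {Psi, Psis} \<Longrightarrow> lie ham_k (fnl_of (pair_term a)) = fnl_of (pair_term' a)"
  by (rule ext)
     (auto simp: lie_def ham_k_eq bracket_fnl_of br_dval ham_field_k fnl_of_def pair_term_def pair_term'_def
        grad_term_def simp del: ham_field.simps fields_of.simps)

lemma lie_k_pair_term': "a \<in> {Psi, Psis} \<Longrightarrow> lie ham_k (fnl_of (pair_term' a)) = 0"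
  by (rule ext)
     (auto simp: lie_def ham_k_eq bracket_fnl_of br_dval ham_field_k pair_term'_def
        simp del: ham_field.simps fields_of.simps)

text \<open>The oscillating part of \<open>ham_H1\<close> is affine in \<phi>, so for
  \<open>G1\<close> the Neumann series stops after its second term.\<close>

lemma one_plus_inv_two_terms:
  assumes "zero_mean F" "lie ham_k (lie ham_k F) = 0"
  shows "one_plus_inv F = F - shift_op F"
proof -
  have "shift_op (shift_op F) = 0"
    using Lh_inv_lie_k[OF zero_mean_lie_k[OF assms(1)]] assms(2) by (simp add: Lh_inv_zero)
  hence "(shift_op ^^ Suc (Suc i)) F = 0" for i
    by (induction i) (simp_all add: lie_zero[OF is_functional_k] Lh_inv_zero)
  hence "(shift_op ^^ j) F = 0" if "j \<ge> 2" for j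
    using le_Suc_ex[OF that] by auto
  from one_plus_inv_eq[OF this] show ?thesis by (simp add: numeral_2_eq_2 fun_eq_iff fnl_sum_apply)
qed

lemma avg_H1: "avg ham_H1 = fnl_of Z1_term"
  and H1_minus_avg: "ham_H1 - avg ham_H1 = fnl_of (pair_term Psi) + fnl_of (pair_term Psis)"
proof -
  have "zero_mean (fnl_of (pair_term Psi) + fnl_of (pair_term Psis))"
    by (intro zero_mean.intros(2) zero_mean.base[OF charged_pair_Psi(1)] zero_mean.base[OF charged_pair_Psis(1)]) simp_all
  thus "avg ham_H1 = fnl_of Z1_term" unfolding H1_eq by (rule avg_split[OF charged_Z1_term])
  thus "ham_H1 - avg ham_H1 = fnl_of (pair_term Psi) + fnl_of (pair_term Psis)" unfolding H1_eq by simp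
qed

lemma G1_eq: "one_plus_inv (Lh_inv (ham_H1 - avg ham_H1)) = fnl_of G_minus + fnl_of G_plus"
proof -
  let ?A = "fnl_of (pair_term Psi)" and ?B = "fnl_of (pair_term Psis)"
  let ?A' = "fnl_of (pair_term' Psi)" and ?B' = "fnl_of (pair_term' Psis)"
  note fn = is_functional_fnl_of
  define P where "P = (\<lambda>z. (\<i>/2) * ?A z) + (\<lambda>z. (-\<i>/2) * ?B z)"
  have P: "Lh_inv (ham_H1 - avg ham_H1) = P"
    unfolding H1_minus_avg Lh_inv_add[OF fn fn] Lh_inv_charged[OF charged_pair_Psi(1), simplified]
      Lh_inv_charged[OF charged_pair_Psis(1), simplified] P_def by (simp add: fun_eq_iff field_simps)
  have lP: "lie ham_k P = (\<lambda>z. (\<i>/2) * ?A' z) + (\<lambda>z. (-\<i>/2) * ?B' z)"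
    unfolding P_def lie_add[OF is_functional_k is_functional_scale[OF fn] is_functional_scale[OF fn]]
      lie_scale[OF is_functional_k fn] by (simp add: lie_k_pair_term)
  have llP: "lie ham_k (lie ham_k P) = 0"
    unfolding lP lie_add[OF is_functional_k is_functional_scale[OF fn] is_functional_scale[OF fn]]
      lie_scale[OF is_functional_k fn] by (simp add: lie_k_pair_term' fun_eq_iff)
  have zP: "zero_mean P"
    unfolding P_def by (intro zero_mean.intros(2) zero_mean_scale zero_mean.base[OF charged_pair_Psi(1)]
        zero_mean.base[OF charged_pair_Psis(1)]) simp_all
  have "shift_op P = (\<lambda>z. (-1/4) * ?A' z) + (\<lambda>z. (-1/4) * ?B' z)"
    unfolding lP Lh_inv_add[OF is_functional_scale[OF fn] is_functional_scale[OF fn]] Lh_inv_scale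
      Lh_inv_charged[OF charged_pair_Psi(2), simplified] Lh_inv_charged[OF charged_pair_Psis(2), simplified]
    by (simp add: fun_eq_iff field_simps)
  hence "one_plus_inv P = P - ((\<lambda>z. (-1/4) * ?A' z) + (\<lambda>z. (-1/4) * ?B' z))"
    using one_plus_inv_two_terms[OF zP llP] by simp
  thus ?thesis unfolding P
    by (simp add: P_def fun_eq_iff fnl_of_def G_minus_def G_plus_def)
qed

section \<open>The explicit second-order term\<close>

definition lap :: "cfield \<Rightarrow> cfield" where
  "lap f = (\<Sum>i\<in>UNIV. D i (D i f))"

lemma fun_of_lap: "fun_of (lap f) x = laplacian (fun_of f) x"
  by (simp add: lap_def laplacian_def fun_of_sum fun_of_D)

text \<open>Both factors of each square contribute equally to the gradient, so 1/4 of the squared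
  gradient gives, after integration by parts, -1/2 of the Laplacian. The facts \<open>half\<close>
  and \<open>half'\<close> merge these equal contributions.\<close>

lemma grd_pair_term:
  assumes "a \<in> {Psi, Psis}"
  shows "grd (pair_term a) a w = w Phi * w a - scaleC (1/2) (lap (w a))"
    "grd (pair_term a) Phi w = scaleC (1/2) (w a * w a)"
    "b \<notin> {a, Phi} \<Longrightarrow> grd (pair_term a) b w = 0"
    "grd (pair_term' a) a w = w PPhi * w a"
    "grd (pair_term' a) PPhi w = scaleC (1/2) (w a * w a)"
    "b \<notin> {a, PPhi} \<Longrightarrow> grd (pair_term' a) b w = 0"
proof -
  have half: "scaleC (1/2) f + scaleC (1/2) f = f" "scaleC (1/4) f + scaleC (1/4) f = scaleC (1/2) f" for f
    by (simp_all add: scaleC_distrib(3)[symmetric])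
  have half': "scaleC (1/2) (f + f) = f" "scaleC (1/4) (f + f) = scaleC (1/2) f" for f
    by (simp_all add: scaleC_distrib half)
  show "grd (pair_term a) a w = w Phi * w a - scaleC (1/2) (lap (w a))"
    "grd (pair_term a) Phi w = scaleC (1/2) (w a * w a)"
    "b \<notin> {a, Phi} \<Longrightarrow> grd (pair_term a) b w = 0"
    "grd (pair_term' a) a w = w PPhi * w a"
    "grd (pair_term' a) PPhi w = scaleC (1/2) (w a * w a)"
    "b \<notin> {a, PPhi} \<Longrightarrow> grd (pair_term' a) b w = 0"
    using assms
    by (auto simp: pair_term_def pair_term'_def grad_term_def lap_def sum_3 half' scaleC_distrib half algebra_simps)
qed

text \<open>With X = \<phi> \<psi> - (1/2) \<Delta>\<psi> and Y its conjugate, the bracket in \<psi>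
  contributes -1/2 times the integral of X Y, which accounts for the coefficients -1/8, 1/4 and
  -1/2. In the terms with \<open>p\<^sub>\<phi>\<close> the parts containing \<phi> cancel between
  the two brackets and \<open>\<i>/16\<close> remains. The bracket in \<phi> and its momentum gives
  (1/2) (1/4) (1/2) = 1/16 twice, and the outer 1/2 averages the two.\<close>

lemma Z2_explicit:
  "(1/2) * (br (pair_term Psi) G_plus (fields_of z) + br (pair_term Psis) G_minus (fields_of z)) =
     - (1/8) * (\<integral>x. abs2 (laplacian (psi z) x) \<partial>lborel)
        + (1/4) * (\<integral>x. phi z x * (psis z x * laplacian (psi z) x + psi z x * laplacian (psis z) x) \<partial>lborel)
        + (\<i>/16) * (\<integral>x. pphi z x * (psis z x * laplacian (psi z) x - psi z x * laplacian (psis z) x) \<partial>lborel)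
        - (1/2) * (\<integral>x. (phi z x)\<^sup>2 * abs2 (psi z x) \<partial>lborel)
        + (1/16) * (\<integral>x. (abs2 (psi z x))\<^sup>2 \<partial>lborel)"
proof -
  define w where "w = fields_of z"
  have cnj_lap: "cnj (laplacian (psi z) x) = laplacian (psis z) x" for x
  proof -
    have "pd i (psi z) differentiable (at x)" for i x
      by (metis fun_of_fields(1) schwartz_differentiable schwartz_fun_of schwartz_pd)
    from pd_linear[OF bounded_linear_cnj this] show ?thesis
      by (simp add: laplacian_def cnj_pd_psi)
  qed
  have I: "(\<integral>x. abs2 (laplacian (psi z) x) \<partial>lborel) = intg (lap (w Psi) * lap (w Psis))"
    "(\<integral>x. phi z x * (psis z x * laplacian (psi z) x + psi z x * laplacian (psis z) x) \<partial>lborel) =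
      intg (w Phi * (w Psis * lap (w Psi) + w Psi * lap (w Psis)))"
    "(\<integral>x. pphi z x * (psis z x * laplacian (psi z) x - psi z x * laplacian (psis z) x) \<partial>lborel) =
      intg (w PPhi * (w Psis * lap (w Psi) - w Psi * lap (w Psis)))"
    "(\<integral>x. (phi z x)\<^sup>2 * abs2 (psi z x) \<partial>lborel) = intg (w Phi * w Phi * (w Psi * w Psis))"
    "(\<integral>x. (abs2 (psi z x))\<^sup>2 \<partial>lborel) = intg (w Psi * w Psis * (w Psi * w Psis))"
    by (rule intg_eqI, simp add: w_def fun_of_lap fun_of_fields abs2_def cnj_psi cnj_lap power2_eq_square
         del: fields_of.simps)+
  have 1: "br (pair_term Psi) G_plus w = - \<i> * intg ((w Phi * w Psi - scaleC (1/2) (lap (w Psi))) *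
      (scaleC (- \<i>/2) (w Phi * w Psis - scaleC (1/2) (lap (w Psis))) + scaleC (1/4) (w PPhi * w Psis)))
      + (1/16) * intg (w Psi * w Psi * (w Psis * w Psis))"
    by (simp add: br_def G_plus_def grd_pair_term)
  have 2: "br (pair_term Psis) G_minus w = \<i> * intg ((w Phi * w Psis - scaleC (1/2) (lap (w Psis))) *
      (scaleC (\<i>/2) (w Phi * w Psi - scaleC (1/2) (lap (w Psi))) + scaleC (1/4) (w PPhi * w Psi)))
      + (1/16) * intg (w Psis * w Psis * (w Psi * w Psi))"
    by (simp add: br_def G_minus_def grd_pair_term)
  show ?thesis unfolding I w_def[symmetric] 1 2
    by (simp add: scaleC_distrib algebra_simps)
qed

text \<open>By \<open>hom\<close>, \<open>F\<close> is the Lie derivative along \<open>G1\<close> of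
  the average of \<open>ham_H1\<close> plus half of its oscillating part; sorting the resulting
  brackets by charge leaves the two mixed ones.\<close>

lemma avg_second_order:
  assumes G1: "G1 = fnl_of G_minus + fnl_of G_plus"
    and F: "F = lie G1 ham_H1 + (\<lambda>z. (1/2) * lie G1 (lie G1 ham_H0) z)"
    and hom: "lie G1 ham_H0 = avg ham_H1 - ham_H1"
  shows "avg F = (\<lambda>z. (1/2) * (br (pair_term Psi) G_plus (fields_of z) + br (pair_term Psis) G_minus (fields_of z)))"
proof -
  let ?A = "fnl_of (pair_term Psi)" and ?B = "fnl_of (pair_term Psis)" and ?Z = "fnl_of Z1_term"
  let ?m = "fnl_of G_minus" and ?p = "fnl_of G_plus"
  note fn = is_functional_fnl_of
  have cm: "charged (- 2) ?m" and cp: "charged 2 ?p"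
    unfolding G_minus_def G_plus_def by (intro charged_FPlus charged_FScale charged_pair_Psi charged_pair_Psis)+
  have fG: "is_functional G1" unfolding G1 by (intro is_functional_add fn)
  have "avg ham_H1 - ham_H1 = (\<lambda>z. (- 1) * (?A + ?B) z)"
    using H1_minus_avg by (simp add: fun_eq_iff) (metis minus_diff_eq minus_add_distrib diff_conv_add_uminus)
  hence "lie G1 (lie G1 ham_H0) = (\<lambda>z. (- 1) * lie G1 (?A + ?B) z)"
    unfolding hom by (simp only: lie_scale[OF fG is_functional_add[OF fn fn]])
  moreover have "lie G1 ham_H1 = lie G1 ?Z + lie G1 (?A + ?B)"
    unfolding H1_eq by (rule lie_add[OF fG fn is_functional_add[OF fn fn]])
  ultimately have "F = lie G1 ?Z + (\<lambda>z. (1/2) * lie G1 (?A + ?B) z)"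
    unfolding F by (simp add: fun_eq_iff)
  also have "\<dots> = (\<lambda>z. (1/2) * (bracket ?A ?p + bracket ?B ?m) z) + ((bracket ?Z ?m + bracket ?Z ?p)
      + ((\<lambda>z. (1/2) * bracket ?A ?m z) + (\<lambda>z. (1/2) * bracket ?B ?p z)))"
    unfolding G1 lie_def
    by (simp add: bracket_add_left bracket_add_right is_functional_add fn fun_eq_iff algebra_simps)
  finally have F': "F = (\<lambda>z. (1/2) * (bracket ?A ?p + bracket ?B ?m) z) + ((bracket ?Z ?m + bracket ?Z ?p)
      + ((\<lambda>z. (1/2) * bracket ?A ?m z) + (\<lambda>z. (1/2) * bracket ?B ?p z)))" .
  have "charged 0 (\<lambda>z. (1/2) * (bracket ?A ?p + bracket ?B ?m) z)"
    using charged_bracket[OF charged_pair_Psi(1) cp] charged_bracket[OF charged_pair_Psis(1) cm]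
    by (intro charged_scale charged_add) simp_all
  \<comment> \<open>The charges of these four brackets are -2, 2, -4 and 4.\<close>
  moreover have "zero_mean ((bracket ?Z ?m + bracket ?Z ?p)
      + ((\<lambda>z. (1/2) * bracket ?A ?m z) + (\<lambda>z. (1/2) * bracket ?B ?p z)))"
    by (intro zero_mean.intros(2) zero_mean_scale zero_mean.base[OF charged_bracket[OF charged_Z1_term cm]]
        zero_mean.base[OF charged_bracket[OF charged_Z1_term cp]]
        zero_mean.base[OF charged_bracket[OF charged_pair_Psi(1) cm]]
        zero_mean.base[OF charged_bracket[OF charged_pair_Psis(1) cp]]) simp_all
  ultimately have "avg F = (\<lambda>z. (1/2) * (bracket ?A ?p + bracket ?B ?m) z)"
    unfolding F' by (rule avg_split)
  thus ?thesis by (simp add: bracket_fnl_of fun_eq_iff)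
qed

section \<open>Reality of the Hamiltonians and assembly of the normal form\<close>

lemma ham_h_real: "ham_h z \<in> \<real>"
proof -
  have "cnj (ham_h z) = ham_h z"
    unfolding ham_h_def by (simp flip: Bochner_Integration.integral_cnj add: abs2_def mult.commute)
  thus ?thesis by (simp add: Reals_cnj_iff)
qed

lemma ham_H0_real: "ham_H0 z \<in> \<real>"
  unfolding ham_H0_def by (simp add: ham_h_real ham_k_real)

lemma ham_H1_real: "ham_H1 z \<in> \<real>"
proof -
  have "cnj (vabs2 v) = vabs2 v" for v by (simp add: vabs2_def bdot_def mult.commute)
  moreover have "cnj (phi z x) = phi z x" for x by (simp add: phi_def)
  ultimately have "cnj (ham_H1 z) = ham_H1 z"
    unfolding ham_H1_def by (simp flip: Bochner_Integration.integral_cnj add: cnj_psi add.commute)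
  thus ?thesis by (simp add: Reals_cnj_iff)
qed

lemma ham_H_nth: "fps_nth ham_H n = (if n = 0 then ham_H0 else if n = 1 then ham_H1 else 0)"
  by (cases n) (auto simp: ham_H_def)

theorem theorem1:
  shows "\<exists>G1 G2 F2 Z1 Z2 :: fnl. \<exists>R3 :: fnl fps. \<exists>C_inv :: fnl fps \<Rightarrow> fnl fps.
    is_hamiltonian G1 \<and> is_hamiltonian G2 \<and>
    G1 = one_plus_inv (Lh_inv (ham_H1 - avg ham_H1)) \<and>
    F2 = lie G1 ham_H1 + (\<lambda>z. (1/2) * lie G1 (lie G1 ham_H0) z) \<and>
    G2 = one_plus_inv (Lh_inv (F2 - avg F2)) \<and>
    C_inv = (\<lambda>A. lie_exp 2 G2 (lie_exp 1 G1 A)) \<and>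
    canonical C_inv \<and>
    C_inv ham_H = fps_const ham_H0 + fps_const Z1 * fps_X + fps_const Z2 * fps_X ^ 2 + R3 \<and>
    bracket ham_h ham_k = 0 \<and> bracket Z1 ham_h = 0 \<and> bracket Z2 ham_h = 0 \<and>
    of_order 3 R3 \<and>
    Z1 = avg ham_H1 \<and> Z2 = avg F2 \<and>
    Z1 = (\<lambda>z. \<integral>x. vabs2 (grad (phi z) x) / 2 + vabs2 (grad (psi z) x) / 2
                  + phi z x * abs2 (psi z x) \<partial>lborel) \<and>
    Z2 = (\<lambda>z. - (1/8) * (\<integral>x. abs2 (laplacian (psi z) x) \<partial>lborel)
        + (1/4) * (\<integral>x. phi z x * (psis z x * laplacian (psi z) x + psi z x * laplacian (psis z) x) \<partial>lborel)
        + (\<i>/16) * (\<integral>x. pphi z x * (psis z x * laplacian (psi z) x - psi z x * laplacian (psis z) x) \<partial>lborel)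
        - (1/2) * (\<integral>x. (phi z x)\<^sup>2 * abs2 (psi z x) \<partial>lborel)
        + (1/16) * (\<integral>x. (abs2 (psi z x))\<^sup>2 \<partial>lborel)) \<and>
    G1 = (\<lambda>z. \<integral>x. (\<i>/8) * (bdot (grad (psi z) x) (grad (psi z) x) - bdot (grad (psis z) x) (grad (psis z) x))
        + (\<i>/4) * (phi z x * ((psi z x)\<^sup>2 - (psis z x)\<^sup>2))
        + (1/8) * (pphi z x * ((psi z x)\<^sup>2 + (psis z x)\<^sup>2)) \<partial>lborel)"
proof -
  define G1 where "G1 = one_plus_inv (Lh_inv (ham_H1 - avg ham_H1))"
  define F2 where "F2 = lie G1 ham_H1 + (\<lambda>z. (1/2) * lie G1 (lie G1 ham_H0) z)"
  define G2 where "G2 = one_plus_inv (Lh_inv (F2 - avg F2))"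
  define C where "C = (\<lambda>A. lie_exp 2 G2 (lie_exp 1 G1 A))"
  \<comment> \<open>The remainder \<open>R3\<close> will be the difference
    \<open>C ham_H - N\<close>, so only the coefficients of order 0, 1 and 2 have to be
    computed.\<close>
  define N where "N = fps_const ham_H0 + fps_const (avg ham_H1) * fps_X + fps_const (avg F2) * fps_X ^ 2"
  have fH1: "is_functional ham_H1" unfolding H1_eq by (intro is_functional_add is_functional_fnl_of)
  note hom1 = homological_equation[OF fH1 G1_def]
  have fG1: "is_functional G1" by (rule zero_mean_functional[OF hom1(1)])
  have fF2: "is_functional F2"
    unfolding F2_def by (intro is_functional_add is_functional_scale is_functional_lie fG1 fH1 is_functional_H0)
  note hom2 = homological_equation[OF fF2 G2_def]
  have fG2: "is_functional G2" by (rule zero_mean_functional[OF hom2(1)])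
  have rG1: "\<forall>z. G1 z \<in> \<real>"
    unfolding G1_def
    by (intro allI one_plus_inv_real zero_mean_Lh_inv zero_mean_minus_avg fH1 Lh_inv_real)
       (simp add: ham_H1_real avg_real)
  have rlie: "\<forall>z. lie G1 F z \<in> \<real>" if "is_functional F" "\<forall>z. F z \<in> \<real>" for F
    unfolding lie_def using bracket_real[OF that(1) fG1 that(2) rG1] by blast
  have rF2: "\<forall>z. F2 z \<in> \<real>"
  proof -
    have "\<forall>z. lie G1 (lie G1 ham_H0) z \<in> \<real>"
      by (intro rlie is_functional_lie fG1 is_functional_H0 allI ham_H0_real)
    thus ?thesis using rlie[OF fH1] unfolding F2_def by (simp add: ham_H1_real)
  qed
  have rG2: "\<forall>z. G2 z \<in> \<real>"
    unfolding G2_def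
    by (intro allI one_plus_inv_real zero_mean_Lh_inv zero_mean_minus_avg fF2 Lh_inv_real)
       (simp add: rF2 avg_real)
  \<comment> \<open>At order 1 the coefficient is \<open>ham_H1 + lie G1 ham_H0\<close>, which the
    first homological equation reduces to the average; at order 2 it is \<open>F2\<close> by
    definition.\<close>
  have l1: "fps_nth (lie_exp 1 G1 ham_H) 0 = ham_H0"
    "fps_nth (lie_exp 1 G1 ham_H) 1 = avg ham_H1"
    "fps_nth (lie_exp 1 G1 ham_H) 2 = F2"
  proof -
    have s: "{j. 1 * j \<le> (0::nat)} = {0}" "{j. 1 * j \<le> (1::nat)} = {0, 1}" "{j. 1 * j \<le> (2::nat)} = {0, 1, 2}"
      by auto
    show "fps_nth (lie_exp 1 G1 ham_H) 0 = ham_H0"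
      unfolding lie_exp_nth s by (simp add: ham_H_nth del: One_nat_def)
    show "fps_nth (lie_exp 1 G1 ham_H) 1 = avg ham_H1"
      unfolding lie_exp_nth s by (simp add: ham_H_nth lie_div_power_1 hom1(2) del: One_nat_def)
    show "fps_nth (lie_exp 1 G1 ham_H) 2 = F2"
      unfolding lie_exp_nth s
      by (simp add: ham_H_nth lie_div_power_def[abs_def] F2_def fun_eq_iff numeral_2_eq_2)
  qed
  \<comment> \<open>\<open>G2\<close> enters with \<epsilon> squared, so orders 0 and 1 are
    unchanged, and at order 2 it adds \<open>lie G2 ham_H0 = avg F2 - F2\<close>.\<close>
  have l2: "fps_nth (C ham_H) 0 = ham_H0" "fps_nth (C ham_H) 1 = avg ham_H1" "fps_nth (C ham_H) 2 = avg F2"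
  proof -
    have s: "{j. 2 * j \<le> (0::nat)} = {0}" "{j. 2 * j \<le> (1::nat)} = {0}" "{j. 2 * j \<le> (2::nat)} = {0, 1}"
      by auto
    show "fps_nth (C ham_H) 0 = ham_H0" "fps_nth (C ham_H) 1 = avg ham_H1"
      unfolding C_def lie_exp_nth[of 2] s by (simp_all add: l1 del: One_nat_def)
    show "fps_nth (C ham_H) 2 = avg F2"
      unfolding C_def lie_exp_nth[of 2] s by (simp add: l1 lie_div_power_1 hom2(2) del: One_nat_def)
  qed
  have N: "fps_nth N n = (if n = 0 then ham_H0 else if n = 1 then avg ham_H1 else if n = 2 then avg F2 else 0)" for n
    by (auto simp: N_def fps_X_power_mult_right_nth)
  have c0: "charged 0 (avg ham_H1)" "charged 0 (avg F2)" by (intro charged_avg fH1 fF2)+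
  have "fps_nth (C ham_H - N) j = 0" if "j < 3" for j
  proof -
    have "j = 0 \<or> j = 1 \<or> j = 2" using that by auto
    thus ?thesis using l2 N by auto
  qed
  moreover have "is_functional (fps_nth (C ham_H - N) j)" for j
  proof -
    have "is_functional (fps_nth ham_H n)" for n
      by (simp add: ham_H_nth is_functional_H0 fH1 is_functional_zero)
    hence "is_functional (fps_nth (C ham_H) j)"
      unfolding C_def by (intro is_functional_lie_exp fG1 fG2)
    moreover have "is_functional (fps_nth N j)"
      unfolding N by (simp add: is_functional_H0 c0[THEN charged_functional] is_functional_zero)
    ultimately show ?thesis by (simp add: is_functional_diff)
  qed
  ultimately have "of_order 3 (C ham_H - N)" unfolding of_order_def by blast
  moreover have "C ham_H = fps_const ham_H0 + fps_const (avg ham_H1) * fps_X + fps_const (avg F2) * fps_X ^ 2 + (C ham_H - N)"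
    by (simp add: N_def)
  moreover have "bracket (avg ham_H1) ham_h = 0" "bracket (avg F2) ham_h = 0"
    using c0 unfolding charged_def lie_def by (auto simp: zero_fun_def)
  moreover have "canonical C" unfolding C_def by (rule canonical_lie_exp) (use fG1 fG2 in auto)
  moreover have "is_hamiltonian G1" "is_hamiltonian G2"
    unfolding is_hamiltonian_def using fG1 fG2 rG1 rG2 by auto
  moreover note G1' = G1_eq[folded G1_def]
  moreover have "avg F2 = (\<lambda>z. - (1/8) * (\<integral>x. abs2 (laplacian (psi z) x) \<partial>lborel)
        + (1/4) * (\<integral>x. phi z x * (psis z x * laplacian (psi z) x + psi z x * laplacian (psis z) x) \<partial>lborel)
        + (\<i>/16) * (\<integral>x. pphi z x * (psis z x * laplacian (psi z) x - psi z x * laplacian (psis z) x) \<partial>lborel)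
        - (1/2) * (\<integral>x. (phi z x)\<^sup>2 * abs2 (psi z x) \<partial>lborel)
        + (1/16) * (\<integral>x. (abs2 (psi z x))\<^sup>2 \<partial>lborel))"
    unfolding avg_second_order[OF G1' F2_def hom1(2)] Z2_explicit ..
  moreover have "avg ham_H1 = (\<lambda>z. \<integral>x. vabs2 (grad (phi z) x) / 2 + vabs2 (grad (psi z) x) / 2
                  + phi z x * abs2 (psi z x) \<partial>lborel)"
    unfolding avg_H1 by (rule ext) (rule Z1_explicit)
  moreover have "G1 = (\<lambda>z. \<integral>x. (\<i>/8) * (bdot (grad (psi z) x) (grad (psi z) x) - bdot (grad (psis z) x) (grad (psis z) x))
        + (\<i>/4) * (phi z x * ((psi z x)\<^sup>2 - (psis z x)\<^sup>2))
        + (1/8) * (pphi z x * ((psi z x)\<^sup>2 + (psis z x)\<^sup>2)) \<partial>lborel)"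
    unfolding G1' by (rule ext) (rule G1_explicit)
  ultimately show ?thesis
    using bracket_h_k G1_def F2_def G2_def C_def
    by (intro exI[of _ G1] exI[of _ G2] exI[of _ F2] exI[of _ "avg ham_H1"] exI[of _ "avg F2"]
        exI[of _ "C ham_H - N"] exI[of _ C] conjI) (assumption | rule refl)+
qed

end
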